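(* Let $H$ be a real-analytic $2$-nondegenerate CR structure of hypersurface type with Levi kernel $K$ of constant rank $1$. If the symbol of $H$ at a point $p$ is not regular, then the CR structure $H$ is recoverable in some neighborhood of $p$, that is, $H$ is uniquely determined by the dynamical Legendrian contact structure associated with the germ of $H$ at $p$.
   Context: CR structures. All objects are real-analytic and all considerations are local. $\mathbb{C}TM=TM\otimes\mathbb{C}$, $\Gamma(E)$ denotes sections of $E$. A CR structure of hypersurface type on a $(2n+1)$-dimensional real manifold $M$ is a complex rank $n$ subbundle $H\subset\mathbb{C}TM$ with $[H,H]\subset H$ and $H\cap\overline H=0$. The Levi form is $\mathcal L(X_p,Y_p)=\frac{i}{2}[X,\overline Y]_p \bmod H_p\oplus\overline H_p$ for $X,Y\in\Gamma(H)$, and $K$ denotes its kernel. For $v\in K_p$ define $\mathrm{ad}_v:\overline H_p/\overline K_p\to H_p/K_p$ by $y\mapsto [V,Y]_p \bmod K_p\oplus\overline H_p$, where $V\in\Gamma(K)$, $V(p)=v$, $Y\in\Gamma(\overline H)$, $Y(p)\equiv y \bmod \overline K$; for $v\in\overline K_p$ define $\mathrm{ad}_v:H_p/K_p\to\overline H_p/\overline K_p$ analogously (by complex conjugation). The structure is $2$-nondegenerate if $K\neq0$ and at every point $p$ there is no nonzero $v\in K_p$ with $\mathrm{ad}_v=0$. Complexification, leaf space, recoverability. After shrinking, $M$ is the fixed point set of an antiholomorphic involution $\tau$ of a complexification $\mathbb{C}M$; $H,K$ extend to holomorphic distributions on $\mathbb{C}M$ denoted by the same letters, and $\overline H:=\tau_*H$,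 $\overline K:=\tau_*K$. The distributions $K,\overline K,K\oplus\overline K$ are involutive. The Levi leaf space is $\mathcal N=\mathbb{C}M/\mathrm{Fol}(K\oplus\overline K)$ with projection $\pi$; $\mathcal D=\pi_*(H\oplus\overline H)$ is a contact distribution on $\mathcal N$, so each $\mathcal D_\gamma$ has a canonical conformal symplectic form. For $\gamma=\pi(q)$ set $J^-_\gamma(q)=\pi_*H_q$, $J^+_\gamma(q)=\pi_*\overline H_q$, Lagrangian subspaces of $\mathcal D_\gamma$; $J^\pm_\gamma=\{J^\pm_\gamma(q): q\in\pi^{-1}(\gamma)\}$ are submanifolds of the Lagrangian Grassmannian $\mathrm{LG}(\mathcal D_\gamma)$. The triple $(\mathcal D,J^-,J^+)$ with the involution induced by $\tau$ (equivalently, $(\mathcal D, J^+,\tau)$) is the dynamical Legendrian contact structure associated with the germ of $H$. The canonical local diffeomorphism $F:\mathbb{C}M\to J^-\times J^+$, $F(q)=(J^-_\gamma(q),J^+_\gamma(q))$, onto the bundle over $\mathcal N$ with fibers $J^-_\gamma\times J^+_\gamma$ shows that the dynamical Legendrian contact structure determines $\mathbb{C}M$, $K$, $\overline K$, $H+\overline K$ and $\overline H+K$. The CR structure $H$ is called recoverable if it can be uniquely reconstructed from its dynamical Legendrian contact structure; concretely, (locally near the point considered) $H$ is the unique involutive rank $n$ subdistribution of $H+\overline K$ that contains $K$ and is transversal to $\overline K$. Symbol and regularity. Put $\mathfrak g_{-1}(p)=\mathcal D_{\pi(p)}$, $\mathfrak g_{-1,1}(p)=\pi_*H_p\cong H_p/K_p$,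 $\mathfrak g_{-1,-1}(p)=\pi_*\overline H_p\cong\overline H_p/\overline K_p$, so $\mathfrak g_{-1}(p)=\mathfrak g_{-1,-1}(p)\oplus\mathfrak g_{-1,1}(p)$. Let $\mathfrak g_{0,2}(p)=\{\mathrm{ad}_v:v\in K_p\}$ and $\mathfrak g_{0,-2}(p)=\{\mathrm{ad}_v:v\in\overline K_p\}$, where $\mathrm{ad}_v$ is extended by $0$ to the other summand, so both are subspaces of the conformal symplectic algebra $\mathfrak{csp}(\mathfrak g_{-1}(p))$. The symbol of $H$ at $p$ is the equivalence class of these data under conformal symplectic transformations. Let $\mathfrak g_{0,0}(p)$ be the maximal subalgebra of $\mathfrak{csp}(\mathfrak g_{-1}(p))$ with $[\mathfrak g_{0,0}(p),\mathfrak g_{-1,\pm1}(p)]\subset\mathfrak g_{-1,\pm1}(p)$ (bracket = action) and $[\mathfrak g_{0,0}(p),\mathfrak g_{0,\pm2}(p)]\subset\mathfrak g_{0,\pm2}(p)$. The symbol at $p$ is regular if $[\mathfrak g_{0,-2}(p),\mathfrak g_{0,2}(p)]\subset\mathfrak g_{0,0}(p)$. *)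

theory Defs
  imports "HOL-Analysis.Analysis" "HOL-Library.Set_Algebras"
begin

text \<open>
  All considerations are local, so the real-analytic manifold is an open set \<open>M\<close> of \<open>real^'m\<close>.
  Through the coordinate fields, \<open>complex^'m\<close> is the complexified tangent space at each point of
  \<open>M\<close>, and also the holomorphic tangent space at each point of the complexification, an open set
  \<open>\<Omega>\<close> of \<open>complex^'m\<close>. A distribution assigns to each point a set of vectors (a complex subspace).
  For sets of vectors, \<open>A + B\<close> is the elementwise sum.
\<close>

definition cnjv :: "complex^'m \<Rightarrow> complex^'m" where
  "cnjv z = (\<chi> i. cnj (z $ i))"

definition cvec :: "real^'m \<Rightarrow> complex^'m" where
  "cvec x = (\<chi> i. complex_of_real (x $ i))"


section \<open>Real-analytic distributions on \<open>M\<close>\<close>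

text \<open>The multi-indices are the functions \<open>\<alpha> :: 'm \<Rightarrow> nat\<close>.\<close>

definition real_analytic_on :: "(real^'m) set \<Rightarrow> (real^'m \<Rightarrow> complex^'m) \<Rightarrow> bool" where
  "real_analytic_on U f \<longleftrightarrow>
     (\<forall>a\<in>U. \<exists>r>0. \<exists>c :: ('m \<Rightarrow> nat) \<Rightarrow> complex^'m. \<forall>x\<in>ball a r.
        ((\<lambda>\<alpha>. (\<Prod>i\<in>UNIV. (x $ i - a $ i) ^ \<alpha> i) *\<^sub>R c \<alpha>) has_sum f x) UNIV)"

definition real_analytic_distribution ::
    "(real^'m) set \<Rightarrow> nat \<Rightarrow> (real^'m \<Rightarrow> (complex^'m) set) \<Rightarrow> bool" where
  "real_analytic_distribution M r D \<longleftrightarrow>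
     (\<forall>a\<in>M. \<exists>U X. open U \<and> a \<in> U \<and> U \<subseteq> M \<and> (\<forall>i<r. real_analytic_on U (X i)) \<and>
        (\<forall>x\<in>U. D x = vec.span ((\<lambda>i. X i x) ` {..<r}) \<and> vec.dim (D x) = r))"

definition sections_at ::
    "(real^'m) set \<Rightarrow> (real^'m \<Rightarrow> (complex^'m) set) \<Rightarrow> real^'m \<Rightarrow> (real^'m \<Rightarrow> complex^'m) set" where
  "sections_at M D p =
     {X. \<exists>U. open U \<and> p \<in> U \<and> U \<subseteq> M \<and> real_analytic_on U X \<and> (\<forall>x\<in>U. X x \<in> D x)}"

text \<open>Derivative of a complex-valued map along a complexified tangent vector \<open>v\<close>: the real
  derivative, extended complex-linearly in \<open>v\<close>.\<close>

definition cderiv :: "(real^'m \<Rightarrow> complex^'m) \<Rightarrow> real^'m \<Rightarrow> complex^'m \<Rightarrow> complex^'m" where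
  "cderiv Y p v = frechet_derivative Y (at p) (\<chi> i. Re (v $ i))
                  + \<i> *s frechet_derivative Y (at p) (\<chi> i. Im (v $ i))"

definition bracket ::
    "(real^'m \<Rightarrow> complex^'m) \<Rightarrow> (real^'m \<Rightarrow> complex^'m) \<Rightarrow> real^'m \<Rightarrow> complex^'m" where
  "bracket X Y p = cderiv Y p (X p) - cderiv X p (Y p)"

definition conj_dist :: "(real^'m \<Rightarrow> (complex^'m) set) \<Rightarrow> real^'m \<Rightarrow> (complex^'m) set" where
  "conj_dist D p = cnjv ` D p"


section \<open>CR structures, Levi kernel, 2-nondegeneracy\<close>

definition cr_structure ::
    "nat \<Rightarrow> (real^'m) set \<Rightarrow> (real^'m \<Rightarrow> (complex^'m) set) \<Rightarrow> bool" where
  "cr_structure n M H \<longleftrightarrow>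
     CARD('m) = 2 * n + 1 \<and> open M \<and> real_analytic_distribution M n H \<and>
     (\<forall>p\<in>M. \<forall>X\<in>sections_at M H p. \<forall>Y\<in>sections_at M H p. bracket X Y p \<in> H p) \<and>
     (\<forall>p\<in>M. H p \<inter> conj_dist H p = {0})"

text \<open>Here and below, an element of a quotient space is given as a coset, the zero element being
  the subspace itself. So a value of the Levi form is a coset of \<open>H p + conj_dist H p\<close>.\<close>

definition levi_form ::
    "(real^'m) set \<Rightarrow> (real^'m \<Rightarrow> (complex^'m) set) \<Rightarrow> real^'m \<Rightarrow>
     complex^'m \<Rightarrow> complex^'m \<Rightarrow> (complex^'m) set" where
  "levi_form M H p x y =
     {w. \<exists>X\<in>sections_at M H p. \<exists>Y\<in>sections_at M H p. X p = x \<and> Y p = y \<and>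
         w - (\<i> / 2) *s bracket X (\<lambda>q. cnjv (Y q)) p \<in> H p + conj_dist H p}"

definition levi_kernel ::
    "(real^'m) set \<Rightarrow> (real^'m \<Rightarrow> (complex^'m) set) \<Rightarrow> real^'m \<Rightarrow> (complex^'m) set" where
  "levi_kernel M H p = {x \<in> H p. \<forall>y\<in>H p. levi_form M H p x y = H p + conj_dist H p}"

text \<open>\<open>ad_op M A KA B KB p v\<close> is the operator \<open>B/KB \<rightarrow> A/KA\<close> at \<open>p\<close> defined by \<open>v \<in> KA p\<close>;
  the argument is given by a representative \<open>y \<in> B p\<close>, the value is a coset of \<open>KA p\<close> in \<open>A p\<close>.
  The two cases of interest are \<open>(A, B) = (H, conj H)\<close> and \<open>(A, B) = (conj H, H)\<close>.\<close>

definition ad_op ::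
    "(real^'m) set \<Rightarrow> (real^'m \<Rightarrow> (complex^'m) set) \<Rightarrow> (real^'m \<Rightarrow> (complex^'m) set) \<Rightarrow>
     (real^'m \<Rightarrow> (complex^'m) set) \<Rightarrow> (real^'m \<Rightarrow> (complex^'m) set) \<Rightarrow> real^'m \<Rightarrow>
     complex^'m \<Rightarrow> complex^'m \<Rightarrow> (complex^'m) set" where
  "ad_op M A KA B KB p v y =
     {w \<in> A p. \<exists>V\<in>sections_at M KA p. \<exists>Y\<in>sections_at M B p.
         V p = v \<and> Y p - y \<in> KB p \<and> w - bracket V Y p \<in> KA p + B p}"

abbreviation ad_plus ::
    "(real^'m) set \<Rightarrow> (real^'m \<Rightarrow> (complex^'m) set) \<Rightarrow> real^'m \<Rightarrow>
     complex^'m \<Rightarrow> complex^'m \<Rightarrow> (complex^'m) set" where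
  "ad_plus M H \<equiv> ad_op M H (levi_kernel M H) (conj_dist H) (conj_dist (levi_kernel M H))"

abbreviation ad_minus ::
    "(real^'m) set \<Rightarrow> (real^'m \<Rightarrow> (complex^'m) set) \<Rightarrow> real^'m \<Rightarrow>
     complex^'m \<Rightarrow> complex^'m \<Rightarrow> (complex^'m) set" where
  "ad_minus M H \<equiv> ad_op M (conj_dist H) (conj_dist (levi_kernel M H)) H (levi_kernel M H)"

definition two_nondegenerate ::
    "(real^'m) set \<Rightarrow> (real^'m \<Rightarrow> (complex^'m) set) \<Rightarrow> bool" where
  "two_nondegenerate M H \<longleftrightarrow>
     (\<forall>p\<in>M. levi_kernel M H p \<noteq> {0}) \<and>
     (\<forall>p\<in>M. \<not> (\<exists>v\<in>levi_kernel M H p. v \<noteq> 0 \<and>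
        (\<forall>y\<in>conj_dist H p. ad_plus M H p v y = levi_kernel M H p)))"


section \<open>The symbol at a point and its regularity\<close>

text \<open>
  The projection to the Levi leaf space has kernel \<open>K \<oplus> conj K\<close>, so it identifies \<open>g_{-1}(p)\<close> with
  the quotient of \<open>W = H p + conj_dist H p\<close> by \<open>S = K p + conj_dist K p\<close>, where \<open>K\<close> is the Levi
  kernel; its summands \<open>g_{-1,1}\<close> and \<open>g_{-1,-1}\<close> are the images of \<open>H p\<close> and \<open>conj_dist H p\<close>.

  An endomorphism of \<open>W/S\<close> is induced by a matrix that preserves \<open>W\<close> and \<open>S\<close>; two matrices induce
  the same endomorphism iff their difference maps \<open>W\<close> into \<open>S\<close>. Each set of endomorphisms of
  \<open>g_{-1}(p)\<close> is encoded by the set of all matrices that induce one of its elements, i.e. by its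
  full preimage under the surjective Lie algebra homomorphism \<open>gl_lift M H p \<rightarrow> gl(g_{-1}(p))\<close>.
  This encoding respects inclusions, subalgebras and brackets.
\<close>

definition levi_dist :: "(real^'m \<Rightarrow> (complex^'m) set) \<Rightarrow> real^'m \<Rightarrow> (complex^'m) set" where
  "levi_dist H p = H p + conj_dist H p"

definition gl_lift ::
    "(real^'m) set \<Rightarrow> (real^'m \<Rightarrow> (complex^'m) set) \<Rightarrow> real^'m \<Rightarrow> (complex^'m^'m) set" where
  "gl_lift M H p = {T. (*v) T ` levi_dist H p \<subseteq> levi_dist H p \<and>
     (*v) T ` levi_dist (levi_kernel M H) p \<subseteq> levi_dist (levi_kernel M H) p}"

text \<open>The conformal symplectic form of the contact distribution \<open>\<D>\<close> on the leaf space, read on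
  representatives in \<open>levi_dist H p\<close>; the values lie in the line \<open>T/\<D>\<close>, i.e. they are cosets of
  \<open>levi_dist H p\<close>.\<close>

definition symplectic_form ::
    "(real^'m) set \<Rightarrow> (real^'m \<Rightarrow> (complex^'m) set) \<Rightarrow> real^'m \<Rightarrow>
     complex^'m \<Rightarrow> complex^'m \<Rightarrow> (complex^'m) set" where
  "symplectic_form M H p x y =
     {w. \<exists>X\<in>sections_at M (levi_dist H) p. \<exists>Y\<in>sections_at M (levi_dist H) p.
         X p = x \<and> Y p = y \<and> w - bracket X Y p \<in> levi_dist H p}"

text \<open>\<open>csp\<close>: the endomorphisms with
  \<open>\<omega> (T x) y + \<omega> x (T y) = l * \<omega> x y\<close> for some scalar \<open>l\<close>.\<close>

definition csp_lift ::
    "(real^'m) set \<Rightarrow> (real^'m \<Rightarrow> (complex^'m) set) \<Rightarrow> real^'m \<Rightarrow> (complex^'m^'m) set" where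
  "csp_lift M H p = {T \<in> gl_lift M H p. \<exists>l. \<forall>x\<in>levi_dist H p. \<forall>y\<in>levi_dist H p.
     \<forall>a\<in>symplectic_form M H p (T *v x) y. \<forall>b\<in>symplectic_form M H p x (T *v y).
     \<forall>c\<in>symplectic_form M H p x y. a + b - l *s c \<in> levi_dist H p}"

text \<open>\<open>g_{0,2}\<close> and \<open>g_{0,-2}\<close>; the second condition on \<open>T\<close> expresses the extension by zero.\<close>

definition g02_lift ::
    "(real^'m) set \<Rightarrow> (real^'m \<Rightarrow> (complex^'m) set) \<Rightarrow> real^'m \<Rightarrow> (complex^'m^'m) set" where
  "g02_lift M H p = {T \<in> gl_lift M H p. \<exists>v\<in>levi_kernel M H p.
     (\<forall>y\<in>conj_dist H p. T *v y \<in> ad_plus M H p v y + conj_dist (levi_kernel M H) p) \<and>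
     (\<forall>x\<in>H p. T *v x \<in> levi_dist (levi_kernel M H) p)}"

definition g0m2_lift ::
    "(real^'m) set \<Rightarrow> (real^'m \<Rightarrow> (complex^'m) set) \<Rightarrow> real^'m \<Rightarrow> (complex^'m^'m) set" where
  "g0m2_lift M H p = {T \<in> gl_lift M H p. \<exists>v\<in>conj_dist (levi_kernel M H) p.
     (\<forall>x\<in>H p. T *v x \<in> ad_minus M H p v x + levi_kernel M H p) \<and>
     (\<forall>y\<in>conj_dist H p. T *v y \<in> levi_dist (levi_kernel M H) p)}"

definition commutator :: "complex^'m^'m \<Rightarrow> complex^'m^'m \<Rightarrow> complex^'m^'m" where
  "commutator A B = A ** B - B ** A"

definition lie_subalgebra :: "(complex^'m^'m) set \<Rightarrow> bool" where
  "lie_subalgebra L \<longleftrightarrow> 0 \<in> L \<and> (\<forall>A\<in>L. \<forall>B\<in>L. A + B \<in> L) \<and>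
     (\<forall>c. \<forall>A\<in>L. mat c ** A \<in> L) \<and> (\<forall>A\<in>L. \<forall>B\<in>L. commutator A B \<in> L)"

text \<open>The preimages of \<open>g_{-1,1}\<close> and \<open>g_{-1,-1}\<close> in \<open>levi_dist H p\<close> are \<open>H p + conj_dist K p\<close>
  and \<open>conj_dist H p + K p\<close>.\<close>

definition g00_lift ::
    "(real^'m) set \<Rightarrow> (real^'m \<Rightarrow> (complex^'m) set) \<Rightarrow> real^'m \<Rightarrow> (complex^'m^'m) set" where
  "g00_lift M H p = (GREATEST L. lie_subalgebra L \<and> L \<subseteq> csp_lift M H p \<and>
     (\<forall>T\<in>L. (*v) T ` (H p + conj_dist (levi_kernel M H) p)
               \<subseteq> H p + conj_dist (levi_kernel M H) p \<and>
             (*v) T ` (conj_dist H p + levi_kernel M H p)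
               \<subseteq> conj_dist H p + levi_kernel M H p) \<and>
     (\<forall>T\<in>L. \<forall>A\<in>g02_lift M H p. commutator T A \<in> g02_lift M H p) \<and>
     (\<forall>T\<in>L. \<forall>A\<in>g0m2_lift M H p. commutator T A \<in> g0m2_lift M H p))"

definition regular_symbol ::
    "(real^'m) set \<Rightarrow> (real^'m \<Rightarrow> (complex^'m) set) \<Rightarrow> real^'m \<Rightarrow> bool" where
  "regular_symbol M H p \<longleftrightarrow>
     (\<forall>A\<in>g0m2_lift M H p. \<forall>B\<in>g02_lift M H p. commutator A B \<in> g00_lift M H p)"


section \<open>Complexification and recoverability\<close>

definition holomorphic_vf :: "(complex^'m) set \<Rightarrow> (complex^'m \<Rightarrow> complex^'m) \<Rightarrow> bool" where
  "holomorphic_vf U X \<longleftrightarrow>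
     (\<forall>z\<in>U. \<exists>D. (X has_derivative D) (at z) \<and> (\<forall>c w. D (c *s w) = c *s D w))"

definition hol_distribution ::
    "(complex^'m) set \<Rightarrow> nat \<Rightarrow> (complex^'m \<Rightarrow> (complex^'m) set) \<Rightarrow> bool" where
  "hol_distribution V r D \<longleftrightarrow>
     (\<forall>a\<in>V. \<exists>U X. open U \<and> a \<in> U \<and> U \<subseteq> V \<and> (\<forall>i<r. holomorphic_vf U (X i)) \<and>
        (\<forall>z\<in>U. D z = vec.span ((\<lambda>i. X i z) ` {..<r}) \<and> vec.dim (D z) = r))"

definition hol_sections_at ::
    "(complex^'m) set \<Rightarrow> (complex^'m \<Rightarrow> (complex^'m) set) \<Rightarrow> complex^'m \<Rightarrow>
     (complex^'m \<Rightarrow> complex^'m) set" where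
  "hol_sections_at V D a =
     {X. \<exists>U. open U \<and> a \<in> U \<and> U \<subseteq> V \<and> holomorphic_vf U X \<and> (\<forall>z\<in>U. X z \<in> D z)}"

definition hol_bracket ::
    "(complex^'m \<Rightarrow> complex^'m) \<Rightarrow> (complex^'m \<Rightarrow> complex^'m) \<Rightarrow> complex^'m \<Rightarrow> complex^'m" where
  "hol_bracket X Y z =
     frechet_derivative Y (at z) (X z) - frechet_derivative X (at z) (Y z)"

definition hol_involutive ::
    "(complex^'m) set \<Rightarrow> (complex^'m \<Rightarrow> (complex^'m) set) \<Rightarrow> bool" where
  "hol_involutive V D \<longleftrightarrow>
     (\<forall>z\<in>V. \<forall>X\<in>hol_sections_at V D z. \<forall>Y\<in>hol_sections_at V D z. hol_bracket X Y z \<in> D z)"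

text \<open>The antiholomorphic involution \<open>\<tau>\<close> is \<open>cnjv\<close>, whose fixed points are the real vectors, and
  \<open>tau_dist D\<close> is the pushforward of \<open>D\<close> by \<open>\<tau>\<close>.\<close>

definition tau_dist :: "(complex^'m \<Rightarrow> (complex^'m) set) \<Rightarrow> complex^'m \<Rightarrow> (complex^'m) set" where
  "tau_dist D z = cnjv ` D (cnjv z)"

text \<open>\<open>Hc\<close> and \<open>Kc\<close> are the holomorphic extensions of \<open>H\<close> and of its Levi kernel to \<open>\<Omega>\<close>; the real
  part of \<open>\<Omega>\<close> is the (shrunk) manifold. Since \<open>\<Omega>\<close> is connected, \<open>Hc\<close> and \<open>Kc\<close> are determined by
  \<open>H\<close> and \<open>\<Omega>\<close> as soon as the real part is nonempty.\<close>

definition complexification ::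
    "nat \<Rightarrow> (real^'m) set \<Rightarrow> (real^'m \<Rightarrow> (complex^'m) set) \<Rightarrow> (complex^'m) set \<Rightarrow>
     (complex^'m \<Rightarrow> (complex^'m) set) \<Rightarrow> (complex^'m \<Rightarrow> (complex^'m) set) \<Rightarrow> bool" where
  "complexification n M H \<Omega> Hc Kc \<longleftrightarrow>
     open \<Omega> \<and> connected \<Omega> \<and> cnjv ` \<Omega> = \<Omega> \<and> {x. cvec x \<in> \<Omega>} \<subseteq> M \<and>
     hol_distribution \<Omega> n Hc \<and> (\<exists>k. hol_distribution \<Omega> k Kc) \<and>
     (\<forall>x. cvec x \<in> \<Omega> \<longrightarrow> Hc (cvec x) = H x \<and> Kc (cvec x) = levi_kernel M H x)"

text \<open>The dynamical Legendrian contact structure determines the complexification together with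
  \<open>K\<close>, \<open>\<tau>\<^sub>*K\<close>, \<open>H + \<tau>\<^sub>*K\<close>, \<open>\<tau>\<^sub>*H + K\<close>. To reconstruct \<open>H\<close> from it means that, on every open subset
  \<open>V\<close> of a neighbourhood \<open>\<Omega>\<close> of \<open>p\<close>, \<open>H\<close> is the one and only involutive holomorphic rank \<open>n\<close>
  subdistribution of \<open>H + \<tau>\<^sub>*K\<close> that contains \<open>K\<close> and is transversal to \<open>\<tau>\<^sub>*K\<close>.\<close>

definition recoverable_near ::
    "nat \<Rightarrow> (real^'m) set \<Rightarrow> (real^'m \<Rightarrow> (complex^'m) set) \<Rightarrow> real^'m \<Rightarrow> bool" where
  "recoverable_near n M H p \<longleftrightarrow>
     (\<exists>\<Omega> Hc Kc. cvec p \<in> \<Omega> \<and> complexification n M H \<Omega> Hc Kc \<and>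
        (\<forall>V H'. open V \<and> V \<subseteq> \<Omega> \<longrightarrow>
           ((hol_distribution V n H' \<and> hol_involutive V H' \<and>
             (\<forall>z\<in>V. H' z \<subseteq> Hc z + tau_dist Kc z \<and> Kc z \<subseteq> H' z \<and> H' z \<inter> tau_dist Kc z = {0}))
           \<longleftrightarrow> (\<forall>z\<in>V. H' z = Hc z))))"

end

theory Submission
  imports Defs "HOL-Complex_Analysis.Conformal_Mappings"
begin

text \<open>
  The complexified manifold carries the distributions \<open>H\<close>, \<open>K\<close> and their conjugates, where \<open>K\<close> is spanned by one
  field \<open>k\<close> and \<open>conj K\<close> by \<open>kb\<close>. A competitor \<open>H'\<close> for \<open>H\<close> of rank \<open>n\<close>, contained in \<open>H + conj K\<close> and transversal to \<open>conj K\<close>,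
  is the graph of a function: it consists of the vectors \<open>h + b(h) kb\<close> with \<open>h\<close> in \<open>H\<close>. Modulo \<open>H + conj K\<close> the bracket
  of two such fields is \<open>b(h) [kb, h'] - b(h') [kb, h]\<close>, because \<open>H\<close> is involutive. So involutivity of \<open>H'\<close> forces
  \<open>b(h) ad h' = b(h') ad h\<close>, where \<open>ad\<close> is the operator of \<open>kb\<close> from \<open>H\<close> to the quotient of \<open>conj H\<close> by \<open>conj K\<close>. If this operator has
  rank at least two, then \<open>b = 0\<close> and \<open>H' = H\<close> (\<open>subdistribution_unique\<close>).
  
  Rank at least two is an open condition, the nonvanishing of a minor, so it remains to see
  that it holds at \<open>p\<close>. Here the symbol enters. Let \<open>A\<close> and \<open>B\<close> be the operators of \<open>k\<close> and \<open>kb\<close>. Brackets of \<open>g0m2\<close> with \<open>g02\<close>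
  are multiples of \<open>B A - A B\<close>. They respect the splitting, and they are conformally symplectic because \<open>A\<close> and \<open>B\<close>
  are, by the Jacobi identity (\<open>ad_skew\<close>). They normalize the lines spanned by \<open>A\<close> and \<open>B\<close> if \<open>A B A\<close> is
  a multiple of \<open>A\<close> and \<open>B A B\<close> a multiple of \<open>B\<close>, which is always so for operators of rank one. Hence a symbol of
  rank at most one is regular (\<open>regular_if_rank_one\<close>), and a nonregular one has rank at least two
  (\<open>nonregular_minor_nonzero\<close>).
  
  The complexification itself has to be constructed on a ball around \<open>p\<close>. Convergent power
  series extend to complex arguments (\<open>analytic_extension\<close>), and relations at real points persist by the
  identity theorem (\<open>hol_identity\<close>). The Levi kernel is the kernel of a holomorphic matrix of constant corank one at
  real points, for which a holomorphic generator exists (\<open>levi_kernel_frame\<close>). Everything is then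
  expressed in a frame of \<open>H\<close>, its conjugate and one transversal vector (\<open>cr_chart\<close>).
\<close>

section \<open>Holomorphic functions of several variables\<close>

text \<open>
  The scalar counterpart of \<open>holomorphic_vf\<close>; by \<open>holomorphic_vf_iff\<close> a field is holomorphic
  exactly when its coordinates are. Having scalar functions allows coefficients with respect to
  a frame to be multiplied, divided and differentiated.
\<close>

definition hol :: "(complex^'m) set \<Rightarrow> (complex^'m \<Rightarrow> complex) \<Rightarrow> bool" where
  "hol U f \<longleftrightarrow> (\<forall>z\<in>U. \<exists>D. (f has_derivative D) (at z) \<and> (\<forall>c w. D (c *s w) = c * D w))"

abbreviation fd :: "('a::real_normed_vector \<Rightarrow> 'b::real_normed_vector) \<Rightarrow> 'a \<Rightarrow> 'a \<Rightarrow> 'b" where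
  "fd f z \<equiv> frechet_derivative f (at z)"

lemma norm_scale_vec: "norm (c *s (w :: complex^'m)) = cmod c * norm w"
  by (simp add: norm_vec_def L2_set_def norm_mult power_mult_distrib sum_distrib_left[symmetric]
      real_sqrt_mult)

lemma scaleR_eq_scale_vec: "r *\<^sub>R (w :: complex^'m) = complex_of_real r *s w"
  by (simp add: vec_eq_iff) (metis scaleR_conv_of_real)

lemma holD:
  assumes "hol U f" "z \<in> U"
  shows "(f has_derivative fd f z) (at z)" "fd f z (c *s w) = c * fd f z w"
proof -
  obtain D where D: "(f has_derivative D) (at z)" "\<And>c w. D (c *s w) = c * D w"
    using assms unfolding hol_def by blast
  then have "D = fd f z" using frechet_derivative_at by blast
  with D show "(f has_derivative fd f z) (at z)" "fd f z (c *s w) = c * fd f z w" by auto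
qed

lemma holI:
  assumes "\<And>z. z \<in> U \<Longrightarrow> (f has_derivative D z) (at z)"
    and "\<And>z c w. z \<in> U \<Longrightarrow> D z (c *s w) = c * D z w"
  shows "hol U f"
  using assms unfolding hol_def by blast

lemma hol_fd_linear:
  assumes "hol U f" "z \<in> U"
  shows "bounded_linear (fd f z)"
  using holD(1)[OF assms] has_derivative_bounded_linear by blast

lemma hol_subset: "hol U f \<Longrightarrow> V \<subseteq> U \<Longrightarrow> hol V f"
  unfolding hol_def by blast

lemma hol_continuous: "hol U f \<Longrightarrow> continuous_on U f"
  by (meson continuous_at_imp_continuous_on has_derivative_continuous holD(1))

lemma hol_const: "hol U (\<lambda>_. c)"
  by (rule holI[where D="\<lambda>_ _. 0"]) auto

lemma has_derivative_vec_nth: "((\<lambda>z. z $ i) has_derivative (\<lambda>w. w $ i)) (at z)"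
  by (intro bounded_linear_imp_has_derivative bounded_linear_vec_nth)

lemma hol_component: "hol U (\<lambda>z. z $ i)"
  by (rule holI[where D="\<lambda>_ w. w $ i"]) (auto intro: has_derivative_vec_nth)

lemma hol_add: "hol U f \<Longrightarrow> hol U g \<Longrightarrow> hol U (\<lambda>z. f z + g z)"
  by (rule holI[where D="\<lambda>z w. fd f z w + fd g z w"])
    (auto intro!: has_derivative_add simp: holD algebra_simps)

lemma hol_diff: "hol U f \<Longrightarrow> hol U g \<Longrightarrow> hol U (\<lambda>z. f z - g z)"
  by (rule holI[where D="\<lambda>z w. fd f z w - fd g z w"])
    (auto intro!: has_derivative_diff simp: holD algebra_simps)

lemma hol_mult:
  assumes f: "hol U f" and g: "hol U g" shows "hol U (\<lambda>z. f z * g z)"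
proof (rule holI[where D="\<lambda>z w. f z * fd g z w + fd f z w * g z"])
  fix z assume z: "z \<in> U"
  show "((\<lambda>z. f z * g z) has_derivative (\<lambda>w. f z * fd g z w + fd f z w * g z)) (at z)"
    by (rule has_derivative_mult[OF holD(1)[OF f z] holD(1)[OF g z]])
qed (simp add: holD(2)[OF f] holD(2)[OF g] algebra_simps)

lemma hol_sum: "(\<And>i. i \<in> I \<Longrightarrow> hol U (f i)) \<Longrightarrow> hol U (\<lambda>z. \<Sum>i\<in>I. f i z)"
  by (induction I rule: infinite_finite_induct) (auto intro: hol_const hol_add)

lemma hol_prod: "(\<And>i. i \<in> I \<Longrightarrow> hol U (f i)) \<Longrightarrow> hol U (\<lambda>z. \<Prod>i\<in>I. f i z)"
  by (induction I rule: infinite_finite_induct) (auto intro: hol_const hol_mult)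

lemma hol_power: "hol U f \<Longrightarrow> hol U (\<lambda>z. f z ^ k)"
  by (induction k) (auto intro: hol_const hol_mult)

lemma hol_inverse:
  assumes f: "hol U f" and nz: "\<And>z. z \<in> U \<Longrightarrow> f z \<noteq> 0" shows "hol U (\<lambda>z. inverse (f z))"
proof (rule holI[where D="\<lambda>z w. - (inverse (f z) * fd f z w * inverse (f z))"])
  fix z assume z: "z \<in> U"
  show "((\<lambda>z. inverse (f z)) has_derivative (\<lambda>w. - (inverse (f z) * fd f z w * inverse (f z)))) (at z)"
    using Deriv.has_derivative_inverse[OF nz[OF z] holD(1)[OF f z]] by simp
qed (simp add: holD(2)[OF f])

lemma hol_divide:
  assumes "hol U f" "hol U g" "\<And>z. z \<in> U \<Longrightarrow> g z \<noteq> 0" shows "hol U (\<lambda>z. f z / g z)"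
  unfolding divide_inverse using assms by (intro hol_mult hol_inverse) auto

lemma hol_cong:
  assumes "hol U f" "open U" "\<And>z. z \<in> U \<Longrightarrow> f z = g z" shows "hol U g"
proof (rule holI[where D="fd f"])
  fix z assume z: "z \<in> U"
  show "(g has_derivative fd f z) (at z)"
    by (rule has_derivative_transform_within_open[OF holD(1)[OF assms(1) z] assms(2) z assms(3)])
qed (simp add: holD(2)[OF assms(1)])

lemma holomorphic_vfD:
  assumes "holomorphic_vf U X" "z \<in> U"
  shows "(X has_derivative fd X z) (at z)" "fd X z (c *s w) = c *s fd X z w"
proof -
  obtain D where D: "(X has_derivative D) (at z)" "\<And>c w. D (c *s w) = c *s D w"
    using assms unfolding holomorphic_vf_def by blast
  then have "D = fd X z" using frechet_derivative_at by blast
  with D show "(X has_derivative fd X z) (at z)" "fd X z (c *s w) = c *s fd X z w" by auto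
qed

lemma fd_eqI: "(f has_derivative D) (at z) \<Longrightarrow> fd f z w = D w"
  using frechet_derivative_at by metis

lemma holomorphic_vf_subset: "holomorphic_vf U X \<Longrightarrow> V \<subseteq> U \<Longrightarrow> holomorphic_vf V X"
  unfolding holomorphic_vf_def by blast

lemma holomorphic_vf_iff: "holomorphic_vf U X \<longleftrightarrow> (\<forall>i. hol U (\<lambda>z. X z $ i))"
proof
  assume X: "holomorphic_vf U X"
  show "\<forall>i. hol U (\<lambda>z. X z $ i)"
  proof (intro allI holI[where D="\<lambda>z w. fd X z w $ _"])
    fix i z assume z: "z \<in> U"
    show "((\<lambda>z. X z $ i) has_derivative (\<lambda>w. fd X z w $ i)) (at z)"
      by (rule bounded_linear.has_derivative[OF bounded_linear_vec_nth holomorphic_vfD(1)[OF X z]])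
  qed (use holomorphic_vfD[OF X] in auto)
next
  assume X: "\<forall>i. hol U (\<lambda>z. X z $ i)"
  show "holomorphic_vf U X"
    unfolding holomorphic_vf_def
  proof (intro ballI exI[of _ "\<lambda>w. \<chi> i. fd (\<lambda>z. X z $ i) _ w"] conjI allI)
    fix z assume z: "z \<in> U"
    show "(X has_derivative (\<lambda>w. \<chi> i. fd (\<lambda>z. X z $ i) z w)) (at z)"
    proof (subst has_derivative_componentwise_within, intro ballI)
      fix b :: "complex^'a" assume "b \<in> Basis"
      then obtain i c where b: "b = axis i c" by (auto simp: Basis_vec_def)
      show "((\<lambda>x. X x \<bullet> b) has_derivative (\<lambda>x. (\<chi> i. fd (\<lambda>z. X z $ i) z x) \<bullet> b)) (at z)"
        unfolding b inner_axis
        using has_derivative_inner_left[OF holD(1)[OF X[rule_format] z], of i c] by simp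
    qed
    fix c w
    show "(\<chi> i. fd (\<lambda>z. X z $ i) z (c *s w)) = c *s (\<chi> i. fd (\<lambda>z. X z $ i) z w)"
      using holD(2)[OF X[rule_format] z] by (simp add: vec_eq_iff)
  qed
qed

lemma fd_component:
  assumes "holomorphic_vf U X" "z \<in> U"
  shows "fd X z w $ i = fd (\<lambda>z. X z $ i) z w"
proof -
  have "((\<lambda>z. X z $ i) has_derivative (\<lambda>w. fd X z w $ i)) (at z)"
    by (rule bounded_linear.has_derivative[OF bounded_linear_vec_nth holomorphic_vfD(1)[OF assms]])
  then show ?thesis using frechet_derivative_at by metis
qed

section \<open>Cauchy estimates and Weierstrass' theorem\<close>

text \<open>
  Restriction to a complex line \<open>z + \<zeta> h\<close>: the bridge to the theory of one complex variable.
\<close>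

lemma hol_line:
  assumes "hol U f" "z + \<zeta> *s h \<in> U"
  shows "((\<lambda>\<zeta>. f (z + \<zeta> *s h)) has_field_derivative fd f (z + \<zeta> *s h) h) (at \<zeta>)"
proof -
  have "((\<lambda>\<zeta>. z + \<zeta> *s h) has_derivative (\<lambda>\<zeta>. \<zeta> *s h)) (at \<zeta>)"
  proof -
    have "bounded_linear (\<lambda>\<zeta>. \<zeta> *s h)"
      by (rule bounded_linear_intro[where K="norm h"])
        (auto simp: norm_scale_vec vec_eq_iff algebra_simps)
    from has_derivative_add[OF has_derivative_const bounded_linear_imp_has_derivative[OF this]]
    show ?thesis by simp
  qed
  from has_derivative_compose[OF this holD(1)[OF assms]]
  show ?thesis
    unfolding has_field_derivative_def holD(2)[OF assms] by (simp add: mult.commute[of _ "fd f (z + \<zeta> *s h) h"])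
qed

text \<open>
  Cauchy's inequalities for the restriction of \<open>f\<close> to the complex line in direction \<open>h\<close>, which stays in
  the ball for \<open>\<bar>\<zeta>\<bar> < \<rho> / \<bar>h\<bar>\<close>. The second estimate, a quadratic bound on the Taylor remainder that is
  proportional to \<open>M\<close>, is what makes series of holomorphic functions differentiable term by term.
\<close>

lemma hol_cauchy:
  assumes f: "hol (ball z \<rho>) f" and M: "\<And>y. y \<in> ball z \<rho> \<Longrightarrow> cmod (f y) \<le> M" and \<rho>: "0 < \<rho>"
  shows "cmod (fd f z h) \<le> 2 * M / \<rho> * norm h"
    and "norm h \<le> \<rho> / 4 \<Longrightarrow> cmod (f (z + h) - f z - fd f z h) \<le> 32 * M / \<rho>\<^sup>2 * (norm h)\<^sup>2"
proof -
  have b0: "fd f z 0 = 0"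
    using hol_fd_linear[OF f, of z] \<rho> by (simp add: linear_simps)
  consider "h = 0" | "h \<noteq> 0" by blast
  then have "cmod (fd f z h) \<le> 2 * M / \<rho> * norm h \<and> (norm h \<le> \<rho> / 4 \<longrightarrow> cmod (f (z + h) - f z - fd f z h) \<le> 32 * M / \<rho>\<^sup>2 * (norm h)\<^sup>2)"
  proof cases
    case 1 then show ?thesis using b0 by simp
  next
    case 2
    \<comment> \<open>the line stays in the ball for parameters of modulus below \<open>2 R\<close>\<close>
    define R where "R = \<rho> / (2 * norm h)"
    have R: "R > 0" using 2 \<rho> by (simp add: R_def)
    define g where "g \<zeta> = f (z + \<zeta> *s h)" for \<zeta>
    have inb: "z + \<zeta> *s h \<in> ball z \<rho>" if "\<zeta> \<in> ball 0 (2 * R)" for \<zeta>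
    proof -
      have "dist z (z + \<zeta> *s h) = cmod \<zeta> * norm h" by (simp add: dist_norm norm_scale_vec)
      also have "\<dots> < 2 * R * norm h" using that 2 by simp
      also have "\<dots> = \<rho>" using 2 by (simp add: R_def)
      finally show ?thesis by simp
    qed
    have dg: "(g has_field_derivative fd f (z + \<zeta> *s h) h) (at \<zeta>)" if "\<zeta> \<in> ball 0 (2 * R)" for \<zeta>
      unfolding g_def by (rule hol_line[OF f inb[OF that]])
    have hg: "g holomorphic_on ball 0 (2*R)"
      using dg by (subst holomorphic_on_open) (simp, blast)
    have Mg: "cmod (g \<zeta>) \<le> M" if "\<zeta> \<in> ball 0 (2 * R)" for \<zeta>
      using M[OF inb[OF that]] by (simp add: g_def)
    have cau: "cmod ((deriv ^^ k) g \<xi>) \<le> fact k * M / s ^ k" if "cball \<xi> s \<subseteq> ball 0 (2*R)" "s > 0" for k \<xi> s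
    proof (rule Cauchy_inequality)
      show "g holomorphic_on ball \<xi> s" using hg that(1) by (meson ball_subset_cball holomorphic_on_subset)
      show "continuous_on (cball \<xi> s) g" using hg that(1) holomorphic_on_imp_continuous_on holomorphic_on_subset by blast
      show "cmod (g x) \<le> M" if "cmod (\<xi> - x) = s" for x
        using that \<open>cball \<xi> s \<subseteq> _\<close> by (intro Mg) (auto simp: dist_norm subset_iff)
    qed fact
    have d0: "deriv g 0 = fd f z h" using DERIV_imp_deriv[OF dg[of 0]] R by simp
    have subR: "cball 0 R \<subseteq> ball (0::complex) (2*R)" using R by auto
    have 1: "cmod (fd f z h) \<le> 2 * M / \<rho> * norm h"
      using cau[of 0 R 1, OF subR R] d0 2 \<rho> by (simp add: R_def mult_ac)
    have 3: "cmod (f (z + h) - f z - fd f z h) \<le> 32 * M / \<rho>\<^sup>2 * (norm h)\<^sup>2" if h: "norm h \<le> \<rho> / 4"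
    proof -
      have R2: "R \<ge> 2" using h 2 by (simp add: R_def field_simps)
      have sub: "cball 0 1 \<subseteq> ball (0::complex) (2*R)" using R2 by auto
      have "cmod (g 1 - (\<Sum>i\<le>1. (deriv ^^ i) g 0 * (1-0) ^ i / (fact i))) \<le> (8 * M / R\<^sup>2) * cmod (1 - 0)^(Suc 1) / fact 1"
      proof (rule complex_Taylor[where S="cball 0 1" and f="\<lambda>i. (deriv ^^ i) g" and n=1, of "8 * M / R\<^sup>2" 0 1, simplified funpow_0])
        fix i and x :: complex assume x: "x \<in> cball 0 1"
        have "(deriv ^^ i) g holomorphic_on ball 0 (2*R)"
          by (intro holomorphic_higher_deriv hg) simp
        from holomorphic_derivI[OF this, of x] x sub
        show "((deriv ^^ i) g has_field_derivative (deriv ^^ Suc i) g x) (at x within cball 0 1)"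
          by (auto intro: has_field_derivative_at_within)
      next
        fix x :: complex assume x: "x \<in> cball 0 1"
        have "cball x (R/2) \<subseteq> ball 0 (2*R)"
        proof
          fix y assume "y \<in> cball x (R/2)"
          then have "cmod (x - y) \<le> R/2" by (simp add: dist_norm)
          moreover have "cmod x \<le> 1" using x by simp
          moreover have "cmod y \<le> cmod x + cmod (x - y)" by (metis norm_triangle_sub norm_minus_commute)
          ultimately show "y \<in> ball 0 (2*R)" using R2 by simp
        qed
        from cau[OF this, of 2] R show "cmod ((deriv ^^ Suc 1) g x) \<le> 8 * M / R\<^sup>2"
          by (simp add: power2_eq_square eval_nat_numeral)
      qed auto
      then have "cmod (g 1 - g 0 - deriv g 0) \<le> 8 * M / R\<^sup>2" by (simp add: algebra_simps)
      moreover have "8 * M / R\<^sup>2 = 32 * M / \<rho>\<^sup>2 * (norm h)\<^sup>2"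
        using 2 \<rho> by (simp add: R_def power2_eq_square field_simps)
      ultimately show ?thesis by (simp add: g_def d0)
    qed
    show ?thesis using 1 3 by blast
  qed
  then show "cmod (fd f z h) \<le> 2 * M / \<rho> * norm h"
    "norm h \<le> \<rho> / 4 \<Longrightarrow> cmod (f (z + h) - f z - fd f z h) \<le> 32 * M / \<rho>\<^sup>2 * (norm h)\<^sup>2"
    by auto
qed

lemma has_derivative_quadratic:
  fixes f :: "'a::real_normed_vector \<Rightarrow> 'b::real_normed_vector"
  assumes D: "bounded_linear D" and \<delta>: "\<delta> > 0"
    and C: "\<And>h. norm h \<le> \<delta> \<Longrightarrow> norm (f (z + h) - f z - D h) \<le> C * (norm h)\<^sup>2"
  shows "(f has_derivative D) (at z)"
  unfolding has_derivative_at_alt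
proof (intro conjI allI impI D)
  fix e :: real assume e: "e > 0"
  show "\<exists>d>0. \<forall>y. norm (y - z) < d \<longrightarrow> norm (f y - f z - D (y - z)) \<le> e * norm (y - z)"
  proof (intro exI[of _ "min \<delta> (e / (\<bar>C\<bar> + 1))"] conjI allI impI)
    show "0 < min \<delta> (e / (\<bar>C\<bar> + 1))" using \<delta> e by simp
    fix y assume y: "norm (y - z) < min \<delta> (e / (\<bar>C\<bar> + 1))"
    have "norm (f y - f z - D (y - z)) \<le> C * (norm (y-z))\<^sup>2" using C[of "y - z"] y by simp
    also have "\<dots> \<le> (\<bar>C\<bar> + 1) * (norm (y-z))\<^sup>2" by (intro mult_right_mono) auto
    also have "\<dots> = ((\<bar>C\<bar> + 1) * norm (y-z)) * norm (y - z)" by (simp add: power2_eq_square)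
    also have "\<dots> \<le> e * norm (y - z)"
    proof (rule mult_right_mono)
      have "norm (y - z) * (\<bar>C\<bar> + 1) < e"
        using y by (simp add: pos_less_divide_eq[symmetric])
      then show "(\<bar>C\<bar> + 1) * norm (y-z) \<le> e" by (simp add: mult.commute)
    qed auto
    finally show "norm (f y - f z - D (y - z)) \<le> e * norm (y - z)" .
  qed
qed

lemma summable_on_bound:
  fixes f :: "'i \<Rightarrow> complex"
  assumes "g summable_on I" "\<And>i. i \<in> I \<Longrightarrow> norm (f i) \<le> g i"
  shows "f summable_on I"
proof -
  have "norm (g i) = g i" if "i \<in> I" for i
    using order_trans[OF norm_ge_zero assms(2)[OF that]] by simp
  then have "(\<lambda>i. norm (g i)) summable_on I"
    using assms(1) summable_on_cong[of I "\<lambda>i. norm (g i)" g] by simp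
  moreover have "norm (f i) \<le> norm (g i)" if "i \<in> I" for i
    using order_trans[OF assms(2)[OF that] abs_ge_self] by simp
  ultimately have "(\<lambda>i. norm (f i)) summable_on I"
    by (rule Infinite_Sum.abs_summable_on_comparison_test)
  then show ?thesis by (rule abs_summable_summable)
qed

lemma infsum_diff_summable:
  fixes f g :: "'i \<Rightarrow> complex"
  assumes "f summable_on I" "g summable_on I"
  shows "(\<lambda>i. f i - g i) summable_on I" "infsum (\<lambda>i. f i - g i) I = infsum f I - infsum g I"
proof -
  have "((\<lambda>i. f i + - g i) has_sum infsum f I + - infsum g I) I"
    using assms by (intro has_sum_add has_sum_infsum) (simp_all add: has_sum_uminus)
  then show "(\<lambda>i. f i - g i) summable_on I" "infsum (\<lambda>i. f i - g i) I = infsum f I - infsum g I"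
    by (auto simp: summable_on_def intro: infsumI)
qed

text \<open>
  Weierstrass' theorem. The majorant \<open>M\<close> also bounds the derivatives and the quadratic remainders of
  the terms by the Cauchy estimates, so that both may be summed; the index set is arbitrary,
  which suits multi-indices.
\<close>

lemma hol_infsum:
  fixes f :: "'i \<Rightarrow> complex^'m \<Rightarrow> complex"
  assumes f: "\<And>i. i \<in> I \<Longrightarrow> hol (ball z0 \<rho>) (f i)"
    and M: "\<And>i z. i \<in> I \<Longrightarrow> z \<in> ball z0 \<rho> \<Longrightarrow> cmod (f i z) \<le> M i"
    and sM: "M summable_on I"
  shows "hol (ball z0 \<rho>) (\<lambda>z. infsum (\<lambda>i. f i z) I)"
proof (rule holI[where D="\<lambda>z h. infsum (\<lambda>i. fd (f i) z h) I"])
  fix z assume z: "z \<in> ball z0 \<rho>"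
  define r where "r = \<rho> - dist z0 z"
  have r: "r > 0" using z by (simp add: r_def)
  have sub: "ball z r \<subseteq> ball z0 \<rho>"
  proof
    fix y assume "y \<in> ball z r"
    then show "y \<in> ball z0 \<rho>" using dist_triangle[of z0 y z] by (simp add: r_def)
  qed
  have fr: "hol (ball z r) (f i)" if "i \<in> I" for i using f[OF that] sub hol_subset by blast
  have Mr: "cmod (f i y) \<le> M i" if "i \<in> I" "y \<in> ball z r" for i y using M that sub by blast
  note C1 = hol_cauchy(1)[OF fr Mr r] and C2 = hol_cauchy(2)[OF fr Mr r]
  have sC: "(\<lambda>i. c * M i) summable_on I" for c using sM by (simp add: summable_on_cmult_right)
  have s1: "(\<lambda>i. fd (f i) z h) summable_on I" for h
  proof (rule summable_on_bound)
    show "(\<lambda>i. (2 / r * norm h) * M i) summable_on I" by (rule sC)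
    show "norm (fd (f i) z h) \<le> 2 / r * norm h * M i" if "i \<in> I" for i
      using C1[OF that that, of h] by (simp add: mult_ac)
  qed
  have s0: "(\<lambda>i. f i y) summable_on I" if "y \<in> ball z r" for y
    by (rule summable_on_bound[OF sM]) (use Mr that in auto)
  have lin: "bounded_linear (fd (f i) z)" if "i \<in> I" for i
    using hol_fd_linear[OF f[OF that] z] .
  have bl: "bounded_linear (\<lambda>h. infsum (\<lambda>i. fd (f i) z h) I)"
  proof (rule bounded_linear_intro[where K="infsum (\<lambda>i. (2 / r) * M i) I"])
    fix x y :: "complex^'m"
    have "infsum (\<lambda>i. fd (f i) z (x + y)) I = infsum (\<lambda>i. fd (f i) z x + fd (f i) z y) I"
      by (rule infsum_cong) (simp add: lin linear_simps)
    also have "\<dots> = infsum (\<lambda>i. fd (f i) z x) I + infsum (\<lambda>i. fd (f i) z y) I"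
      by (intro infsum_add s1)
    finally show "infsum (\<lambda>i. fd (f i) z (x + y)) I = infsum (\<lambda>i. fd (f i) z x) I + infsum (\<lambda>i. fd (f i) z y) I" .
  next
    fix c :: real and x :: "complex^'m"
    have "infsum (\<lambda>i. fd (f i) z (c *\<^sub>R x)) I = infsum (\<lambda>i. c *\<^sub>R fd (f i) z x) I"
      by (rule infsum_cong) (simp add: lin linear_simps)
    also have "\<dots> = c *\<^sub>R infsum (\<lambda>i. fd (f i) z x) I"
      by (rule infsum_scaleR_right)
    finally show "infsum (\<lambda>i. fd (f i) z (c *\<^sub>R x)) I = c *\<^sub>R infsum (\<lambda>i. fd (f i) z x) I" .
  next
    fix x :: "complex^'m"
    have "norm (infsum (\<lambda>i. fd (f i) z x) I) \<le> infsum (\<lambda>i. norm x * (2 / r * M i)) I"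
    proof (rule norm_infsum_le[OF has_sum_infsum has_sum_infsum])
      show "(\<lambda>i. norm x * (2 / r * M i)) summable_on I"
        using sC[of "norm x * (2/r)"] by (simp only: mult.assoc)
      show "norm (fd (f i) z x) \<le> norm x * (2 / r * M i)" if "i \<in> I" for i
        using C1[OF that that, of x] by (simp add: mult_ac)
    qed (use s1 in auto)
    also have "\<dots> = norm x * infsum (\<lambda>i. 2 / r * M i) I"
      by (rule infsum_cmult_right) (rule sC)
    finally show "norm (infsum (\<lambda>i. fd (f i) z x) I) \<le> norm x * infsum (\<lambda>i. 2 / r * M i) I" .
  qed
  show "((\<lambda>z. infsum (\<lambda>i. f i z) I) has_derivative (\<lambda>h. infsum (\<lambda>i. fd (f i) z h) I)) (at z)"
  proof (rule has_derivative_quadratic[OF bl, of "r/4" _ _ "32 / r\<^sup>2 * infsum M I"])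
    fix h :: "complex^'m" assume h: "norm h \<le> r / 4"
    then have zh: "z + h \<in> ball z r" "z \<in> ball z r" using r by (auto simp: dist_norm)
    have "infsum (\<lambda>i. f i (z + h)) I - infsum (\<lambda>i. f i z) I - infsum (\<lambda>i. fd (f i) z h) I
      = infsum (\<lambda>i. f i (z + h) - f i z - fd (f i) z h) I"
      using infsum_diff_summable(2)[OF infsum_diff_summable(1)[OF s0[OF zh(1)] s0[OF zh(2)]] s1]
        infsum_diff_summable(2)[OF s0[OF zh(1)] s0[OF zh(2)]] by simp
    also have "norm \<dots> \<le> infsum (\<lambda>i. (32 / r\<^sup>2 * (norm h)\<^sup>2) * M i) I"
    proof (rule norm_infsum_le[OF has_sum_infsum has_sum_infsum])
      show "norm (f i (z + h) - f i z - fd (f i) z h) \<le> 32 / r\<^sup>2 * (norm h)\<^sup>2 * M i" if "i \<in> I" for i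
        using C2[OF that that, of h] h by (simp add: mult_ac)
    qed (intro sC infsum_diff_summable(1) s0 s1 zh)+
    also have "\<dots> = (32 / r\<^sup>2 * (norm h)\<^sup>2) * infsum M I"
      by (intro infsum_cmult_right) (use sM in auto)
    finally show "norm (infsum (\<lambda>i. f i (z + h)) I - infsum (\<lambda>i. f i z) I - infsum (\<lambda>i. fd (f i) z h) I)
      \<le> 32 / r\<^sup>2 * infsum M I * (norm h)\<^sup>2" by (simp add: mult_ac)
  qed (use r in auto)
  fix c w
  have "infsum (\<lambda>i. fd (f i) z (c *s w)) I = infsum (\<lambda>i. c * fd (f i) z w) I"
    by (rule infsum_cong) (simp add: holD(2)[OF f z])
  also have "\<dots> = c * infsum (\<lambda>i. fd (f i) z w) I" by (rule infsum_cmult_right) (use s1 in auto)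
  finally show "infsum (\<lambda>i. fd (f i) z (c *s w)) I = c * infsum (\<lambda>i. fd (f i) z w) I" .
qed

section \<open>Derivatives of holomorphic functions\<close>

lemma continuous_scale_vec: "continuous_on S (\<lambda>\<zeta>. z + \<zeta> *s (h :: complex^'m))"
proof -
  have "bounded_linear (\<lambda>\<zeta>. \<zeta> *s h)"
    by (rule bounded_linear_intro[where K="norm h"])
      (auto simp: norm_scale_vec vec_eq_iff algebra_simps)
  then show ?thesis by (intro continuous_intros linear_continuous_on)
qed

lemma hol_shift:
  assumes f: "hol U f" and sub: "\<And>z. z \<in> V \<Longrightarrow> z + h \<in> U"
  shows "hol V (\<lambda>z. f (z + h))"
    and "z \<in> V \<Longrightarrow> fd (\<lambda>z. f (z + h)) z = fd f (z + h)"
proof -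
  have d: "((\<lambda>z. f (z + h)) has_derivative fd f (z + h)) (at z)" if "z \<in> V" for z
  proof -
    have "((\<lambda>z. z + h) has_derivative (\<lambda>w. w)) (at z)"
      by (auto intro!: derivative_eq_intros)
    from has_derivative_compose[OF this holD(1)[OF f sub[OF that]]] show ?thesis .
  qed
  show "hol V (\<lambda>z. f (z + h))"
    by (rule holI[OF d]) (auto simp: holD(2)[OF f sub])
  show "z \<in> V \<Longrightarrow> fd (\<lambda>z. f (z + h)) z = fd f (z + h)"
    using d frechet_derivative_at by metis
qed

lemma fd_rules:
  assumes f: "hol U f" and g: "hol U g" and z: "z \<in> U"
  shows "fd (\<lambda>z. f z + g z) z w = fd f z w + fd g z w"
    and "fd (\<lambda>z. f z - g z) z w = fd f z w - fd g z w"
    and "fd (\<lambda>z. f z * g z) z w = f z * fd g z w + fd f z w * g z"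
    and "fd (\<lambda>z. c * f z) z w = c * fd f z w"
proof -
  note df = holD(1)[OF f z] and dg = holD(1)[OF g z]
  show "fd (\<lambda>z. f z + g z) z w = fd f z w + fd g z w"
    using fun_cong[OF frechet_derivative_at[OF has_derivative_add[OF df dg]], of w] by simp
  show "fd (\<lambda>z. f z - g z) z w = fd f z w - fd g z w"
    using fun_cong[OF frechet_derivative_at[OF has_derivative_diff[OF df dg]], of w] by simp
  show "fd (\<lambda>z. f z * g z) z w = f z * fd g z w + fd f z w * g z"
    using fun_cong[OF frechet_derivative_at[OF has_derivative_mult[OF df dg]], of w] by simp
  show "fd (\<lambda>z. c * f z) z w = c * fd f z w"
    using fun_cong[OF frechet_derivative_at[OF has_derivative_mult_right[OF df, of c]], of w] by simp
qed

lemma hol_locally_bounded: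
  assumes f: "hol U f" and U: "open U" "z \<in> U"
  obtains \<rho> M where "\<rho> > 0" "M > 0" "cball z \<rho> \<subseteq> U" "\<And>y. y \<in> cball z \<rho> \<Longrightarrow> cmod (f y) \<le> M"
proof -
  obtain \<rho> where \<rho>: "\<rho> > 0" "cball z \<rho> \<subseteq> U" using U open_contains_cball by blast
  have "continuous_on (cball z \<rho>) f" using hol_continuous[OF hol_subset[OF f \<rho>(2)]] .
  then have "bounded (f ` cball z \<rho>)" by (intro compact_imp_bounded compact_continuous_image) auto
  then obtain M where "M > 0" "\<And>y. y \<in> cball z \<rho> \<Longrightarrow> cmod (f y) \<le> M"
    unfolding bounded_pos by auto
  with \<rho> that show ?thesis by blast
qed

text \<open>
  The difference quotients converge at the uniform rate \<open>C h\<close> near \<open>z0\<close>; both the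
  holomorphy and the symmetry of derivatives follow from this rate.
\<close>

lemma hol_difference_quotient:
  assumes f: "hol U f" and U: "open U" "z0 \<in> U"
  obtains \<rho> h0 C where "\<rho> > 0" "h0 > 0" "C \<ge> 0" "ball z0 \<rho> \<subseteq> U"
    "\<And>z h. z \<in> ball z0 \<rho> \<Longrightarrow> 0 < h \<Longrightarrow> h \<le> h0 \<Longrightarrow>
       z + of_real h *s w \<in> U \<and>
       cmod ((f (z + of_real h *s w) - f z) / of_real h - fd f z w) \<le> C * h"
proof -
  obtain R M where R: "R > 0" "M > 0" "cball z0 R \<subseteq> U" "\<And>y. y \<in> cball z0 R \<Longrightarrow> cmod (f y) \<le> M"
    using hol_locally_bounded[OF f U] by blast
  define \<rho> where "\<rho> = R / 2"
  define h0 where "h0 = \<rho> / (4 * (norm w + 1))"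
  define C where "C = 32 * M / \<rho>\<^sup>2 * (norm w)\<^sup>2"
  have \<rho>: "\<rho> > 0" using R by (simp add: \<rho>_def)
  have nw: "norm w + 1 > 0" by (rule add_nonneg_pos) auto
  have h0: "h0 > 0" using \<rho> nw by (simp add: h0_def)
  show ?thesis
  proof (rule that[of \<rho> h0 C])
    show "ball z0 \<rho> \<subseteq> U" using R \<rho>_def by (auto intro!: subsetD[OF R(3)])
    show "C \<ge> 0" using R(2) by (simp add: C_def)
    fix z h assume z: "z \<in> ball z0 \<rho>" and h: "0 < h" "h \<le> h0"
    have sub: "ball z \<rho> \<subseteq> cball z0 R"
    proof
      fix y assume "y \<in> ball z \<rho>"
      then show "y \<in> cball z0 R" using z dist_triangle[of z0 y z] by (simp add: \<rho>_def)
    qed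
    have n: "norm (of_real h *s w) = h * norm w" using h by (simp add: norm_scale_vec)
    have "h * norm w \<le> h0 * (norm w + 1)" using h h0 by (intro mult_mono) auto
    also have "\<dots> = \<rho> / 4" using nw by (simp only: h0_def) (simp add: field_simps)
    finally have small: "norm (of_real h *s w) \<le> \<rho> / 4" unfolding n .
    then have "z + of_real h *s w \<in> ball z \<rho>" using \<rho> by (simp add: dist_norm)
    then have inU: "z + of_real h *s w \<in> U" using sub R(3) by blast
    have zU: "z \<in> U" using z sub R(3) \<rho> by (meson centre_in_ball subset_iff)
    have fb: "hol (ball z \<rho>) f" using hol_subset[OF f] sub R(3) by blast
    have "cmod (f (z + of_real h *s w) - f z - fd f z (of_real h *s w)) \<le> 32 * M / \<rho>\<^sup>2 * (norm (of_real h *s w))\<^sup>2"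
      by (rule hol_cauchy(2)[OF fb _ \<rho> small]) (use R(4) sub in blast)
    then have "cmod (f (z + of_real h *s w) - f z - of_real h * fd f z w) \<le> C * h * h"
      unfolding n holD(2)[OF f zU] by (simp add: C_def power_mult_distrib power2_eq_square mult_ac)
    then have "cmod (f (z + of_real h *s w) - f z - of_real h * fd f z w) / h \<le> C * h"
      using h by (simp add: pos_divide_le_eq)
    moreover have "cmod ((f (z + of_real h *s w) - f z) / of_real h - fd f z w)
       = cmod (f (z + of_real h *s w) - f z - of_real h * fd f z w) / h"
    proof -
      have "(f (z + of_real h *s w) - f z) / of_real h - fd f z w
        = (f (z + of_real h *s w) - f z - of_real h * fd f z w) / of_real h"
        using h by (simp add: field_simps)
      then show ?thesis using h by (simp add: norm_divide)
    qed
    ultimately show "z + of_real h *s w \<in> U \<and>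
       cmod ((f (z + of_real h *s w) - f z) / of_real h - fd f z w) \<le> C * h"
      using inU by simp
  qed (use \<rho> h0 in auto)
qed

text \<open>
  A directional derivative is the sum of a telescoping series of difference quotients with step
  sizes \<open>h0 / 2^k\<close>. Its terms decrease geometrically, so Weierstrass' theorem applies.
\<close>

lemma hol_fd:
  assumes f: "hol U f" and U: "open U"
  shows "hol U (\<lambda>z. fd f z w)"
proof -
  have "\<exists>D. ((\<lambda>z. fd f z w) has_derivative D) (at z0) \<and> (\<forall>c w. D (c *s w) = c * D w)" if z0: "z0 \<in> U" for z0
  proof -
    obtain \<rho> h0 C where \<rho>: "\<rho> > 0" "h0 > 0" "C \<ge> 0" "ball z0 \<rho> \<subseteq> U"
      and q: "\<And>z h. z \<in> ball z0 \<rho> \<Longrightarrow> 0 < h \<Longrightarrow> h \<le> h0 \<Longrightarrow>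
       z + of_real h *s w \<in> U \<and>
       cmod ((f (z + of_real h *s w) - f z) / of_real h - fd f z w) \<le> C * h"
      using hol_difference_quotient[OF f U z0] by blast
    define h where "h k = h0 / 2 ^ k" for k :: nat
    have h: "0 < h k" "h k \<le> h0" for k using \<rho>(2) by (auto simp: h_def field_simps)
    define Q where "Q k z = (f (z + of_real (h k) *s w) - f z) / of_real (h k)" for k z
    have Qh: "hol (ball z0 \<rho>) (Q k)" for k
      unfolding Q_def using q h[of k] hol_subset[OF f \<rho>(4)]
      by (intro hol_divide hol_diff hol_const hol_shift(1)[OF f]) auto
    have Qe: "cmod (Q k z - fd f z w) \<le> C * h k" if "z \<in> ball z0 \<rho>" for k z
      using q[OF that h] by (simp add: Q_def)
    have Qd: "cmod (Q (Suc k) z - Q k z) \<le> 2 * C * h0 * (1/2) ^ k" if "z \<in> ball z0 \<rho>" for k z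
    proof -
      have "cmod (Q (Suc k) z - Q k z) \<le> cmod (Q (Suc k) z - fd f z w) + cmod (Q k z - fd f z w)"
        using norm_triangle_ineq4[of "Q (Suc k) z - fd f z w" "Q k z - fd f z w"] by simp
      also have "\<dots> \<le> C * h (Suc k) + C * h k" by (intro add_mono Qe that)
      also have "\<dots> \<le> C * h k + C * h k"
        using \<rho> by (intro add_mono mult_left_mono) (auto simp: h_def field_simps)
      finally show ?thesis by (simp add: h_def field_simps)
    qed
    have sM: "(\<lambda>k. 2 * C * h0 * (1/2) ^ k) summable_on (UNIV :: nat set)"
      by (intro summable_on_cmult_right norm_summable_imp_summable_on) (simp add: summable_geometric)
    have "hol (ball z0 \<rho>) (\<lambda>z. infsum (\<lambda>k. Q (Suc k) z - Q k z) UNIV)"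
      by (rule hol_infsum[OF _ _ sM]) (auto intro: hol_diff Qh Qd simp del: mem_ball)
    then have hs: "hol (ball z0 \<rho>) (\<lambda>z. Q 0 z + infsum (\<lambda>k. Q (Suc k) z - Q k z) UNIV)"
      by (intro hol_add Qh)
    have eq: "Q 0 z + infsum (\<lambda>k. Q (Suc k) z - Q k z) UNIV = fd f z w" if z: "z \<in> ball z0 \<rho>" for z
    proof -
      have h_lim: "(\<lambda>k. C * h k) \<longlonglongrightarrow> 0"
        unfolding h_def by real_asymp
      have "(\<lambda>k. Q k z - fd f z w) \<longlonglongrightarrow> 0"
        by (rule Lim_null_comparison[OF _ h_lim]) (use Qe[OF z] in auto)
      then have "(\<lambda>k. Q k z) \<longlonglongrightarrow> fd f z w" using LIM_zero_iff by blast
      then have "(\<lambda>k. Q (Suc k) z - Q k z) sums (fd f z w - Q 0 z)"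
        by (rule telescope_sums)
      moreover have "summable (\<lambda>k. norm (Q (Suc k) z - Q k z))"
        by (rule summable_comparison_test'[where g="\<lambda>k. 2 * C * h0 * (1/2) ^ k" and N=0])
          (use Qd[OF z] in \<open>auto intro: summable_mult summable_geometric\<close>)
      ultimately have "((\<lambda>k. Q (Suc k) z - Q k z) has_sum (fd f z w - Q 0 z)) UNIV"
        by (intro norm_summable_imp_has_sum) auto
      then show ?thesis by (simp add: infsumI)
    qed
    have "hol (ball z0 \<rho>) (\<lambda>z. fd f z w)"
      by (rule hol_cong[OF hs open_ball eq])
    then show ?thesis unfolding hol_def using \<rho>(1) by (meson centre_in_ball)
  qed
  then show ?thesis unfolding hol_def by blast
qed

text \<open>
  The error of the difference quotient in direction \<open>w\<close> is a holomorphic function of size \<open>O(h)\<close>, hence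
  so is its derivative in direction \<open>v\<close>. Letting \<open>h\<close> tend to \<open>0\<close> interchanges the two derivatives.
\<close>

lemma fd_symmetric:
  assumes f: "hol U f" and U: "open U" and z: "z0 \<in> U"
  shows "fd (\<lambda>z. fd f z v) z0 w = fd (\<lambda>z. fd f z w) z0 v"
proof -
  obtain \<rho> h0 C where \<rho>: "\<rho> > 0" "h0 > 0" "C \<ge> 0" "ball z0 \<rho> \<subseteq> U"
    and q: "\<And>z h. z \<in> ball z0 \<rho> \<Longrightarrow> 0 < h \<Longrightarrow> h \<le> h0 \<Longrightarrow>
       z + of_real h *s w \<in> U \<and>
       cmod ((f (z + of_real h *s w) - f z) / of_real h - fd f z w) \<le> C * h"
    using hol_difference_quotient[OF f U z] by blast
  have hv: "hol U (\<lambda>z. fd f z v)" by (rule hol_fd[OF f U])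
  obtain \<rho>' h0' C' where \<rho>': "\<rho>' > 0" "h0' > 0" "C' \<ge> 0" "ball z0 \<rho>' \<subseteq> U"
    and q': "\<And>z h. z \<in> ball z0 \<rho>' \<Longrightarrow> 0 < h \<Longrightarrow> h \<le> h0' \<Longrightarrow>
       z + of_real h *s w \<in> U \<and>
       cmod ((fd f (z + of_real h *s w) v - fd f z v) / of_real h - fd (\<lambda>z. fd f z v) z w) \<le> C' * h"
    using hol_difference_quotient[OF hv U z] by blast
  have z\<rho>: "z0 \<in> ball z0 \<rho>" "z0 \<in> ball z0 \<rho>'" using \<rho> \<rho>' by auto
  have est: "cmod (fd (\<lambda>z. fd f z v) z0 w - fd (\<lambda>z. fd f z w) z0 v) \<le> (C' + 2 * C / \<rho> * norm v) * h"
    if h: "0 < h" "h \<le> h0" "h \<le> h0'" for h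
  proof -
    let ?s = "of_real h *s w"
    let ?D = "\<lambda>z. (1 / of_real h) * (f (z + ?s) - f z)"
    define e where "e z = ?D z - fd f z w" for z
    have h1: "hol (ball z0 \<rho>) (\<lambda>z. f (z + ?s))"
      using q h by (intro hol_shift(1)[OF f]) auto
    have h2: "hol (ball z0 \<rho>) f" using hol_subset[OF f \<rho>(4)] .
    have h3: "hol (ball z0 \<rho>) (\<lambda>z. fd f z w)" using hol_subset[OF hol_fd[OF f U] \<rho>(4)] .
    have h4: "hol (ball z0 \<rho>) (\<lambda>z. f (z + ?s) - f z)" by (intro hol_diff h1 h2)
    have h5: "hol (ball z0 \<rho>) ?D" by (intro hol_mult hol_const h4)
    have he: "hol (ball z0 \<rho>) e" unfolding e_def by (intro hol_diff h5 h3)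
    have "cmod (e y) \<le> C * h" if "y \<in> ball z0 \<rho>" for y
      using q[OF that h(1,2)] by (simp add: e_def)
    from hol_cauchy(1)[OF he this \<rho>(1)]
    have e_bd: "cmod (fd e z0 v) \<le> 2 * (C * h) / \<rho> * norm v" .
    have sh: "fd (\<lambda>z. f (z + ?s)) z0 = fd f (z0 + ?s)"
      by (rule hol_shift(2)[OF f _ z\<rho>(1)]) (use q h in auto)
    have "fd e z0 v = fd ?D z0 v - fd (\<lambda>z. fd f z w) z0 v"
      unfolding e_def by (rule fd_rules(2)[OF h5 h3 z\<rho>(1)])
    also have "fd ?D z0 v = (1 / of_real h) * fd (\<lambda>z. f (z + ?s) - f z) z0 v"
      by (rule fd_rules(4)[OF h4 h4 z\<rho>(1)])
    also have "fd (\<lambda>z. f (z + ?s) - f z) z0 v = fd f (z0 + ?s) v - fd f z0 v"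
      using fd_rules(2)[OF h1 h2 z\<rho>(1)] sh by simp
    finally have "fd e z0 v = (fd f (z0 + ?s) v - fd f z0 v) / of_real h - fd (\<lambda>z. fd f z w) z0 v"
      by simp
    moreover have "cmod ((fd f (z0 + ?s) v - fd f z0 v) / of_real h - fd (\<lambda>z. fd f z v) z0 w) \<le> C' * h"
      using q'[OF z\<rho>(2) h(1,3)] by simp
    ultimately have "cmod (fd (\<lambda>z. fd f z v) z0 w - fd (\<lambda>z. fd f z w) z0 v) \<le> C' * h + 2 * (C * h) / \<rho> * norm v"
      using e_bd norm_triangle_ineq4[of "fd e z0 v" "(fd f (z0 + ?s) v - fd f z0 v) / of_real h - fd (\<lambda>z. fd f z v) z0 w"]
      by simp
    then show ?thesis by (simp add: algebra_simps)
  qed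
  let ?B = "C' + 2 * C / \<rho> * norm v" and ?d = "cmod (fd (\<lambda>z. fd f z v) z0 w - fd (\<lambda>z. fd f z w) z0 v)"
  have "?d \<le> 0"
  proof (rule tendsto_lowerbound[where F="at_right 0" and f="\<lambda>h. ?B * h"])
    show "((\<lambda>h. ?B * h) \<longlongrightarrow> 0) (at_right 0)" by (auto intro!: tendsto_eq_intros)
    have "eventually (\<lambda>h. h \<in> {0<..<min h0 h0'}) (at_right 0)"
      using \<rho> \<rho>' by (intro eventually_at_right_real) auto
    then show "\<forall>\<^sub>F h in at_right 0. ?d \<le> ?B * h"
      by eventually_elim (use est in auto)
  qed simp
  then show ?thesis by simp
qed

section \<open>The identity theorem at real points\<close>

lemma norm_cnjv [simp]: "norm (cnjv z) = norm z"
  by (simp add: cnjv_def norm_vec_def)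

lemma norm_cvec [simp]: "norm (cvec x) = norm x"
  by (simp add: cvec_def norm_vec_def)

lemma cvec_diff: "cvec (x - y) = cvec x - cvec y"
  and cvec_add: "cvec (x + y) = cvec x + cvec y"
  and cvec_scaleR: "cvec (r *\<^sub>R x) = r *\<^sub>R cvec x"
  by (simp_all add: scaleR_eq_scale_vec cvec_def vec_eq_iff)

lemma dist_cvec [simp]: "dist (cvec x) (cvec y) = dist x y"
  by (simp add: dist_norm cvec_diff[symmetric])

lemma cvec_in_ball [simp]: "cvec x \<in> ball (cvec p) r \<longleftrightarrow> x \<in> ball p r"
  by simp

text \<open>
  A point \<open>z = u + \<i> v\<close> lies on the complex line \<open>u + \<zeta> v\<close>, whose real points are real vectors. The part of
  the line in the ball is convex, so a function that vanishes at the real points vanishes at \<open>z\<close> by the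
  identity theorem in one variable. This is how every relation that holds on the real manifold
  is carried over to its complexification.
\<close>

lemma hol_identity:
  fixes f :: "complex^'m \<Rightarrow> complex"
  assumes f: "hol (ball (cvec p) r) f" and zero: "\<And>x. x \<in> ball p r \<Longrightarrow> f (cvec x) = 0"
    and z: "z \<in> ball (cvec p) r"
  shows "f z = 0"
proof -
  define u :: "real^'m" where "u = (\<chi> i. Re (z $ i))"
  define v :: "real^'m" where "v = (\<chi> i. Im (z $ i))"
  define A where "A = {\<zeta>. cvec u + \<zeta> *s cvec v \<in> ball (cvec p) r}"
  have z_eq: "z = cvec u + \<i> *s cvec v"
    by (simp add: vec_eq_iff u_def v_def cvec_def complex_eq_iff)
  have "norm (u - p) \<le> norm (z - cvec p)"
    unfolding norm_vec_def by (rule L2_set_mono) (auto simp: u_def cvec_def intro: order_trans[OF _ abs_Re_le_cmod])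
  then have "u \<in> ball p r" using z by (simp add: dist_norm norm_minus_commute)
  then have 0: "0 \<in> A" by (simp add: A_def)
  have cont: "continuous_on UNIV (\<lambda>\<zeta>. cvec u + \<zeta> *s cvec v)" by (rule continuous_scale_vec)
  have op: "open A" unfolding A_def
    using open_vimage[OF open_ball cont] by (simp add: vimage_def)
  have "convex A"
  proof (rule convexI)
    fix x y :: complex and a b :: real assume *: "x \<in> A" "y \<in> A" "0 \<le> a" "0 \<le> b" "a + b = 1"
    have "cvec u + (a *\<^sub>R x + b *\<^sub>R y) *s cvec v
       = a *\<^sub>R (cvec u + x *s cvec v) + b *\<^sub>R (cvec u + y *s cvec v)"
    proof -
      have ab: "complex_of_real a + complex_of_real b = 1"
        using *(5) by (metis of_real_1 of_real_add)
      have "s + (complex_of_real a * x + complex_of_real b * y) * t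
          = complex_of_real a * (s + x * t) + complex_of_real b * (s + y * t)" for s t
      proof -
        have "complex_of_real a * (s + x * t) + complex_of_real b * (s + y * t)
          = (complex_of_real a + complex_of_real b) * s
            + (complex_of_real a * x + complex_of_real b * y) * t" by (simp add: algebra_simps)
        then show ?thesis using ab by simp
      qed
      then show ?thesis
        unfolding vec_eq_iff scaleR_eq_scale_vec scaleR_conv_of_real[where 'a=complex]
          vector_add_component vector_smult_component by blast
    qed
    then show "a *\<^sub>R x + b *\<^sub>R y \<in> A"
      using convexD[OF convex_ball, of "cvec u + x *s cvec v" "cvec p" r "cvec u + y *s cvec v" a b] *
      by (simp add: A_def)
  qed
  then have conn: "connected A" by (rule convex_connected)
  have hg: "(\<lambda>\<zeta>. f (cvec u + \<zeta> *s cvec v)) holomorphic_on A"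
    using hol_line[OF f] op by (subst holomorphic_on_open) (auto simp: A_def)
  have "(\<lambda>\<zeta>. f (cvec u + \<zeta> *s cvec v)) \<i> = 0"
  proof (rule analytic_continuation[OF hg op conn, where w="\<i>" and \<xi>=0 and U="{\<zeta> \<in> A. \<zeta> \<in> \<real>}"])
    show "\<i> \<in> A" using z z_eq by (simp add: A_def)
    show "{\<zeta> \<in> A. \<zeta> \<in> \<real>} \<subseteq> A" by auto
    show "0 \<in> A" by (rule 0)
    show "0 islimpt {\<zeta> \<in> A. \<zeta> \<in> \<real>}"
    proof (subst islimpt_approachable, intro allI impI)
      fix e :: real assume e: "e > 0"
      obtain d where d: "d > 0" "ball 0 d \<subseteq> A" using op 0 openE by blast
      show "\<exists>x'\<in>{\<zeta> \<in> A. \<zeta> \<in> \<real>}. x' \<noteq> 0 \<and> dist x' 0 < e"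
        using e d by (intro bexI[of _ "of_real (min d e / 2)"]) (auto simp: subset_iff)
    qed
    fix \<zeta> assume \<zeta>: "\<zeta> \<in> {\<zeta> \<in> A. \<zeta> \<in> \<real>}"
    then obtain t where t: "\<zeta> = of_real t" by (auto elim: Reals_cases)
    have eq: "cvec u + \<zeta> *s cvec v = cvec (u + t *\<^sub>R v)"
      by (simp add: t cvec_add cvec_scaleR scaleR_eq_scale_vec)
    show "f (cvec u + \<zeta> *s cvec v) = 0"
      using \<zeta> zero[of "u + t *\<^sub>R v"] cvec_in_ball[of "u + t *\<^sub>R v" p r] by (simp add: A_def eq del: mem_ball cvec_in_ball) 
  qed
  then show ?thesis using z_eq by simp
qed

section \<open>Holomorphic extension of real-analytic functions\<close>

lemma vec_nth_has_sum:
  fixes f :: "'i \<Rightarrow> complex^'m"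
  shows "(f has_sum s) I \<Longrightarrow> ((\<lambda>x. f x $ i) has_sum (s $ i)) I"
  using has_sum_bounded_linear[OF bounded_linear_vec_nth[of i], of f I s] by (simp add: o_def)

text \<open>
  Absolute convergence at the single real point \<open>a + (s, \<dots>, s)\<close> dominates the power series at all
  complex points whose coordinates differ from those of \<open>a\<close> by at most \<open>s\<close>.
\<close>

lemma analytic_extension:
  fixes f :: "real^'m \<Rightarrow> complex^'m"
  assumes f: "real_analytic_on U f" and a: "a \<in> U"
  obtains \<delta> F where "\<delta> > 0" "holomorphic_vf (ball (cvec a) \<delta>) F" "\<And>x. x \<in> ball a \<delta> \<Longrightarrow> F (cvec x) = f x"
proof -
  obtain r c where r: "r > 0" and c: "\<And>x. x \<in> ball a r \<Longrightarrow>
    ((\<lambda>\<alpha>. (\<Prod>i\<in>UNIV. (x $ i - a $ i) ^ \<alpha> i) *\<^sub>R c \<alpha>) has_sum f x) UNIV"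
    using f a unfolding real_analytic_on_def by blast
  define m where "m = real CARD('m)"
  have m: "m \<ge> 1" by (simp add: m_def Suc_le_eq)
  \<comment> \<open>the factor \<open>2 m\<close> puts the point \<open>a + (s, \<dots>, s)\<close> into the ball of convergence\<close>
  define s where "s = r / (2 * m)"
  have s: "s > 0" using r m by (simp add: s_def)
  define S where "S \<alpha> = (\<Prod>i\<in>UNIV. s ^ \<alpha> i)" for \<alpha> :: "'m \<Rightarrow> nat"
  have S0: "S \<alpha> > 0" for \<alpha> using s by (simp add: S_def prod_pos)
  define x0 where "x0 = a + (\<chi> i. s)"
  have "dist a x0 \<le> (\<Sum>i\<in>UNIV. \<bar>((\<chi> i. s) :: real^'m) $ i\<bar>)"
    using norm_le_l1_cart[of "(\<chi> i. s) :: real^'m"] by (simp add: dist_norm x0_def)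
  also have "\<dots> = m * s" using s by (simp add: m_def)
  also have "\<dots> = r / 2" using m by (simp add: s_def)
  finally have x0: "x0 \<in> ball a r" using r by simp
  have sum_le: "s \<le> r" using m r by (simp add: s_def field_simps)
  have sM: "(\<lambda>\<alpha>. S \<alpha> * cmod (c \<alpha> $ i)) summable_on UNIV" for i
  proof -
    have "(\<lambda>\<alpha>. S \<alpha> *\<^sub>R (c \<alpha> $ i)) summable_on UNIV"
      using vec_nth_has_sum[OF c[OF x0], of i] by (auto simp: summable_on_def x0_def S_def)
    then have "(\<lambda>\<alpha>. cmod (S \<alpha> *\<^sub>R (c \<alpha> $ i))) summable_on UNIV"
      by (simp add: summable_on_iff_abs_summable_on_complex)
    then show ?thesis using S0 by (simp add: less_imp_le)
  qed
  define T where "T i \<alpha> z = (\<Prod>j\<in>UNIV. (z $ j - cvec a $ j) ^ \<alpha> j) * c \<alpha> $ i" for i \<alpha> z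
  have hT: "hol V (T i \<alpha>)" for V i \<alpha>
    unfolding T_def by (intro hol_mult hol_prod hol_power hol_diff hol_component hol_const)
  have bT: "cmod (T i \<alpha> z) \<le> S \<alpha> * cmod (c \<alpha> $ i)" if z: "z \<in> ball (cvec a) s" for i \<alpha> z
  proof -
    have "cmod (z $ j - cvec a $ j) \<le> s" for j
      using Finite_Cartesian_Product.norm_nth_le[where x="z - cvec a" and i=j] z by (simp add: dist_norm norm_minus_commute)
    then have "cmod (\<Prod>j\<in>UNIV. (z $ j - cvec a $ j) ^ \<alpha> j) \<le> S \<alpha>"
      unfolding S_def prod_norm[symmetric] norm_power by (intro prod_mono conjI power_mono) auto
    then show ?thesis unfolding T_def norm_mult by (rule mult_right_mono) simp
  qed
  define F where "F z = (\<chi> i. infsum (\<lambda>\<alpha>. T i \<alpha> z) UNIV)" for z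
  have "hol (ball (cvec a) s) (\<lambda>z. infsum (\<lambda>\<alpha>. T i \<alpha> z) UNIV)" for i
    by (rule hol_infsum[OF hT bT sM])
  then have "holomorphic_vf (ball (cvec a) s) F" by (simp add: holomorphic_vf_iff F_def)
  moreover have "F (cvec x) = f x" if x: "x \<in> ball a s" for x
  proof -
    have "x \<in> ball a r" using x sum_le by simp
    from vec_nth_has_sum[OF c[OF this]]
    have "((\<lambda>\<alpha>. T i \<alpha> (cvec x)) has_sum f x $ i) UNIV" for i
      by (simp add: T_def cvec_def scaleR_conv_of_real[where 'a=complex])
    then show ?thesis by (auto simp: F_def vec_eq_iff intro: infsumI)
  qed
  ultimately show ?thesis using that s by blast
qed

lemma real_analytic_subset: "real_analytic_on U f \<Longrightarrow> V \<subseteq> U \<Longrightarrow> real_analytic_on V f"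
  unfolding real_analytic_on_def by blast

lemma real_analytic_linear:
  assumes f: "real_analytic_on U f" and T: "bounded_linear T"
  shows "real_analytic_on U (\<lambda>x. T (f x))"
  unfolding real_analytic_on_def
proof
  fix a assume "a \<in> U"
  then obtain r c where r: "r > 0" and c: "\<And>x. x \<in> ball a r \<Longrightarrow>
    ((\<lambda>\<alpha>. (\<Prod>i\<in>UNIV. (x $ i - a $ i) ^ \<alpha> i) *\<^sub>R c \<alpha>) has_sum f x) UNIV"
    using f unfolding real_analytic_on_def by blast
  show "\<exists>r>0. \<exists>c. \<forall>x\<in>ball a r. ((\<lambda>\<alpha>. (\<Prod>i\<in>UNIV. (x $ i - a $ i) ^ \<alpha> i) *\<^sub>R c \<alpha>) has_sum T (f x)) UNIV"
    by (rule exI[of _ r], intro conjI r exI[of _ "\<lambda>\<alpha>. T (c \<alpha>)"] ballI)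
      (use has_sum_bounded_linear[OF T c] T in \<open>auto simp: o_def linear_simps\<close>)
qed

lemma real_analytic_add:
  assumes f: "real_analytic_on U f" and g: "real_analytic_on U g"
  shows "real_analytic_on U (\<lambda>x. f x + g x)"
  unfolding real_analytic_on_def
proof
  fix a assume a: "a \<in> U"
  obtain r c where r: "r > 0" and c: "\<And>x. x \<in> ball a r \<Longrightarrow>
    ((\<lambda>\<alpha>. (\<Prod>i\<in>UNIV. (x $ i - a $ i) ^ \<alpha> i) *\<^sub>R c \<alpha>) has_sum f x) UNIV"
    using f a unfolding real_analytic_on_def by blast
  obtain r' c' where r': "r' > 0" and c': "\<And>x. x \<in> ball a r' \<Longrightarrow>
    ((\<lambda>\<alpha>. (\<Prod>i\<in>UNIV. (x $ i - a $ i) ^ \<alpha> i) *\<^sub>R c' \<alpha>) has_sum g x) UNIV"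
    using g a unfolding real_analytic_on_def by blast
  show "\<exists>r>0. \<exists>c. \<forall>x\<in>ball a r. ((\<lambda>\<alpha>. (\<Prod>i\<in>UNIV. (x $ i - a $ i) ^ \<alpha> i) *\<^sub>R c \<alpha>) has_sum f x + g x) UNIV"
    by (rule exI[of _ "min r r'"], intro conjI exI[of _ "\<lambda>\<alpha>. c \<alpha> + c' \<alpha>"] ballI)
      (use r r' has_sum_add[OF c c'] in \<open>auto simp: scaleR_add_right\<close>)
qed

lemma real_analytic_zero: "real_analytic_on U (\<lambda>_. 0)"
  unfolding real_analytic_on_def by (intro ballI exI[of _ 1] conjI exI[of _ "\<lambda>_. 0"]) auto

lemma bounded_linear_scale_vec: "bounded_linear (\<lambda>w. c *s (w :: complex^'m))"
  by (rule bounded_linear_intro[where K="cmod c"])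
    (auto simp: norm_scale_vec mult.commute vec_eq_iff scaleR_conv_of_real[where 'a=complex] algebra_simps)

lemma bounded_linear_cnjv: "bounded_linear cnjv"
  by (rule bounded_linear_intro[where K=1]) (auto, auto simp: cnjv_def vec_eq_iff)

lemma real_analytic_scale: "real_analytic_on U f \<Longrightarrow> real_analytic_on U (\<lambda>x. c *s f x)"
  by (rule real_analytic_linear[OF _ bounded_linear_scale_vec])

lemma real_analytic_cnjv: "real_analytic_on U f \<Longrightarrow> real_analytic_on U (\<lambda>x. cnjv (f x))"
  by (rule real_analytic_linear[OF _ bounded_linear_cnjv])

lemma real_analytic_sum:
  "(\<And>i. i \<in> I \<Longrightarrow> real_analytic_on U (f i)) \<Longrightarrow> real_analytic_on U (\<lambda>x. \<Sum>i\<in>I. f i x)"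
  by (induction I rule: infinite_finite_induct) (auto intro: real_analytic_zero real_analytic_add)

lemma real_analytic_cong:
  assumes f: "real_analytic_on U f" and U: "open U" and eq: "\<And>x. x \<in> U \<Longrightarrow> f x = g x"
  shows "real_analytic_on U g"
  unfolding real_analytic_on_def
proof
  fix a assume a: "a \<in> U"
  obtain r c where r: "r > 0" and c: "\<And>x. x \<in> ball a r \<Longrightarrow>
    ((\<lambda>\<alpha>. (\<Prod>i\<in>UNIV. (x $ i - a $ i) ^ \<alpha> i) *\<^sub>R c \<alpha>) has_sum f x) UNIV"
    using f a unfolding real_analytic_on_def by blast
  obtain d where d: "d > 0" "ball a d \<subseteq> U" using U a openE by blast
  show "\<exists>r>0. \<exists>c. \<forall>x\<in>ball a r. ((\<lambda>\<alpha>. (\<Prod>i\<in>UNIV. (x $ i - a $ i) ^ \<alpha> i) *\<^sub>R c \<alpha>) has_sum g x) UNIV"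
  proof (rule exI[of _ "min r d"], intro conjI exI[of _ c] ballI)
    fix x assume "x \<in> ball a (min r d)"
    then show "((\<lambda>\<alpha>. (\<Prod>i\<in>UNIV. (x $ i - a $ i) ^ \<alpha> i) *\<^sub>R c \<alpha>) has_sum g x) UNIV"
      using c[of x] eq[of x] d by auto
  qed (use r d in auto)
qed

section \<open>Linear algebra with holomorphic coefficients\<close>

lemma hol_det:
  fixes A :: "complex^'m \<Rightarrow> complex^'n^'n"
  assumes "\<And>i j. hol U (\<lambda>z. A z $ i $ j)" shows "hol U (\<lambda>z. det (A z))"
  unfolding det_def by (intro hol_sum hol_mult hol_prod hol_const assms)

lemma matrix_inv_inverse:
  assumes "det (A :: 'a::field^'m^'m) \<noteq> 0"
  shows "A ** matrix_inv A = mat 1" "matrix_inv A ** A = mat 1"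
proof -
  have "\<exists>A'. A ** A' = mat 1 \<and> A' ** A = mat 1"
    using assms by (simp add: invertible_det_nz[symmetric] invertible_def)
  then have "A ** matrix_inv A = mat 1 \<and> matrix_inv A ** A = mat 1"
    unfolding matrix_inv_def by (rule someI_ex)
  then show "A ** matrix_inv A = mat 1" "matrix_inv A ** A = mat 1" by auto
qed

text \<open>
  By Cramer's rule the solution of a linear system with holomorphic coefficients is holomorphic.
\<close>

lemma hol_matrix_solve:
  fixes A :: "complex^'m \<Rightarrow> complex^'m^'m"
  assumes A: "\<And>i j. hol U (\<lambda>z. A z $ i $ j)" and b: "holomorphic_vf U b"
    and U: "open U" and nz: "\<And>z. z \<in> U \<Longrightarrow> det (A z) \<noteq> 0"
  shows "holomorphic_vf U (\<lambda>z. matrix_inv (A z) *v b z)"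
    and "z \<in> U \<Longrightarrow> A z *v (matrix_inv (A z) *v b z) = b z"
proof -
  have inv: "A z ** matrix_inv (A z) = mat 1" if "z \<in> U" for z
    by (rule matrix_inv_inverse(1)[OF nz[OF that]])
  then show sol: "A z *v (matrix_inv (A z) *v b z) = b z" if "z \<in> U" for z
    using that by (simp add: matrix_vector_mul_assoc)
  have b': "hol U (\<lambda>z. b z $ i)" for i using b by (simp add: holomorphic_vf_iff)
  have "hol U (\<lambda>z. (matrix_inv (A z) *v b z) $ k)" for k
  proof -
    have eq: "(matrix_inv (A z) *v b z) $ k = det (\<chi> i j. if j = k then b z $ i else A z $ i $ j) / det (A z)" if "z \<in> U" for z
      using cramer[THEN iffD1, OF nz[OF that] sol[OF that]] by simp
    have "hol U (\<lambda>z. det (\<chi> i j. if j = k then b z $ i else A z $ i $ j) / det (A z))"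
    proof (intro hol_divide hol_det nz)
      fix i j show "hol U (\<lambda>z. (\<chi> i j. if j = k then b z $ i else A z $ i $ j) $ i $ j)"
        using A b' by (cases "j = k") auto
    qed (use A in auto)
    then show ?thesis by (rule hol_cong[OF _ U eq[symmetric]])
  qed
  then show "holomorphic_vf U (\<lambda>z. matrix_inv (A z) *v b z)" by (simp add: holomorphic_vf_iff)
qed

lemma hol_nonzero_nbhd:
  assumes "hol U f" "open U" "a \<in> U" "f a \<noteq> 0"
  obtains V where "open V" "a \<in> V" "V \<subseteq> U" "\<And>z. z \<in> V \<Longrightarrow> f z \<noteq> 0"
proof -
  have "open (U \<inter> f -` (- {0}))"
    by (rule continuous_open_preimage[OF hol_continuous[OF assms(1)] assms(2)]) auto
  then show ?thesis using assms(3,4) that[of "U \<inter> f -` (- {0})"] by auto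
qed

text \<open>
  The coordinates of a vector with respect to a holomorphic frame. The frame is indexed by natural
  numbers, so that initial segments of it can span subdistributions; \<open>b\<close> translates to the index type.
\<close>

lemma local_coframe:
  fixes E :: "nat \<Rightarrow> complex^'m \<Rightarrow> complex^'m"
  assumes E: "\<And>i. i < CARD('m) \<Longrightarrow> holomorphic_vf U (E i)" and U: "open U" "a \<in> U"
    and indep: "\<And>c. (\<Sum>i<CARD('m). c i *s E i a) = 0 \<Longrightarrow> \<forall>i<CARD('m). c i = 0"
  obtains V \<kappa> where "open V" "a \<in> V" "V \<subseteq> U"
    "\<And>z v. z \<in> V \<Longrightarrow> (\<Sum>i<CARD('m). \<kappa> i z v *s E i z) = v"
    "\<And>z i j. z \<in> V \<Longrightarrow> i < CARD('m) \<Longrightarrow> j < CARD('m) \<Longrightarrow> \<kappa> i z (E j z) = (if i = j then 1 else 0)"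
    "\<And>z i v w. \<kappa> i z (v + w) = \<kappa> i z v + \<kappa> i z w"
    "\<And>z i c v. \<kappa> i z (c *s v) = c * \<kappa> i z v"
    "\<And>i Y W. holomorphic_vf W Y \<Longrightarrow> open W \<Longrightarrow> W \<subseteq> V \<Longrightarrow> hol W (\<lambda>z. \<kappa> i z (Y z))"
proof -
  obtain b :: "'m \<Rightarrow> nat" where b: "bij_betw b UNIV {..<CARD('m)}"
    using ex_bij_betw_finite_nat[of "UNIV :: 'm set"] by (auto simp: lessThan_atLeast0)
  have bN: "b c < CARD('m)" for c using b by (auto simp: bij_betw_def)
  define b' where "b' = inv_into UNIV b"
  have bb': "b (b' i) = i" if "i < CARD('m)" for i
    using bij_betw_inv_into_right[OF b] that by (simp add: b'_def)
  have b'b: "b' (b c) = c" for c using bij_betw_inv_into_left[OF b] by (simp add: b'_def)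
  define B where "B z = (\<chi> r c. E (b c) z $ r)" for z
  have Bv: "B z *v x = (\<Sum>i<CARD('m). x $ (b' i) *s E i z)" for z x
  proof -
    have "B z *v x = (\<Sum>c\<in>UNIV. x $ c *s E (b c) z)"
      by (simp add: B_def matrix_vector_mult_def vec_eq_iff mult.commute)
    also have "\<dots> = (\<Sum>i<CARD('m). x $ (b' i) *s E i z)"
      by (rule sum.reindex_bij_betw[OF b, of "\<lambda>i. x $ (b' i) *s E i z", unfolded b'b])
    finally show ?thesis .
  qed
  have hB: "hol U (\<lambda>z. B z $ i $ j)" for i j
    using E[OF bN] by (simp add: B_def holomorphic_vf_iff)
  have "det (B a) \<noteq> 0"
  proof -
    have "x = 0" if "B a *v x = 0" for x
    proof -
      have "\<forall>i<CARD('m). x $ (b' i) = 0" by (rule indep) (use that Bv in simp)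
      then show "x = 0" using bN b'b by (metis vec_eq_iff zero_index)
    qed
    then show ?thesis
      using matrix_left_invertible_ker[of "B a"] invertible_left_inverse[of "B a"] invertible_det_nz by blast
  qed
  then obtain V where V: "open V" "a \<in> V" "V \<subseteq> U" and nz: "\<And>z. z \<in> V \<Longrightarrow> det (B z) \<noteq> 0"
    using hol_nonzero_nbhd[OF hol_det[OF hB] U] by blast
  define \<kappa> where "\<kappa> i z v = (matrix_inv (B z) *v v) $ (b' i)" for i z v
  show ?thesis
  proof (rule that[OF V])
    fix z v assume z: "z \<in> V"
    show "(\<Sum>i<CARD('m). \<kappa> i z v *s E i z) = v"
      using Bv[of z "matrix_inv (B z) *v v"] matrix_inv_inverse(1)[OF nz[OF z]]
      by (simp add: \<kappa>_def matrix_vector_mul_assoc)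
  next
    fix z i j assume z: "z \<in> V" and ij: "i < CARD('m)" "j < CARD('m)"
    have "B z *v axis (b' j) 1 = (\<Sum>i<CARD('m). (if i = j then 1 else 0) *s E i z)"
      unfolding Bv using ij bb' by (intro sum.cong) (auto simp: axis_def, metis)
    also have "\<dots> = (\<Sum>i<CARD('m). if i = j then E i z else 0)" by (intro sum.cong) auto
    also have "\<dots> = E j z" using ij by simp
    finally have "matrix_inv (B z) *v E j z = axis (b' j) 1"
      using matrix_inv_inverse(2)[OF nz[OF z]] by (metis matrix_vector_mul_assoc matrix_vector_mul_lid)
    then show "\<kappa> i z (E j z) = (if i = j then 1 else 0)"
      using ij bb' by (auto simp: \<kappa>_def axis_def) metis
  next
    fix i and Y :: "complex^'m \<Rightarrow> complex^'m" and W assume Y: "holomorphic_vf W Y" "open W" "W \<subseteq> V"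
    have "holomorphic_vf W (\<lambda>z. matrix_inv (B z) *v Y z)"
      by (rule hol_matrix_solve(1)[OF _ Y(1,2)]) (use hol_subset[OF hB] Y V nz in auto)
    then show "hol W (\<lambda>z. \<kappa> i z (Y z))" by (simp add: \<kappa>_def holomorphic_vf_iff)
  qed (simp_all add: \<kappa>_def matrix_vector_right_distrib vector_scalar_commute)
qed

section \<open>Brackets of holomorphic fields\<close>

lemma fd_vf_linear:
  assumes "holomorphic_vf U X" "z \<in> U"
  shows "fd X z (v + w) = fd X z v + fd X z w" "fd X z (v - w) = fd X z v - fd X z w" "fd X z 0 = 0"
    "fd X z (\<Sum>i\<in>S. c i *s u i) = (\<Sum>i\<in>S. c i *s fd X z (u i))"
proof -
  have bl: "bounded_linear (fd X z)"
    using holomorphic_vfD(1)[OF assms] has_derivative_bounded_linear by blast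
  then show "fd X z (v + w) = fd X z v + fd X z w" "fd X z (v - w) = fd X z v - fd X z w" "fd X z 0 = 0"
    by (auto simp: linear_simps)
  show "fd X z (\<Sum>i\<in>S. c i *s u i) = (\<Sum>i\<in>S. c i *s fd X z (u i))"
    using bl by (induction S rule: infinite_finite_induct)
      (auto simp: linear_simps holomorphic_vfD(2)[OF assms])
qed

lemma fd_linear:
  assumes "hol U f" "z \<in> U"
  shows "fd f z (v + w) = fd f z v + fd f z w" "fd f z (v - w) = fd f z v - fd f z w"
    "fd f z (\<Sum>i\<in>S. c i *s u i) = (\<Sum>i\<in>S. c i * fd f z (u i))"
proof -
  have bl: "bounded_linear (fd f z)" using hol_fd_linear[OF assms] .
  then show "fd f z (v + w) = fd f z v + fd f z w" "fd f z (v - w) = fd f z v - fd f z w"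
    by (auto simp: linear_simps)
  show "fd f z (\<Sum>i\<in>S. c i *s u i) = (\<Sum>i\<in>S. c i * fd f z (u i))"
    using bl by (induction S rule: infinite_finite_induct)
      (auto simp: linear_simps holD(2)[OF assms])
qed

lemma holomorphic_vf_scale:
  assumes "hol V f" "holomorphic_vf V X" shows "holomorphic_vf V (\<lambda>z. f z *s X z)"
  using assms unfolding holomorphic_vf_iff by (auto intro!: hol_mult)

lemma has_derivative_scale_vf:
  assumes y: "hol V y" and E: "holomorphic_vf V E" and z: "z \<in> V"
  shows "((\<lambda>z. y z *s E z) has_derivative (\<lambda>w. fd y z w *s E z + y z *s fd E z w)) (at z)"
proof -
  have "((\<lambda>z. y z *s E z) has_derivative fd (\<lambda>z. y z *s E z) z) (at z)"
    by (rule holomorphic_vfD(1)[OF holomorphic_vf_scale[OF y E] z])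
  moreover have "fd (\<lambda>z. y z *s E z) z w = fd y z w *s E z + y z *s fd E z w" for w
  proof -
    have Ei: "hol V (\<lambda>z. E z $ i)" for i using E by (simp add: holomorphic_vf_iff)
    show ?thesis
      unfolding vec_eq_iff
      using fd_component[OF holomorphic_vf_scale[OF y E] z] fd_rules(3)[OF y Ei z]
        fd_component[OF E z]
      by simp
  qed
  then have "fd (\<lambda>z. y z *s E z) z = (\<lambda>w. fd y z w *s E z + y z *s fd E z w)" by (rule ext)
  ultimately show ?thesis by (rule subst[rotated])
qed

lemma fd_lincomb:
  assumes E: "\<And>i. i \<in> S \<Longrightarrow> holomorphic_vf V (E i)" and y: "\<And>i. i \<in> S \<Longrightarrow> hol V (y i)"
    and V: "open V" "z \<in> V" and X: "\<And>z. z \<in> V \<Longrightarrow> X z = (\<Sum>i\<in>S. y i z *s E i z)"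
  shows "fd X z w = (\<Sum>i\<in>S. fd (y i) z w *s E i z + y i z *s fd (E i) z w)"
proof -
  have "((\<lambda>z. \<Sum>i\<in>S. y i z *s E i z) has_derivative (\<lambda>w. \<Sum>i\<in>S. fd (y i) z w *s E i z + y i z *s fd (E i) z w)) (at z)"
    by (intro has_derivative_sum has_derivative_scale_vf[OF y E] V)
  from fd_eqI[OF has_derivative_transform_within_open[OF this V X[symmetric]]]
  show ?thesis .
qed

text \<open>
  The Leibniz rule. Modulo the span of the frame fields the bracket is bilinear over the functions, and
  this is the source of the tensoriality of the Levi form and of the operators \<open>ad\<close>.
\<close>

lemma hol_bracket_lincomb:
  assumes E: "\<And>i. i \<in> S \<Longrightarrow> holomorphic_vf V (E i)" and y: "\<And>i. i \<in> S \<Longrightarrow> hol V (y i)"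
    and F: "\<And>j. j \<in> T \<Longrightarrow> holomorphic_vf V (F j)" and g: "\<And>j. j \<in> T \<Longrightarrow> hol V (g j)"
    and V: "open V" "z \<in> V"
    and X: "\<And>z. z \<in> V \<Longrightarrow> X z = (\<Sum>i\<in>S. y i z *s E i z)"
    and Y: "\<And>z. z \<in> V \<Longrightarrow> Y z = (\<Sum>j\<in>T. g j z *s F j z)"
  shows "hol_bracket X Y z = (\<Sum>i\<in>S. \<Sum>j\<in>T. (y i z * g j z) *s hol_bracket (E i) (F j) z)
     + (\<Sum>j\<in>T. fd (g j) z (X z) *s F j z) - (\<Sum>i\<in>S. fd (y i) z (Y z) *s E i z)"
proof -
  have 1: "fd Y z (X z) = (\<Sum>j\<in>T. fd (g j) z (X z) *s F j z) + (\<Sum>i\<in>S. \<Sum>j\<in>T. (y i z * g j z) *s fd (F j) z (E i z))"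
  proof -
    have "fd Y z (X z) = (\<Sum>j\<in>T. fd (g j) z (X z) *s F j z) + (\<Sum>j\<in>T. g j z *s fd (F j) z (\<Sum>i\<in>S. y i z *s E i z))"
      using fd_lincomb[OF F g V Y] X[OF V(2)] by (simp add: sum.distrib)
    also have "(\<Sum>j\<in>T. g j z *s fd (F j) z (\<Sum>i\<in>S. y i z *s E i z)) = (\<Sum>j\<in>T. \<Sum>i\<in>S. (y i z * g j z) *s fd (F j) z (E i z))"
      by (intro sum.cong refl)
        (simp add: fd_vf_linear(4)[OF F V(2)] vec.scale_sum_right mult.commute)
    finally show ?thesis by (subst sum.swap)
  qed
  have 2: "fd X z (Y z) = (\<Sum>i\<in>S. fd (y i) z (Y z) *s E i z) + (\<Sum>i\<in>S. \<Sum>j\<in>T. (y i z * g j z) *s fd (E i) z (F j z))"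
  proof -
    have "fd X z (Y z) = (\<Sum>i\<in>S. fd (y i) z (Y z) *s E i z) + (\<Sum>i\<in>S. y i z *s fd (E i) z (\<Sum>j\<in>T. g j z *s F j z))"
      using fd_lincomb[OF E y V X] Y[OF V(2)] by (simp add: sum.distrib)
    also have "(\<Sum>i\<in>S. y i z *s fd (E i) z (\<Sum>j\<in>T. g j z *s F j z)) = (\<Sum>i\<in>S. \<Sum>j\<in>T. (y i z * g j z) *s fd (E i) z (F j z))"
      by (intro sum.cong refl)
        (simp add: fd_vf_linear(4)[OF E V(2)] vec.scale_sum_right)
    finally show ?thesis .
  qed
  show ?thesis
    unfolding hol_bracket_def 1 2
    by (simp add: vec.scale_right_diff_distrib sum_subtractf)
qed

text \<open>
  Linearity of the derivative in its direction reduces a variable direction to the coordinate directions.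
\<close>

lemma hol_directional:
  assumes f: "hol V f" and Y: "holomorphic_vf V Y" and V: "open V"
  shows "hol V (\<lambda>z. fd f z (Y z))"
    and "z \<in> V \<Longrightarrow> fd (\<lambda>z. fd f z (Y z)) z w = fd (\<lambda>z'. fd f z' (Y z)) z w + fd f z (fd Y z w)"
proof -
  have Yi: "hol V (\<lambda>z. Y z $ i)" for i using Y by (simp add: holomorphic_vf_iff)
  have exp: "fd f z v = (\<Sum>i\<in>UNIV. v $ i * fd f z (axis i 1))" if "z \<in> V" for z v
  proof -
    have "fd f z v = fd f z (\<Sum>i\<in>UNIV. v $ i *s axis i 1)" by (simp add: basis_expansion)
    then show ?thesis using fd_linear(3)[OF f that] by simp
  qed
  have h: "hol V (\<lambda>z. \<Sum>i\<in>UNIV. Y z $ i * fd f z (axis i 1))"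
    by (intro hol_sum hol_mult Yi hol_fd[OF f V])
  show "hol V (\<lambda>z. fd f z (Y z))"
    by (rule hol_cong[OF h V]) (simp add: exp[symmetric])
  have step: "((\<lambda>z. fd f z (Y z)) has_derivative
     (\<lambda>w. \<Sum>i\<in>UNIV. Y z $ i * fd (\<lambda>z. fd f z (axis i 1)) z w + fd Y z w $ i * fd f z (axis i 1))) (at z)"
    if z: "z \<in> V" for z
  proof -
    have "((\<lambda>z. \<Sum>i\<in>UNIV. Y z $ i * fd f z (axis i 1)) has_derivative
     (\<lambda>w. \<Sum>i\<in>UNIV. Y z $ i * fd (\<lambda>z. fd f z (axis i 1)) z w + fd Y z w $ i * fd f z (axis i 1))) (at z)"
      unfolding fd_component[OF Y z]
      by (intro has_derivative_sum has_derivative_mult holD(1)[OF Yi z] holD(1)[OF hol_fd[OF f V] z])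
    from has_derivative_transform_within_open[OF this V z, of "\<lambda>z. fd f z (Y z)"]
    show ?thesis using exp[symmetric] by blast
  qed
  have step2: "(\<Sum>i\<in>UNIV. v $ i * fd (\<lambda>z. fd f z (axis i 1)) z w) = fd (\<lambda>z'. fd f z' v) z w"
    if z: "z \<in> V" for z v w
  proof -
    have "((\<lambda>z. \<Sum>i\<in>UNIV. v $ i * fd f z (axis i 1)) has_derivative
     (\<lambda>w. \<Sum>i\<in>UNIV. v $ i * fd (\<lambda>z. fd f z (axis i 1)) z w)) (at z)"
      by (intro has_derivative_sum has_derivative_mult_right holD(1)[OF hol_fd[OF f V] z])
    from fd_eqI[OF has_derivative_transform_within_open[OF this V z, of "\<lambda>z. fd f z v"]]
    show ?thesis using exp[symmetric] by simp
  qed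
  assume z: "z \<in> V"
  have "fd (\<lambda>z. fd f z (Y z)) z w =
     (\<Sum>i\<in>UNIV. Y z $ i * fd (\<lambda>z. fd f z (axis i 1)) z w + fd Y z w $ i * fd f z (axis i 1))"
    by (rule fd_eqI[OF step[OF z]])
  also have "\<dots> = fd (\<lambda>z'. fd f z' (Y z)) z w + fd f z (fd Y z w)"
    unfolding sum.distrib step2[OF z] exp[OF z, symmetric] ..
  finally show "fd (\<lambda>z. fd f z (Y z)) z w = fd (\<lambda>z'. fd f z' (Y z)) z w + fd f z (fd Y z w)" .
qed

lemma hol_bracket_cong:
  assumes "open V" "z \<in> V" "\<And>y. y \<in> V \<Longrightarrow> X y = X' y" "\<And>y. y \<in> V \<Longrightarrow> Y y = Y' y"
    and "holomorphic_vf V X" "holomorphic_vf V Y"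
  shows "hol_bracket X Y z = hol_bracket X' Y' z"
proof -
  have "fd X z w = fd X' z w" "fd Y z w = fd Y' z w" for w
    using fd_eqI[OF has_derivative_transform_within_open[OF holomorphic_vfD(1)[OF assms(5,2)] assms(1,2,3)], of w]
      fd_eqI[OF has_derivative_transform_within_open[OF holomorphic_vfD(1)[OF assms(6,2)] assms(1,2,4)], of w]
    by simp_all
  then show ?thesis using assms(2-4) by (simp add: hol_bracket_def)
qed

lemma hol_bracket_add:
  assumes X: "holomorphic_vf V X" and Y: "holomorphic_vf V Y" and X': "holomorphic_vf V X'" and Y': "holomorphic_vf V Y'" and z: "z \<in> V"
  shows "hol_bracket (\<lambda>z. X z + X' z) (\<lambda>z. Y z + Y' z) z
    = hol_bracket X Y z + hol_bracket X Y' z + hol_bracket X' Y z + hol_bracket X' Y' z"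
proof -
  have 1: "fd (\<lambda>z. X z + X' z) z w = fd X z w + fd X' z w" for w
    by (rule fd_eqI[OF has_derivative_add[OF holomorphic_vfD(1)[OF X z] holomorphic_vfD(1)[OF X' z]]])
  have 2: "fd (\<lambda>z. Y z + Y' z) z w = fd Y z w + fd Y' z w" for w
    by (rule fd_eqI[OF has_derivative_add[OF holomorphic_vfD(1)[OF Y z] holomorphic_vfD(1)[OF Y' z]]])
  show ?thesis
    unfolding hol_bracket_def 1 2 fd_vf_linear(1)[OF X z] fd_vf_linear(1)[OF X' z] fd_vf_linear(1)[OF Y z] fd_vf_linear(1)[OF Y' z]
    by (simp add: algebra_simps)
qed

lemma hol_bracket_component:
  assumes X: "holomorphic_vf V X" and Y: "holomorphic_vf V Y" and z: "z \<in> V"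
  shows "hol_bracket X Y z $ i = fd (\<lambda>z. Y z $ i) z (X z) - fd (\<lambda>z. X z $ i) z (Y z)"
  by (simp add: hol_bracket_def fd_component[OF X z] fd_component[OF Y z])

lemma holomorphic_vf_bracket:
  assumes X: "holomorphic_vf V X" and Y: "holomorphic_vf V Y" and V: "open V"
  shows "holomorphic_vf V (hol_bracket X Y)"
  unfolding holomorphic_vf_iff
proof
  fix i
  have "hol V (\<lambda>z. fd (\<lambda>z. Y z $ i) z (X z) - fd (\<lambda>z. X z $ i) z (Y z))"
    using X Y V by (intro hol_diff hol_directional) (auto simp: holomorphic_vf_iff)
  then show "hol V (\<lambda>z. hol_bracket X Y z $ i)"
    by (rule hol_cong) (auto simp: hol_bracket_component[OF X Y] V)
qed

text \<open>
  The second derivatives cancel by \<open>fd_symmetric\<close>.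
\<close>

lemma jacobi:
  assumes X: "holomorphic_vf V X" and Y: "holomorphic_vf V Y" and Z: "holomorphic_vf V Z"
    and V: "open V" "z \<in> V"
  shows "hol_bracket X (hol_bracket Y Z) z + hol_bracket Y (hol_bracket Z X) z
     + hol_bracket Z (hol_bracket X Y) z = 0"
proof -
  have comp: "hol_bracket X (hol_bracket Y Z) z $ i =
      fd (\<lambda>z'. fd (\<lambda>z. Z z $ i) z' (Y z)) z (X z) + fd (\<lambda>z. Z z $ i) z (fd Y z (X z))
    - (fd (\<lambda>z'. fd (\<lambda>z. Y z $ i) z' (Z z)) z (X z) + fd (\<lambda>z. Y z $ i) z (fd Z z (X z)))
    - (fd (\<lambda>z. X z $ i) z (fd Z z (Y z)) - fd (\<lambda>z. X z $ i) z (fd Y z (Z z)))"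
    if X: "holomorphic_vf V X" and Y: "holomorphic_vf V Y" and Z: "holomorphic_vf V Z" for X Y Z i
  proof -
    have Xi: "hol V (\<lambda>z. X z $ i)" and Yi: "hol V (\<lambda>z. Y z $ i)" and Zi: "hol V (\<lambda>z. Z z $ i)"
      using X Y Z by (simp_all add: holomorphic_vf_iff)
    note dZ = hol_directional[OF Zi Y V(1)] and dY = hol_directional[OF Yi Z V(1)]
    have "((\<lambda>z. fd (\<lambda>z. Z z $ i) z (Y z) - fd (\<lambda>z. Y z $ i) z (Z z)) has_derivative
        (\<lambda>w. fd (\<lambda>z. fd (\<lambda>z. Z z $ i) z (Y z)) z w - fd (\<lambda>z. fd (\<lambda>z. Y z $ i) z (Z z)) z w)) (at z)"
      by (intro has_derivative_diff holD(1)[OF dZ(1) V(2)] holD(1)[OF dY(1) V(2)])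
    from fd_eqI[OF has_derivative_transform_within_open[OF this V, of "\<lambda>z. hol_bracket Y Z z $ i"]]
    have "fd (\<lambda>z. hol_bracket Y Z z $ i) z w =
        fd (\<lambda>z. fd (\<lambda>z. Z z $ i) z (Y z)) z w - fd (\<lambda>z. fd (\<lambda>z. Y z $ i) z (Z z)) z w" for w
      using hol_bracket_component[OF Y Z] by simp
    then show ?thesis
      unfolding hol_bracket_component[OF X holomorphic_vf_bracket[OF Y Z V(1)] V(2)]
      by (simp add: dZ(2)[OF V(2)] dY(2)[OF V(2)] hol_bracket_def fd_linear(2)[OF Xi V(2)])
  qed
  have sym: "fd (\<lambda>z'. fd (\<lambda>z. A z $ i) z' v) z w = fd (\<lambda>z'. fd (\<lambda>z. A z $ i) z' w) z v"
    if "holomorphic_vf V A" for A i v w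
    by (rule fd_symmetric[OF _ V]) (use that in \<open>simp add: holomorphic_vf_iff\<close>)
  show ?thesis
    unfolding vec_eq_iff vector_add_component comp[OF X Y Z] comp[OF Y Z X] comp[OF Z X Y]
    using sym[OF X, of _ "Y z" "Z z"] sym[OF Y, of _ "Z z" "X z"] sym[OF Z, of _ "Y z" "X z"]
    by simp
qed

lemma hol_bracket_antisym: "hol_bracket X Y z = - hol_bracket Y X z"
  by (simp add: hol_bracket_def)

section \<open>Conjugation and restriction to real points\<close>

definition conj_vf :: "(complex^'m \<Rightarrow> complex^'m) \<Rightarrow> complex^'m \<Rightarrow> complex^'m" where
  "conj_vf X z = cnjv (X (cnjv z))"

lemma cnjv_cnjv [simp]: "cnjv (cnjv z) = z" by (simp add: cnjv_def vec_eq_iff)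
lemma cnjv_simps: "cnjv (v + w) = cnjv v + cnjv w" "cnjv (v - w) = cnjv v - cnjv w" "cnjv 0 = 0"
  "cnjv (c *s v) = cnj c *s cnjv v" "cnjv (- v) = - cnjv v"
  by (simp_all add: cnjv_def vec_eq_iff)
lemma cnjv_sum: "cnjv (\<Sum>i\<in>S. f i) = (\<Sum>i\<in>S. cnjv (f i))"
  by (induction S rule: infinite_finite_induct) (simp_all add: cnjv_simps)
lemma cnjv_cvec [simp]: "cnjv (cvec x) = cvec x" by (simp add: cnjv_def cvec_def)

lemma cnjv_ball [simp]: "cnjv z \<in> ball (cvec p) r \<longleftrightarrow> z \<in> ball (cvec p) r"
proof -
  have "norm (cvec p - cnjv z) = norm (cvec p - z)"
    using norm_cnjv[of "cvec p - z"] by (simp only: cnjv_simps cnjv_cvec)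
  then show ?thesis by (simp add: dist_norm)
qed

lemma conj_vf_has_derivative:
  assumes X: "holomorphic_vf U X" and z: "cnjv z \<in> U"
  shows "(conj_vf X has_derivative (\<lambda>w. cnjv (fd X (cnjv z) (cnjv w)))) (at z)"
proof -
  have "((\<lambda>z. X (cnjv z)) has_derivative (\<lambda>w. fd X (cnjv z) (cnjv w))) (at z)"
    by (rule has_derivative_compose[OF bounded_linear_imp_has_derivative[OF bounded_linear_cnjv] holomorphic_vfD(1)[OF X z]])
  then show ?thesis
    unfolding conj_vf_def[abs_def] by (rule bounded_linear.has_derivative[OF bounded_linear_cnjv])
qed

lemma fd_conj_vf:
  assumes X: "holomorphic_vf U X" and z: "cnjv z \<in> U"
  shows "fd (conj_vf X) z w = cnjv (fd X (cnjv z) (cnjv w))"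
  by (rule fd_eqI[OF conj_vf_has_derivative[OF assms]])

lemma holomorphic_conj_vf:
  assumes X: "holomorphic_vf U X" and V: "\<And>z. z \<in> V \<Longrightarrow> cnjv z \<in> U"
  shows "holomorphic_vf V (conj_vf X)"
  unfolding holomorphic_vf_def
  by (intro ballI exI conjI allI, rule conj_vf_has_derivative[OF X V])
    (use V holomorphic_vfD(2)[OF X] in \<open>auto simp: cnjv_simps\<close>)

lemma hol_bracket_conj:
  assumes X: "holomorphic_vf U X" and Y: "holomorphic_vf U Y" and z: "cnjv z \<in> U"
  shows "hol_bracket (conj_vf X) (conj_vf Y) z = cnjv (hol_bracket X Y (cnjv z))"
  by (simp add: hol_bracket_def fd_conj_vf[OF X z] fd_conj_vf[OF Y z] conj_vf_def cnjv_simps)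

lemma cderiv_eq_fd:
  assumes F: "holomorphic_vf (ball (cvec p) \<delta>) F" and \<delta>: "\<delta> > 0"
    and eq: "\<And>x. x \<in> ball p \<delta> \<Longrightarrow> X x = F (cvec x)"
  shows "cderiv X p v = fd F (cvec p) v"
proof -
  have pb: "cvec p \<in> ball (cvec p) \<delta>" using \<delta> by simp
  have bl: "bounded_linear (cvec :: real^'a \<Rightarrow> complex^'a)"
    by (rule bounded_linear_intro[where K=1]) (simp_all add: cvec_add cvec_scaleR)
  have "((\<lambda>x. F (cvec x)) has_derivative (\<lambda>w. fd F (cvec p) (cvec w))) (at p)"
    by (rule has_derivative_compose[OF bounded_linear_imp_has_derivative[OF bl] holomorphic_vfD(1)[OF F pb]])
  then have "(X has_derivative (\<lambda>w. fd F (cvec p) (cvec w))) (at p)"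
    by (rule has_derivative_transform_within_open[of _ _ _ _ "ball p \<delta>"]) (use \<delta> eq in auto)
  then have d: "fd X p w = fd F (cvec p) (cvec w)" for w by (rule fd_eqI)
  have "v = cvec (\<chi> i. Re (v $ i)) + \<i> *s cvec (\<chi> i. Im (v $ i))"
    by (simp add: vec_eq_iff cvec_def complex_eq_iff)
  then have "fd F (cvec p) v = fd F (cvec p) (cvec (\<chi> i. Re (v $ i))) + \<i> *s fd F (cvec p) (cvec (\<chi> i. Im (v $ i)))"
    using fd_vf_linear(1)[OF F pb] holomorphic_vfD(2)[OF F pb] by metis
  then show ?thesis unfolding cderiv_def d by simp
qed

text \<open>
  All differential geometry can be done with holomorphic fields: the real bracket, extended complex
  linearly, is the restriction of the holomorphic one.
\<close>

lemma bracket_eq_hol_bracket: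
  assumes F: "holomorphic_vf (ball (cvec p) \<delta>) F" and \<delta>: "\<delta> > 0"
    and X: "\<And>x. x \<in> ball p \<delta> \<Longrightarrow> X x = F (cvec x)"
    and G: "holomorphic_vf (ball (cvec p) \<delta>) G"
    and Y: "\<And>x. x \<in> ball p \<delta> \<Longrightarrow> Y x = G (cvec x)"
  shows "bracket X Y p = hol_bracket F G (cvec p)"
proof -
  have "cderiv X p v = fd F (cvec p) v" "cderiv Y p v = fd G (cvec p) v" for v
    using cderiv_eq_fd[OF F \<delta>, of X] cderiv_eq_fd[OF G \<delta>, of Y] X Y by blast+
  then show ?thesis
    using X[of p] Y[of p] \<delta> by (simp add: bracket_def hol_bracket_def)
qed

section \<open>Families of vectors\<close>

lemma independent_family:
  fixes f :: "nat \<Rightarrow> complex^'m"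
  assumes I: "finite I" and ind: "\<And>c. (\<Sum>i\<in>I. c i *s f i) = 0 \<Longrightarrow> \<forall>i\<in>I. c i = 0"
  shows "inj_on f I" "vec.independent (f ` I)"
proof -
  show inj: "inj_on f I"
  proof (rule inj_onI, rule ccontr)
    fix i j assume ij: "i \<in> I" "j \<in> I" "f i = f j" "i \<noteq> j"
    let ?c = "\<lambda>l. if l = i then 1 else if l = j then - 1 else (0::complex)"
    have "(\<Sum>l\<in>I. ?c l *s f l) = (\<Sum>l\<in>{i,j}. ?c l *s f l)"
      by (rule sum.mono_neutral_right) (use I ij in auto)
    also have "\<dots> = 0" using ij by (simp add: vec_eq_iff)
    finally have "?c i = 0" using ind[of ?c] ij by blast
    then show False by simp
  qed
  show "vec.independent (f ` I)"
  proof (rule vec.independent_if_scalars_zero)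
    show "finite (f ` I)" using I by simp
    fix g v assume g: "(\<Sum>v\<in>f ` I. g v *s v) = 0" and v: "v \<in> f ` I"
    then have "(\<Sum>i\<in>I. g (f i) *s f i) = 0" by (simp add: sum.reindex[OF inj])
    from ind[OF this] v show "g v = 0" by auto
  qed
qed

lemma frame_independent:
  fixes f :: "nat \<Rightarrow> complex^'m"
  assumes dim: "vec.dim (vec.span (f ` {..<n})) = n" and c: "(\<Sum>i<n. c i *s f i) = 0" and i: "i < n"
  shows "c i = 0"
proof -
  have fin: "finite (f ` {..<n})" by simp
  have "vec.dim (f ` {..<n}) = n" using dim by (simp add: vec.dim_span)
  moreover have "vec.dim (f ` {..<n}) \<le> card (f ` {..<n})" by (rule vec.dim_le_card'[OF fin])
  moreover have "card (f ` {..<n}) \<le> n" using card_image_le[of "{..<n}" f] by simp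
  ultimately have card: "card (f ` {..<n}) = n" and dimc: "vec.dim (f ` {..<n}) = card (f ` {..<n})" by auto
  have inj: "inj_on f {..<n}" by (rule eq_card_imp_inj_on) (use card in auto)
  have ind: "vec.independent (f ` {..<n})"
    by (rule vec.card_le_dim_spanning[OF order_refl vec.span_superset fin]) (use dimc in simp)
  have "(\<Sum>v\<in>f ` {..<n}. c (the_inv_into {..<n} f v) *s v) = 0"
    using c by (simp add: sum.reindex[OF inj] the_inv_into_f_f[OF inj])
  then have "c (the_inv_into {..<n} f (f i)) = 0"
    using vec.independentD[OF ind fin order_refl, of "\<lambda>v. c (the_inv_into {..<n} f v)" "f i"] i by auto
  then show ?thesis using the_inv_into_f_f[OF inj] i by simp
qed

lemma exists_transversal:
  fixes f :: "nat \<Rightarrow> complex^'m"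
  assumes "k < CARD('m)" obtains e where "e \<notin> vec.span (f ` {..<k})"
proof -
  have "vec.dim (vec.span (f ` {..<k})) \<le> k"
    using vec.dim_le_card'[of "f ` {..<k}"] card_image_le[of "{..<k}" f] by (simp add: vec.dim_span)
  then have "vec.span (f ` {..<k}) \<noteq> UNIV"
    using assms vec.dim_UNIV[where 'a=complex and 'b='m] by (metis vec.dimension_def card_cart_basis not_le vec_dim_card)
  then show ?thesis using that by blast
qed

lemma dim_one_range:
  fixes V :: "(complex^'m) set"
  assumes "vec.subspace V" "vec.dim V = 1"
  obtains k where "k \<noteq> 0" "V = range (\<lambda>c. c *s k)"
proof -
  obtain S where S: "S \<subseteq> V" "vec.independent S" "V \<subseteq> vec.span S" "card S = 1"
    using vec.basis_exists[of V] assms(2) by metis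
  then obtain k where k: "S = {k}" using card_1_singletonE by blast
  have "k \<noteq> 0" using S(2) k vec.dependent_zero by blast
  moreover have "V = vec.span {k}" using S k vec.span_minimal[OF _ assms(1)] by blast
  ultimately show ?thesis using that vec.span_singleton by blast
qed

lemma subspace_plus:
  assumes "vec.subspace (X :: (complex^'m) set)" "vec.subspace Y" shows "vec.subspace (X + Y)"
proof (rule vec.subspaceI)
  show "0 \<in> X + Y"
    using set_plus_intro[OF vec.subspace_0[OF assms(1)] vec.subspace_0[OF assms(2)]] by simp
  fix u v assume "u \<in> X + Y" "v \<in> X + Y"
  then obtain a b a' b' where *: "u = a + b" "v = a' + b'" "a \<in> X" "b \<in> Y" "a' \<in> X" "b' \<in> Y"
    by (elim set_plus_elim) blast
  have "u + v = (a + a') + (b + b')" by (simp add: *)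
  then show "u + v \<in> X + Y"
    using set_plus_intro[OF vec.subspace_add[OF assms(1) *(3,5)] vec.subspace_add[OF assms(2) *(4,6)]] by simp
next
  fix c u assume "u \<in> X + Y"
  then obtain a b where *: "u = a + b" "a \<in> X" "b \<in> Y" by (elim set_plus_elim) blast
  show "c *s u \<in> X + Y"
    using set_plus_intro[OF vec.subspace_scale[OF assms(1) *(2)] vec.subspace_scale[OF assms(2) *(3)], of c c]
    by (simp add: *(1) vec.scale_right_distrib)
qed

lemma subspace_line: "vec.subspace (range (\<lambda>c. c *s (k :: complex^'m)))"
  using vec.subspace_span[of "{k}"] by (simp add: vec.span_singleton)

section \<open>Adapted frames\<close>

text \<open>
  A holomorphic frame of the complexified tangent space on a ball around \<open>p\<close>: \<open>E i\<close> with \<open>i < n\<close> spans \<open>H\<close> at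
  real points, \<open>E (n + i)\<close> is its conjugate, and \<open>E (2 * n)\<close> is transversal to \<open>H + conj H\<close>. The functions
  \<open>\<kappa> i z\<close> are the coordinates with respect to this frame.
\<close>

locale cr_chart =
  fixes n :: nat and M :: "(real^'m) set" and H :: "real^'m \<Rightarrow> (complex^'m) set"
    and p :: "real^'m" and r :: real
    and E :: "nat \<Rightarrow> complex^'m \<Rightarrow> complex^'m"
    and \<kappa> :: "nat \<Rightarrow> complex^'m \<Rightarrow> complex^'m \<Rightarrow> complex"
  assumes cr: "cr_structure n M H"
    and r: "r > 0" and ball_sub: "ball p r \<subseteq> M"
    and E_hol: "i < 2 * n + 1 \<Longrightarrow> holomorphic_vf (ball (cvec p) r) (E i)"
    and E_conj: "i < n \<Longrightarrow> z \<in> ball (cvec p) r \<Longrightarrow> E (n + i) z = conj_vf (E i) z"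
    and E_analytic: "i < n \<Longrightarrow> real_analytic_on (ball p r) (\<lambda>x. E i (cvec x))"
    and H_span: "x \<in> ball p r \<Longrightarrow> H x = vec.span ((\<lambda>i. E i (cvec x)) ` {..<n})"
    and \<kappa>_sum: "z \<in> ball (cvec p) r \<Longrightarrow> (\<Sum>i<2*n+1. \<kappa> i z v *s E i z) = v"
    and \<kappa>_E: "z \<in> ball (cvec p) r \<Longrightarrow> i < 2*n+1 \<Longrightarrow> j < 2*n+1 \<Longrightarrow>
       \<kappa> i z (E j z) = (if i = j then 1 else 0)"
    and \<kappa>_add: "\<kappa> i z (v + w) = \<kappa> i z v + \<kappa> i z w"
    and \<kappa>_scale: "\<kappa> i z (c *s v) = c * \<kappa> i z v"
    and \<kappa>_hol: "holomorphic_vf W Y \<Longrightarrow> open W \<Longrightarrow> W \<subseteq> ball (cvec p) r \<Longrightarrow> hol W (\<lambda>z. \<kappa> i z (Y z))"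
begin

abbreviation "B \<equiv> ball (cvec p) r"

lemma \<kappa>_zero [simp]: "\<kappa> i z 0 = 0" using \<kappa>_scale[of i z 0 0] by simp
lemma \<kappa>_minus: "\<kappa> i z (- v) = - \<kappa> i z v"
  using \<kappa>_scale[of i z "-1" v] by (simp add: vector_sneg_minus1[symmetric])
lemma \<kappa>_diff: "\<kappa> i z (v - w) = \<kappa> i z v - \<kappa> i z w"
  using \<kappa>_add[of i z v "- w"] by (simp add: \<kappa>_minus)
lemma \<kappa>_lsum: "\<kappa> i z (\<Sum>j\<in>S. f j) = (\<Sum>j\<in>S. \<kappa> i z (f j))"
  by (induction S rule: infinite_finite_induct) (simp_all add: \<kappa>_add)
lemmas \<kappa>_simps = \<kappa>_add \<kappa>_diff \<kappa>_scale \<kappa>_minus \<kappa>_lsum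

text \<open>
  The span of the \<open>E i\<close> with \<open>i \<in> I\<close> (see \<open>span_eq_Esp\<close>), described by equations, so that membership is an
  identity between holomorphic functions. At real points \<open>Esp {..<n}\<close>, \<open>Esp {n..<2*n}\<close> and
  \<open>Esp {..<2*n}\<close> are \<open>H\<close>, its conjugate and their sum.
\<close>

definition Esp :: "nat set \<Rightarrow> complex^'m \<Rightarrow> (complex^'m) set" where
  "Esp I z = {v. \<forall>i<2*n+1. i \<notin> I \<longrightarrow> \<kappa> i z v = 0}"

lemma Esp_iff: "v \<in> Esp I z \<longleftrightarrow> (\<forall>i<2*n+1. i \<notin> I \<longrightarrow> \<kappa> i z v = 0)"
  by (simp add: Esp_def)

lemma Esp_subspace: "vec.subspace (Esp I z)"
  by (rule vec.subspaceI) (auto simp: Esp_iff \<kappa>_simps)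

lemma Esp_mono: "I \<subseteq> J \<Longrightarrow> Esp I z \<subseteq> Esp J z" unfolding Esp_def by blast

lemma Esp_simps:
  "0 \<in> Esp I z" "v \<in> Esp I z \<Longrightarrow> w \<in> Esp I z \<Longrightarrow> v + w \<in> Esp I z"
  "v \<in> Esp I z \<Longrightarrow> w \<in> Esp I z \<Longrightarrow> v - w \<in> Esp I z" "v \<in> Esp I z \<Longrightarrow> c *s v \<in> Esp I z"
  "(\<And>j. j \<in> S \<Longrightarrow> f j \<in> Esp I z) \<Longrightarrow> (\<Sum>j\<in>S. f j) \<in> Esp I z"
  by (auto simp: Esp_iff \<kappa>_simps)

lemma E_in_Esp: "z \<in> B \<Longrightarrow> i \<in> I \<Longrightarrow> i < 2*n+1 \<Longrightarrow> E i z \<in> Esp I z"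
  by (auto simp: Esp_iff \<kappa>_E)

lemma Esp_expand:
  assumes z: "z \<in> B" and I: "I \<subseteq> {..<2*n+1}" and v: "v \<in> Esp I z"
  shows "v = (\<Sum>i\<in>I. \<kappa> i z v *s E i z)"
proof -
  have "(\<Sum>i\<in>I. \<kappa> i z v *s E i z) = (\<Sum>i<2*n+1. \<kappa> i z v *s E i z)"
    by (rule sum.mono_neutral_left) (use I v in \<open>auto simp: Esp_iff\<close>)
  then show ?thesis using \<kappa>_sum[OF z] by simp
qed

lemma Esp_lincomb:
  assumes "z \<in> B" "I \<subseteq> {..<2*n+1}" "I \<subseteq> J"
  shows "(\<Sum>i\<in>I. c i *s E i z) \<in> Esp J z"
  using assms by (intro Esp_simps E_in_Esp) auto

lemma \<kappa>_lincomb: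
  assumes "z \<in> B" "I \<subseteq> {..<2*n+1}" "j < 2*n+1"
  shows "\<kappa> j z (\<Sum>i\<in>I. c i *s E i z) = (if j \<in> I then c j else 0)"
proof -
  have fin: "finite I" using assms(2) finite_subset by blast
  have "\<kappa> j z (\<Sum>i\<in>I. c i *s E i z) = (\<Sum>i\<in>I. if i = j then c i else 0)"
    unfolding \<kappa>_simps using assms by (intro sum.cong refl) (auto simp: \<kappa>_E)
  then show ?thesis using fin by simp
qed

lemma span_eq_Esp:
  assumes z: "z \<in> B" and I: "I \<subseteq> {..<2*n+1}"
  shows "vec.span ((\<lambda>i. E i z) ` I) = Esp I z"
proof
  show "vec.span ((\<lambda>i. E i z) ` I) \<subseteq> Esp I z"
    by (rule vec.span_minimal[OF _ Esp_subspace]) (use E_in_Esp z I in auto)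
  show "Esp I z \<subseteq> vec.span ((\<lambda>i. E i z) ` I)"
  proof
    fix v assume "v \<in> Esp I z"
    then have "v = (\<Sum>i\<in>I. \<kappa> i z v *s E i z)" by (rule Esp_expand[OF z I])
    also have "\<dots> \<in> vec.span ((\<lambda>i. E i z) ` I)"
      by (intro vec.span_sum vec.span_scale vec.span_base) auto
    finally show "v \<in> vec.span ((\<lambda>i. E i z) ` I)" .
  qed
qed

lemma cvec_B [simp]: "cvec x \<in> B \<longleftrightarrow> x \<in> ball p r" by (rule cvec_in_ball)

lemma H_eq: "x \<in> ball p r \<Longrightarrow> H x = Esp {..<n} (cvec x)"
  unfolding H_span by (rule span_eq_Esp) auto

lemma E_conj_shift: 
  assumes "z \<in> B" "n \<le> j" "j < 2 * n" shows "E j z = conj_vf (E (j - n)) z"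
  using E_conj[of "j - n" z] assms by auto

lemma E_conj_back:
  assumes "z \<in> B" "i < n" shows "conj_vf (E (n + i)) z = E i z"
proof -
  have "cnjv z \<in> B" using assms(1) cnjv_ball by blast
  from E_conj[OF assms(2) this] show ?thesis by (simp add: conj_vf_def)
qed

text \<open>
  The index of the conjugate of \<open>E i\<close>; it exchanges the two halves of \<open>{..<2*n}\<close>.
\<close>

definition conj_idx :: "nat \<Rightarrow> nat" where "conj_idx i = (if i < n then n + i else i - n)"

lemma conj_idx_simps: "i < n \<Longrightarrow> conj_idx i = n + i" "n \<le> i \<Longrightarrow> conj_idx i = i - n" "i < 2 * n \<Longrightarrow> conj_idx (conj_idx i) = i"
  "i < 2 * n \<Longrightarrow> conj_idx i < 2 * n"
  by (auto simp: conj_idx_def)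

lemma E_conj_idx: "z \<in> B \<Longrightarrow> i < 2 * n \<Longrightarrow> E (conj_idx i) z = conj_vf (E i) z"
  using E_conj[of i z] E_conj_back[of z "i - n"] by (auto simp: conj_idx_def not_less)

lemma E_conj_idx_real: "x \<in> ball p r \<Longrightarrow> i < 2 * n \<Longrightarrow> cnjv (E i (cvec x)) = E (conj_idx i) (cvec x)"
  using E_conj_idx[of "cvec x" i] by (simp add: conj_vf_def)

lemma conj_idx_image_iff: "A \<subseteq> {..<2*n} \<Longrightarrow> x \<in> conj_idx ` A \<longleftrightarrow> x < 2 * n \<and> conj_idx x \<in> A"
  using conj_idx_simps(3,4) by (force simp: image_iff subset_iff)

lemma conj_idx_image: "conj_idx ` {..<n} = {n..<2*n}" "conj_idx ` {n..<2*n} = {..<n}" "conj_idx ` {..<2*n} = {..<2*n}"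
  by (subst set_eq_iff, subst conj_idx_image_iff, force, force simp: conj_idx_def)+

lemma cnjv_Esp:
  assumes x: "x \<in> ball p r" and I: "I \<subseteq> {..<2*n}" and v: "v \<in> Esp I (cvec x)"
  shows "cnjv v \<in> Esp (conj_idx ` I) (cvec x)"
    and "i < 2 * n \<Longrightarrow> \<kappa> i (cvec x) (cnjv v) = cnj (\<kappa> (conj_idx i) (cvec x) v)"
proof -
  have xB: "cvec x \<in> B" using x by simp
  have inj: "inj_on conj_idx I" using conj_idx_simps(3) I by (metis inj_on_inverseI lessThan_iff subsetD)
  have I': "conj_idx ` I \<subseteq> {..<2*n+1}" using I conj_idx_simps(4) by fastforce
  have sv: "v = (\<Sum>i\<in>I. \<kappa> i (cvec x) v *s E i (cvec x))"
    by (rule Esp_expand[OF xB _ v]) (use I in auto)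
  have "cnjv v = (\<Sum>i\<in>I. cnj (\<kappa> i (cvec x) v) *s E (conj_idx i) (cvec x))"
  proof -
    have "cnjv v = cnjv (\<Sum>i\<in>I. \<kappa> i (cvec x) v *s E i (cvec x))" using sv by simp
    also have "\<dots> = (\<Sum>i\<in>I. cnj (\<kappa> i (cvec x) v) *s E (conj_idx i) (cvec x))"
      unfolding cnjv_sum cnjv_simps using E_conj_idx_real[OF x] I by (intro sum.cong refl) auto
    finally show ?thesis .
  qed
  also have "\<dots> = (\<Sum>i\<in>conj_idx ` I. cnj (\<kappa> (conj_idx i) (cvec x) v) *s E i (cvec x))"
    unfolding sum.reindex[OF inj] using I conj_idx_simps(3) by (intro sum.cong refl) (auto simp: subset_iff)
  finally have c: "cnjv v = (\<Sum>i\<in>conj_idx ` I. cnj (\<kappa> (conj_idx i) (cvec x) v) *s E i (cvec x))" .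
  then show "cnjv v \<in> Esp (conj_idx ` I) (cvec x)" using Esp_lincomb[OF xB I'] by simp
  show "\<kappa> i (cvec x) (cnjv v) = cnj (\<kappa> (conj_idx i) (cvec x) v)" if i: "i < 2 * n"
  proof (cases "i \<in> conj_idx ` I")
    case True then show ?thesis using \<kappa>_lincomb[OF xB I', of i] c i by simp
  next
    case False
    then have "conj_idx i \<notin> I" using i conj_idx_simps(3) by (metis imageI)
    then have "\<kappa> (conj_idx i) (cvec x) v = 0" using v conj_idx_simps(4)[OF i] by (simp add: Esp_iff)
    then show ?thesis using False \<kappa>_lincomb[OF xB I', of i] c i by simp
  qed
qed

lemma conj_dist_eq:
  assumes D: "D x = Esp I (cvec x)" and x: "x \<in> ball p r" and I: "I \<subseteq> {..<2*n}"
  shows "conj_dist D x = Esp (conj_idx ` I) (cvec x)"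
proof
  show "conj_dist D x \<subseteq> Esp (conj_idx ` I) (cvec x)"
    unfolding conj_dist_def D using cnjv_Esp(1)[OF x I] by auto
  have I': "conj_idx ` I \<subseteq> {..<2*n}" using I conj_idx_simps(4) by fastforce
  have II: "conj_idx ` conj_idx ` I = I" using I conj_idx_simps(3) by (force simp: image_iff subset_iff)
  show "Esp (conj_idx ` I) (cvec x) \<subseteq> conj_dist D x"
  proof
    fix v assume "v \<in> Esp (conj_idx ` I) (cvec x)"
    then have "cnjv v \<in> D x" using cnjv_Esp(1)[OF x I'] II D by simp
    then have "cnjv (cnjv v) \<in> conj_dist D x" unfolding conj_dist_def by (rule imageI)
    then show "v \<in> conj_dist D x" by simp
  qed
qed

lemma conj_H_eq: "x \<in> ball p r \<Longrightarrow> conj_dist H x = Esp {n..<2*n} (cvec x)"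
  using conj_dist_eq[of H x "{..<n}"] H_eq conj_idx_image by auto

lemma Esp_plus:
  assumes z: "z \<in> B" and I: "I \<subseteq> {..<2*n+1}" "J \<subseteq> {..<2*n+1}"
  shows "Esp I z + Esp J z = Esp (I \<union> J) z"
proof
  show "Esp I z + Esp J z \<subseteq> Esp (I \<union> J) z"
    by (auto simp: set_plus_def Esp_iff \<kappa>_add)
  show "Esp (I \<union> J) z \<subseteq> Esp I z + Esp J z"
  proof
    fix v assume v: "v \<in> Esp (I \<union> J) z"
    have fin: "finite I" "finite J" using I by (auto intro: finite_subset)
    have "I \<union> J \<subseteq> {..<2*n+1}" "I \<union> J = I \<union> (J - I)" using I by auto
    then have "v = (\<Sum>i\<in>I \<union> (J - I). \<kappa> i z v *s E i z)"
      using Esp_expand[OF z _ v] by metis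
    also have "\<dots> = (\<Sum>i\<in>I. \<kappa> i z v *s E i z) + (\<Sum>i\<in>J - I. \<kappa> i z v *s E i z)"
      using fin by (intro sum.union_disjoint) auto
    also have "\<dots> \<in> Esp I z + Esp J z"
      by (intro set_plus_intro Esp_lincomb[OF z]) (use I in auto)
    finally show "v \<in> Esp I z + Esp J z" .
  qed
qed

lemma levi_dist_eq: "x \<in> ball p r \<Longrightarrow> levi_dist H x = Esp {..<2*n} (cvec x)"
proof -
  assume x: "x \<in> ball p r"
  have xB: "cvec x \<in> B" using x by simp
  have un: "{..<n} \<union> {n..<2*n} = {..<2*n}" by auto
  have "levi_dist H x = Esp {..<n} (cvec x) + Esp {n..<2*n} (cvec x)"
    unfolding levi_dist_def H_eq[OF x] conj_H_eq[OF x] ..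
  also have "\<dots> = Esp ({..<n} \<union> {n..<2*n}) (cvec x)" by (rule Esp_plus[OF xB]) auto
  finally show ?thesis unfolding un .
qed

lemma section_extension:
  assumes X: "X \<in> sections_at M D x0" and x0: "x0 \<in> ball p r"
  obtains \<delta> F where "\<delta> > 0" "ball (cvec x0) \<delta> \<subseteq> B" "holomorphic_vf (ball (cvec x0) \<delta>) F"
    "\<And>x. x \<in> ball x0 \<delta> \<Longrightarrow> X x = F (cvec x) \<and> F (cvec x) \<in> D x \<and> x \<in> ball p r"
proof -
  obtain U where U: "open U" "x0 \<in> U" "real_analytic_on U X" "\<forall>x\<in>U. X x \<in> D x"
    using X unfolding sections_at_def by blast
  obtain d where d: "d > 0" "ball x0 d \<subseteq> U" using U openE by blast
  obtain \<delta> F where F: "\<delta> > 0" "holomorphic_vf (ball (cvec x0) \<delta>) F" "\<And>x. x \<in> ball x0 \<delta> \<Longrightarrow> F (cvec x) = X x"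
    using analytic_extension[OF U(3,2)] by blast
  obtain e where e: "e > 0" "ball (cvec x0) e \<subseteq> B" using x0 openE[OF open_ball, of "cvec x0" "cvec p" r] cvec_B by blast
  define \<rho> where "\<rho> = min d (min \<delta> e)"
  show ?thesis
  proof (rule that[of \<rho> F])
    show "\<rho> > 0" using d F e by (simp add: \<rho>_def)
    show eB: "ball (cvec x0) \<rho> \<subseteq> B" using e(2) by (auto simp: \<rho>_def)
    show "holomorphic_vf (ball (cvec x0) \<rho>) F"
      by (rule holomorphic_vf_subset[OF F(2)]) (auto simp: \<rho>_def)
    fix x assume x: "x \<in> ball x0 \<rho>"
    then have "x \<in> U" using d(2) by (auto simp: \<rho>_def)
    moreover have "x \<in> ball p r" using eB x cvec_in_ball cvec_B by blast
    ultimately show "X x = F (cvec x) \<and> F (cvec x) \<in> D x \<and> x \<in> ball p r"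
      using U(4) F(3)[of x] x by (simp add: \<rho>_def)
  qed
qed

lemma Esp_identity:
  assumes F: "holomorphic_vf (ball (cvec x0) \<delta>) F" and sub: "ball (cvec x0) \<delta> \<subseteq> B"
    and re: "\<And>x. x \<in> ball x0 \<delta> \<Longrightarrow> F (cvec x) \<in> Esp I (cvec x)" and z: "z \<in> ball (cvec x0) \<delta>"
  shows "F z \<in> Esp I z"
  unfolding Esp_iff
proof (intro allI impI)
  fix i assume i: "i < 2*n+1" "i \<notin> I"
  show "\<kappa> i z (F z) = 0"
    by (rule hol_identity[OF \<kappa>_hol[OF F open_ball sub] _ z]) (use re i in \<open>auto simp: Esp_iff\<close>)
qed

text \<open>
  A section of a distribution spanned by frame fields extends to a holomorphic section: the coordinates
  that vanish at the real points vanish identically.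
\<close>

lemma section_extension_Esp:
  assumes X: "X \<in> sections_at M D x0" and x0: "x0 \<in> ball p r"
    and D: "\<And>x. x \<in> ball p r \<Longrightarrow> D x = Esp I (cvec x)"
  obtains \<delta> F where "\<delta> > 0" "ball (cvec x0) \<delta> \<subseteq> B" "holomorphic_vf (ball (cvec x0) \<delta>) F"
    "\<And>x. x \<in> ball x0 \<delta> \<Longrightarrow> X x = F (cvec x)" "\<And>z. z \<in> ball (cvec x0) \<delta> \<Longrightarrow> F z \<in> Esp I z"
proof -
  obtain \<delta> F where F: "\<delta> > 0" "ball (cvec x0) \<delta> \<subseteq> B" "holomorphic_vf (ball (cvec x0) \<delta>) F"
    "\<And>x. x \<in> ball x0 \<delta> \<Longrightarrow> X x = F (cvec x) \<and> F (cvec x) \<in> D x \<and> x \<in> ball p r"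
    using section_extension[OF X x0] by blast
  have "F z \<in> Esp I z" if "z \<in> ball (cvec x0) \<delta>" for z
    by (rule Esp_identity[OF F(3,2) _ that]) (use F(4) D in auto)
  then show ?thesis using that[OF F(1-3)] F(4) by blast
qed

lemma E_analytic_conj: "i < 2 * n \<Longrightarrow> real_analytic_on (ball p r) (\<lambda>x. E i (cvec x))"
proof (cases "i < n")
  case False
  assume i: "i < 2 * n"
  have "real_analytic_on (ball p r) (\<lambda>x. cnjv (E (i - n) (cvec x)))"
    by (rule real_analytic_cnjv[OF E_analytic]) (use i False in auto)
  moreover have "cnjv (E (i - n) (cvec x)) = E i (cvec x)" if "x \<in> ball p r" for x
    using E_conj_shift[of "cvec x" i] that i False by (simp add: conj_vf_def)
  ultimately show ?thesis by (rule real_analytic_cong[OF _ open_ball])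
qed (rule E_analytic)

text \<open>
  Linear combinations of the frame with constant coefficients are analytic sections through any vector.
\<close>

lemma constant_section:
  assumes x0: "x0 \<in> ball p r" and I: "I \<subseteq> {..<2*n}" and v: "v \<in> Esp I (cvec x0)"
    and D: "\<And>x. x \<in> ball p r \<Longrightarrow> D x = Esp I (cvec x)"
  obtains X where "X \<in> sections_at M D x0" "X x0 = v"
proof
  let ?X = "\<lambda>x. \<Sum>i\<in>I. \<kappa> i (cvec x0) v *s E i (cvec x)"
  have I': "I \<subseteq> {..<2*n+1}" using I by auto
  have "?X x \<in> D x" if "x \<in> ball p r" for x
    unfolding D[OF that] by (rule Esp_lincomb[OF _ I']) (use that in auto)
  moreover have "real_analytic_on (ball p r) ?X"
    using I by (intro real_analytic_sum real_analytic_scale E_analytic_conj) auto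
  ultimately show "?X \<in> sections_at M D x0"
    unfolding sections_at_def using x0 ball_sub by blast
  show "?X x0 = v" using Esp_expand[OF _ I' v] x0 by simp
qed

lemma hol_bracket_Esp:
  assumes F: "holomorphic_vf V F" and FI: "\<And>z. z \<in> V \<Longrightarrow> F z \<in> Esp I z" and I: "I \<subseteq> {..<2*n+1}"
    and G: "holomorphic_vf V G" and GJ: "\<And>z. z \<in> V \<Longrightarrow> G z \<in> Esp J z" and J: "J \<subseteq> {..<2*n+1}"
    and V: "open V" "V \<subseteq> B" "z \<in> V"
  shows "hol_bracket F G z - (\<Sum>i\<in>I. \<Sum>j\<in>J. (\<kappa> i z (F z) * \<kappa> j z (G z)) *s hol_bracket (E i) (E j) z) \<in> Esp (I \<union> J) z"
proof -
  have E: "holomorphic_vf V (E i)" if "i < 2*n+1" for i using holomorphic_vf_subset[OF E_hol[OF that] V(2)] .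
  have zB: "z \<in> B" using V by auto
  have "hol_bracket F G z = (\<Sum>i\<in>I. \<Sum>j\<in>J. (\<kappa> i z (F z) * \<kappa> j z (G z)) *s hol_bracket (E i) (E j) z)
     + (\<Sum>j\<in>J. fd (\<lambda>z. \<kappa> j z (G z)) z (F z) *s E j z) - (\<Sum>i\<in>I. fd (\<lambda>z. \<kappa> i z (F z)) z (G z) *s E i z)"
    by (rule hol_bracket_lincomb[OF E \<kappa>_hol[OF F V(1,2)] E \<kappa>_hol[OF G V(1,2)] V(1,3)])
      (use I J V FI GJ Esp_expand in auto)
  moreover have "(\<Sum>j\<in>J. fd (\<lambda>z. \<kappa> j z (G z)) z (F z) *s E j z) \<in> Esp (I \<union> J) z"
    "(\<Sum>i\<in>I. fd (\<lambda>z. \<kappa> i z (F z)) z (G z) *s E i z) \<in> Esp (I \<union> J) z"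
    using Esp_lincomb[OF zB] I J by auto
  ultimately show ?thesis by (simp add: add_diff_eq[symmetric] Esp_simps)
qed

lemma bracket_Esp:
  assumes X: "X \<in> sections_at M D x0" and D: "\<And>x. x \<in> ball p r \<Longrightarrow> D x = Esp I (cvec x)" and I: "I \<subseteq> {..<2*n+1}"
    and Y: "Y \<in> sections_at M D' x0" and D': "\<And>x. x \<in> ball p r \<Longrightarrow> D' x = Esp J (cvec x)" and J: "J \<subseteq> {..<2*n+1}"
    and x0: "x0 \<in> ball p r"
  shows "bracket X Y x0 - (\<Sum>i\<in>I. \<Sum>j\<in>J. (\<kappa> i (cvec x0) (X x0) * \<kappa> j (cvec x0) (Y x0)) *s
     hol_bracket (E i) (E j) (cvec x0)) \<in> Esp (I \<union> J) (cvec x0)"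
proof -
  obtain d F where F: "d > 0" "ball (cvec x0) d \<subseteq> B" "holomorphic_vf (ball (cvec x0) d) F"
    "\<And>x. x \<in> ball x0 d \<Longrightarrow> X x = F (cvec x)" "\<And>z. z \<in> ball (cvec x0) d \<Longrightarrow> F z \<in> Esp I z"
    using section_extension_Esp[OF X x0 D] by blast
  obtain e G where G: "e > 0" "ball (cvec x0) e \<subseteq> B" "holomorphic_vf (ball (cvec x0) e) G"
    "\<And>x. x \<in> ball x0 e \<Longrightarrow> Y x = G (cvec x)" "\<And>z. z \<in> ball (cvec x0) e \<Longrightarrow> G z \<in> Esp J z"
    using section_extension_Esp[OF Y x0 D'] by blast
  let ?V = "ball (cvec x0) (min d e)"
  have F': "holomorphic_vf ?V F" by (rule holomorphic_vf_subset[OF F(3)]) auto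
  have G': "holomorphic_vf ?V G" by (rule holomorphic_vf_subset[OF G(3)]) auto
  have sub: "?V \<subseteq> B" using F(2) by auto
  have XF: "X x = F (cvec x)" and YG: "Y x = G (cvec x)" if "x \<in> ball x0 (min d e)" for x
    using that F(4) G(4) by auto
  have FI: "F z \<in> Esp I z" and GJ: "G z \<in> Esp J z" if "z \<in> ?V" for z
    using that F(5) G(5) by auto
  have pos: "min d e > 0" using F(1) G(1) by simp
  have br: "bracket X Y x0 = hol_bracket F G (cvec x0)"
    by (rule bracket_eq_hol_bracket[OF F' pos XF G' YG])
  have vals: "X x0 = F (cvec x0)" "Y x0 = G (cvec x0)" using XF YG pos by simp_all
  show ?thesis
    unfolding br vals
    by (rule hol_bracket_Esp[OF F' FI I G' GJ J open_ball sub]) (use pos in auto)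
qed

end

section \<open>Integrability and the Levi form in an adapted frame\<close>

context cr_chart
begin

lemma ball_in_B:
  assumes "x \<in> ball p r" obtains \<delta> where "\<delta> > 0" "ball (cvec x) \<delta> \<subseteq> B"
  using openE[OF open_ball] assms cvec_B by blast

lemma bracket_E_real:
  assumes x: "x \<in> ball p r" and ij: "i < 2*n" "j < 2*n"
  shows "bracket (\<lambda>x. E i (cvec x)) (\<lambda>x. E j (cvec x)) x = hol_bracket (E i) (E j) (cvec x)"
proof -
  obtain \<delta> where d: "\<delta> > 0" "ball (cvec x) \<delta> \<subseteq> B" using ball_in_B[OF x] by blast
  show ?thesis
    by (rule bracket_eq_hol_bracket[OF holomorphic_vf_subset[OF E_hol d(2)] d(1) _ holomorphic_vf_subset[OF E_hol d(2)]])
      (use ij in auto)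
qed

lemma bracket_frame_hol: "i < 2 * n + 1 \<Longrightarrow> j < 2 * n + 1 \<Longrightarrow> holomorphic_vf B (hol_bracket (E i) (E j))"
  by (intro holomorphic_vf_bracket E_hol open_ball)

lemma Esp_identity_ball:
  assumes "holomorphic_vf B F" "\<And>x. x \<in> ball p r \<Longrightarrow> F (cvec x) \<in> Esp I (cvec x)" "z \<in> B"
  shows "F z \<in> Esp I z"
  using Esp_identity[OF assms(1) order_refl assms(2,3)] .

text \<open>
  Integrability of the CR structure, carried from the real points to the complexification.
\<close>

lemma bracket_H:
  assumes ij: "i < n" "j < n" and z: "z \<in> B"
  shows "hol_bracket (E i) (E j) z \<in> Esp {..<n} z"
proof (rule Esp_identity_ball[OF _ _ z])
  show "holomorphic_vf B (hol_bracket (E i) (E j))" using ij by (intro bracket_frame_hol) auto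
  fix x assume x: "x \<in> ball p r"
  have sec: "(\<lambda>x. E i (cvec x)) \<in> sections_at M H x" if "i < n" for i
    unfolding sections_at_def mem_Collect_eq
  proof (intro exI[of _ "ball p r"] conjI ballI open_ball x ball_sub E_analytic that)
    fix y assume y: "y \<in> ball p r"
    show "E i (cvec y) \<in> H y" unfolding H_eq[OF y] by (rule E_in_Esp) (use y that in auto)
  qed
  have "bracket (\<lambda>x. E i (cvec x)) (\<lambda>x. E j (cvec x)) x \<in> H x"
    using cr sec[OF ij(1)] sec[OF ij(2)] x ball_sub unfolding cr_structure_def by blast
  then show "hol_bracket (E i) (E j) (cvec x) \<in> Esp {..<n} (cvec x)"
    using bracket_E_real[OF x, of i j] ij H_eq[OF x] by simp
qed

lemma bracket_conj_idx:
  assumes x: "x \<in> ball p r" and ij: "i < 2*n" "j < 2*n"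
  shows "hol_bracket (E (conj_idx i)) (E (conj_idx j)) (cvec x) = cnjv (hol_bracket (E i) (E j) (cvec x))"
proof -
  have "hol_bracket (E (conj_idx i)) (E (conj_idx j)) (cvec x) = hol_bracket (conj_vf (E i)) (conj_vf (E j)) (cvec x)"
  proof (rule hol_bracket_cong[OF open_ball])
    show "cvec x \<in> B" using x by simp
    show "holomorphic_vf B (E (conj_idx i))" "holomorphic_vf B (E (conj_idx j))"
      using ij conj_idx_simps(4) by (auto intro!: E_hol less_SucI)
  qed (use ij E_conj_idx in auto)
  also have "\<dots> = cnjv (hol_bracket (E i) (E j) (cnjv (cvec x)))"
    by (rule hol_bracket_conj[of B]) (use ij x E_hol in auto)
  finally show ?thesis by simp
qed

lemma bracket_Hb:
  assumes ij: "n \<le> i" "i < 2*n" "n \<le> j" "j < 2*n" and z: "z \<in> B"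
  shows "hol_bracket (E i) (E j) z \<in> Esp {n..<2*n} z"
proof (rule Esp_identity_ball[OF _ _ z])
  show "holomorphic_vf B (hol_bracket (E i) (E j))" using ij by (intro bracket_frame_hol) auto
  fix x assume x: "x \<in> ball p r"
  have *: "conj_idx i < n" "conj_idx j < n" using ij by (auto simp: conj_idx_def)
  then have "hol_bracket (E (conj_idx i)) (E (conj_idx j)) (cvec x) \<in> Esp {..<n} (cvec x)"
    by (rule bracket_H) (use x in simp)
  from cnjv_Esp(1)[OF x _ this] have "cnjv (hol_bracket (E (conj_idx i)) (E (conj_idx j)) (cvec x)) \<in> Esp {n..<2*n} (cvec x)"
    by (auto simp: conj_idx_image)
  then show "hol_bracket (E i) (E j) (cvec x) \<in> Esp {n..<2*n} (cvec x)"
    using bracket_conj_idx[OF x, of "conj_idx i" "conj_idx j"] ij * conj_idx_simps(3) by simp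
qed

definition levi_coeff :: "nat \<Rightarrow> nat \<Rightarrow> complex^'m \<Rightarrow> complex" where
  "levi_coeff i j z = \<kappa> (2*n) z (hol_bracket (E i) (E j) z)"

lemma levi_coeff_antisym: "levi_coeff i j z = - levi_coeff j i z"
  unfolding levi_coeff_def using hol_bracket_antisym[of "E i" "E j" z] by (simp add: \<kappa>_minus)

lemma levi_coeff_H: "i < n \<Longrightarrow> j < n \<Longrightarrow> z \<in> B \<Longrightarrow> levi_coeff i j z = 0"
  and levi_coeff_Hb: "n \<le> i \<Longrightarrow> i < 2*n \<Longrightarrow> n \<le> j \<Longrightarrow> j < 2*n \<Longrightarrow> z \<in> B \<Longrightarrow> levi_coeff i j z = 0"
  using bracket_H[of i j z] bracket_Hb[of i j z] by (auto simp: levi_coeff_def Esp_iff)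

lemma levi_coeff_hol: "i < 2*n+1 \<Longrightarrow> j < 2*n+1 \<Longrightarrow> hol B (levi_coeff i j)"
  unfolding levi_coeff_def[abs_def] by (intro \<kappa>_hol bracket_frame_hol open_ball) auto

text \<open>
  The \<open>E (2 * n)\<close>-component of the bracket of two fields in \<open>H + conj H\<close> (see \<open>hol_bracket_top\<close>). At real points it
  is the symplectic form; with the second argument conjugated and the factor \<open>\<i> / 2\<close> it is the Levi form.
\<close>

definition \<omega> :: "complex^'m \<Rightarrow> complex^'m \<Rightarrow> complex^'m \<Rightarrow> complex" where
  "\<omega> z u v = (\<Sum>i<2*n. \<Sum>j<2*n. \<kappa> i z u * \<kappa> j z v * levi_coeff i j z)"

lemma \<omega>_simps:
  "\<omega> z (u + u') v = \<omega> z u v + \<omega> z u' v" "\<omega> z (c *s u) v = c * \<omega> z u v"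
  "\<omega> z u (v + v') = \<omega> z u v + \<omega> z u v'" "\<omega> z u (c *s v) = c * \<omega> z u v"
  by (simp_all add: \<omega>_def \<kappa>_simps sum.distrib sum_distrib_left algebra_simps)

lemma \<omega>_antisym: "\<omega> z u v = - \<omega> z v u"
proof -
  have "\<omega> z u v = (\<Sum>j<2*n. \<Sum>i<2*n. \<kappa> i z u * \<kappa> j z v * levi_coeff i j z)"
    unfolding \<omega>_def by (rule sum.swap)
  also have "\<dots> = (\<Sum>j<2*n. \<Sum>i<2*n. - (\<kappa> j z v * \<kappa> i z u * levi_coeff j i z))"
    by (intro sum.cong refl, subst levi_coeff_antisym) simp
  finally show ?thesis by (simp add: \<omega>_def sum_negf)
qed

lemma \<omega>_restrict:
  assumes I: "I \<subseteq> {..<2*n}" "u \<in> Esp I z" and J: "J \<subseteq> {..<2*n}" "v \<in> Esp J z"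
  shows "\<omega> z u v = (\<Sum>i\<in>I. \<Sum>j\<in>J. \<kappa> i z u * \<kappa> j z v * levi_coeff i j z)"
proof -
  have "\<omega> z u v = (\<Sum>i\<in>I. \<Sum>j<2*n. \<kappa> i z u * \<kappa> j z v * levi_coeff i j z)"
    unfolding \<omega>_def by (rule sum.mono_neutral_right) (use I in \<open>auto simp: Esp_iff\<close>)
  also have "\<dots> = (\<Sum>i\<in>I. \<Sum>j\<in>J. \<kappa> i z u * \<kappa> j z v * levi_coeff i j z)"
    by (intro sum.cong refl sum.mono_neutral_right) (use J in \<open>auto simp: Esp_iff\<close>)
  finally show ?thesis .
qed

lemma \<omega>_H: "u \<in> Esp {..<n} z \<Longrightarrow> v \<in> Esp {..<n} z \<Longrightarrow> z \<in> B \<Longrightarrow> \<omega> z u v = 0"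
  and \<omega>_Hb: "u \<in> Esp {n..<2*n} z \<Longrightarrow> v \<in> Esp {n..<2*n} z \<Longrightarrow> z \<in> B \<Longrightarrow> \<omega> z u v = 0"
  by (subst \<omega>_restrict[where I="{..<n}" and J="{..<n}"], auto simp: levi_coeff_H)
    (subst \<omega>_restrict[where I="{n..<2*n}" and J="{n..<2*n}"], auto simp: levi_coeff_Hb)

lemma hol_bracket_top:
  assumes F: "holomorphic_vf V F" and FI: "\<And>z. z \<in> V \<Longrightarrow> F z \<in> Esp {..<2*n} z"
    and G: "holomorphic_vf V G" and GJ: "\<And>z. z \<in> V \<Longrightarrow> G z \<in> Esp {..<2*n} z"
    and V: "open V" "V \<subseteq> B" "z \<in> V"
  shows "\<kappa> (2*n) z (hol_bracket F G z) = \<omega> z (F z) (G z)"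
proof -
  have "hol_bracket F G z - (\<Sum>i<2*n. \<Sum>j<2*n. (\<kappa> i z (F z) * \<kappa> j z (G z)) *s hol_bracket (E i) (E j) z) \<in> Esp ({..<2*n} \<union> {..<2*n}) z"
    by (rule hol_bracket_Esp[OF F FI _ G GJ _ V]) auto
  then have "\<kappa> (2*n) z (hol_bracket F G z - (\<Sum>i<2*n. \<Sum>j<2*n. (\<kappa> i z (F z) * \<kappa> j z (G z)) *s hol_bracket (E i) (E j) z)) = 0"
    by (auto simp: Esp_iff)
  then show ?thesis by (simp add: \<kappa>_simps \<omega>_def levi_coeff_def)
qed

text \<open>
  Since the remaining terms of the Leibniz rule lie in the distributions themselves, the transversal
  component of the bracket depends only on the values of the two sections at the point.
\<close>

lemma bracket_top:
  assumes X: "X \<in> sections_at M D x0" and D: "\<And>x. x \<in> ball p r \<Longrightarrow> D x = Esp I (cvec x)" and I: "I \<subseteq> {..<2*n}"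
    and Y: "Y \<in> sections_at M D' x0" and D': "\<And>x. x \<in> ball p r \<Longrightarrow> D' x = Esp J (cvec x)" and J: "J \<subseteq> {..<2*n}"
    and x0: "x0 \<in> ball p r"
  shows "\<kappa> (2*n) (cvec x0) (bracket X Y x0) = \<omega> (cvec x0) (X x0) (Y x0)"
proof -
  have IJ: "I \<subseteq> {..<2*n+1}" "J \<subseteq> {..<2*n+1}" using I J by auto
  have XD: "X x0 \<in> Esp I (cvec x0)" using X D[OF x0] unfolding sections_at_def by auto
  have YD: "Y x0 \<in> Esp J (cvec x0)" using Y D'[OF x0] unfolding sections_at_def by auto
  have "bracket X Y x0 - (\<Sum>i\<in>I. \<Sum>j\<in>J. (\<kappa> i (cvec x0) (X x0) * \<kappa> j (cvec x0) (Y x0)) *s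
     hol_bracket (E i) (E j) (cvec x0)) \<in> Esp (I \<union> J) (cvec x0)"
    by (rule bracket_Esp[OF X D IJ(1) Y D' IJ(2) x0])
  moreover have "2 * n \<notin> I \<union> J" using I J by auto
  ultimately have "\<kappa> (2*n) (cvec x0) (bracket X Y x0 - (\<Sum>i\<in>I. \<Sum>j\<in>J. (\<kappa> i (cvec x0) (X x0) * \<kappa> j (cvec x0) (Y x0)) *s
     hol_bracket (E i) (E j) (cvec x0))) = 0"
    unfolding Esp_iff by simp
  then show ?thesis unfolding \<omega>_restrict[OF I XD J YD] by (simp add: \<kappa>_simps levi_coeff_def)
qed

lemma Esp_top: "v \<in> Esp {..<2*n} z \<longleftrightarrow> \<kappa> (2*n) z v = 0"
  by (auto simp: Esp_iff less_Suc_eq)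

lemma E_top: "z \<in> B \<Longrightarrow> \<kappa> (2*n) z (E (2*n) z) = 1" using \<kappa>_E[of z "2*n" "2*n"] by simp

lemma symplectic_form_eq:
  assumes x: "x \<in> ball p r" and u: "u \<in> levi_dist H x" and v: "v \<in> levi_dist H x"
  shows "symplectic_form M H x u v = {w. \<kappa> (2*n) (cvec x) w = \<omega> (cvec x) u v}"
proof -
  note WE = levi_dist_eq
  have u': "u \<in> Esp {..<2*n} (cvec x)" and v': "v \<in> Esp {..<2*n} (cvec x)" using u v WE[OF x] by auto
  have top: "\<kappa> (2*n) (cvec x) (bracket X Y x) = \<omega> (cvec x) (X x) (Y x)"
    if "X \<in> sections_at M (levi_dist H) x" "Y \<in> sections_at M (levi_dist H) x" for X Y
    by (rule bracket_top[OF that(1) WE order_refl that(2) WE order_refl x])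
  obtain X where X: "X \<in> sections_at M (levi_dist H) x" "X x = u"
    using constant_section[OF x order_refl u' WE] by blast
  obtain Y where Y: "Y \<in> sections_at M (levi_dist H) x" "Y x = v"
    using constant_section[OF x order_refl v' WE] by blast
  show ?thesis
    unfolding symplectic_form_def WE[OF x] Esp_top \<kappa>_simps
    using top X Y by fastforce
qed

lemma sections_cnjv: "Y \<in> sections_at M D x \<Longrightarrow> (\<lambda>q. cnjv (Y q)) \<in> sections_at M (conj_dist D) x"
  unfolding sections_at_def conj_dist_def using real_analytic_cnjv by blast

lemma levi_form_eq:
  assumes x: "x \<in> ball p r" and u: "u \<in> H x" and v: "v \<in> H x"
  shows "levi_form M H x u v = {w. \<kappa> (2*n) (cvec x) w = (\<i> / 2) * \<omega> (cvec x) u (cnjv v)}"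
proof -
  have sub: "{..<n} \<subseteq> {..<2*n}" "{n..<2*n} \<subseteq> {..<2*n}" by auto
  have u': "u \<in> Esp {..<n} (cvec x)" and v': "v \<in> Esp {..<n} (cvec x)" using u v H_eq[OF x] by auto
  have top: "\<kappa> (2*n) (cvec x) (bracket X (\<lambda>q. cnjv (Y q)) x) = \<omega> (cvec x) (X x) (cnjv (Y x))"
    if "X \<in> sections_at M H x" "Y \<in> sections_at M H x" for X Y
    by (rule bracket_top[OF that(1) H_eq sub(1) sections_cnjv[OF that(2)] conj_H_eq sub(2) x])
  obtain X where X: "X \<in> sections_at M H x" "X x = u"
    using constant_section[OF x sub(1) u' H_eq] by blast
  obtain Y where Y: "Y \<in> sections_at M H x" "Y x = v"
    using constant_section[OF x sub(1) v' H_eq] by blast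
  show ?thesis
    unfolding levi_form_def levi_dist_def[symmetric] levi_dist_eq[OF x] Esp_top \<kappa>_simps
    using top X Y by fastforce
qed

text \<open>
  With the Levi form expressed by \<open>\<omega>\<close>, its kernel is cut out of \<open>H\<close> by linear equations whose coefficients
  are holomorphic.
\<close>

lemma levi_kernel_eq:
  assumes x: "x \<in> ball p r"
  shows "levi_kernel M H x = {u \<in> Esp {..<n} (cvec x). \<forall>v\<in>Esp {n..<2*n} (cvec x). \<omega> (cvec x) u v = 0}"
proof -
  have "levi_form M H x u v = levi_dist H x \<longleftrightarrow> \<omega> (cvec x) u (cnjv v) = 0" if "u \<in> H x" "v \<in> H x" for u v
  proof -
    show ?thesis
      unfolding levi_form_eq[OF x that] levi_dist_eq[OF x] Esp_top set_eq_iff mem_Collect_eq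
      by (auto dest: spec[of _ 0])
  qed
  note form = this
  have "levi_kernel M H x = {u \<in> H x. \<forall>v\<in>H x. levi_form M H x u v = levi_dist H x}"
    by (simp add: levi_kernel_def levi_dist_def)
  also have "\<dots> = {u \<in> H x. \<forall>v\<in>H x. \<omega> (cvec x) u (cnjv v) = 0}"
    using form by blast
  also have "\<dots> = {u \<in> H x. \<forall>v\<in>conj_dist H x. \<omega> (cvec x) u v = 0}"
    unfolding conj_dist_def by simp
  finally have "levi_kernel M H x = {u \<in> H x. \<forall>v\<in>conj_dist H x. \<omega> (cvec x) u v = 0}" .
  then show ?thesis unfolding H_eq[OF x] conj_H_eq[OF x] .
qed

end

section \<open>Existence of adapted frames\<close>

text \<open>
  The analytic frame of \<open>H\<close> near \<open>p\<close> and its conjugate are independent at \<open>p\<close> because \<open>H\<close> meets its conjugate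
  trivially; they are completed by a constant vector and extended holomorphically.
\<close>

lemma cr_chart_exists:
  fixes M :: "(real^'m) set" and H :: "real^'m \<Rightarrow> (complex^'m) set"
  assumes cr: "cr_structure n M H" and p: "p \<in> M"
  obtains r E \<kappa> where "cr_chart n M H p r E \<kappa>"
proof -
  have N: "CARD('m) = 2 * n + 1" and M: "open M" and tr: "H p \<inter> conj_dist H p = {0}"
    and ra: "real_analytic_distribution M n H"
    using cr p unfolding cr_structure_def by auto
  have "\<exists>U X. open U \<and> p \<in> U \<and> U \<subseteq> M \<and> (\<forall>i<n. real_analytic_on U (X i)) \<and>
        (\<forall>x\<in>U. H x = vec.span ((\<lambda>i. X i x) ` {..<n}) \<and> vec.dim (H x) = n)"
    using ra p unfolding real_analytic_distribution_def by (rule bspec)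
  then obtain U X where U: "open U" "p \<in> U" "U \<subseteq> M" and Xa: "\<forall>i<n. real_analytic_on U (X i)"
    and HXdim: "\<forall>x\<in>U. H x = vec.span ((\<lambda>i. X i x) ` {..<n}) \<and> vec.dim (H x) = n"
    by (elim exE conjE)
  have Xa: "real_analytic_on U (X i)" if "i < n" for i using Xa that by simp
  have HX: "H x = vec.span ((\<lambda>i. X i x) ` {..<n})" and dimH: "vec.dim (H x) = n" if "x \<in> U" for x
    using bspec[OF HXdim that] by (rule conjunct1, rule conjunct2)
  have "\<exists>\<delta> F. \<delta> > 0 \<and> holomorphic_vf (ball (cvec p) \<delta>) F \<and> (\<forall>x\<in>ball p \<delta>. F (cvec x) = X i x)" if "i < n" for i
    by (rule analytic_extension[OF Xa[OF that] U(2)]) blast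
  then have "\<forall>i. \<exists>\<delta> F. i < n \<longrightarrow> (\<delta> > 0 \<and> holomorphic_vf (ball (cvec p) \<delta>) F \<and> (\<forall>x\<in>ball p \<delta>. F (cvec x) = X i x))"
    by blast
  then obtain \<delta> F where dF: "\<forall>i. i < n \<longrightarrow> (\<delta> i > 0 \<and> holomorphic_vf (ball (cvec p) (\<delta> i)) (F i) \<and> (\<forall>x\<in>ball p (\<delta> i). F i (cvec x) = X i x))"
    unfolding choice_iff by (elim exE)
  have d: "\<delta> i > 0" and F: "holomorphic_vf (ball (cvec p) (\<delta> i)) (F i)"
    and FX: "x \<in> ball p (\<delta> i) \<Longrightarrow> F i (cvec x) = X i x" if "i < n" for i x
    using dF that by simp_all
  obtain d0 where d0: "d0 > 0" "ball p d0 \<subseteq> U" using U openE by blast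
  define \<rho> where "\<rho> = Min (insert d0 (\<delta> ` {..<n}))"
  have \<rho>: "\<rho> > 0" unfolding \<rho>_def using d d0 by (subst Min_gr_iff) auto
  have \<rho>d: "\<rho> \<le> d0" "\<And>i. i < n \<Longrightarrow> \<rho> \<le> \<delta> i" unfolding \<rho>_def by (auto intro: Min_le)
  let ?B = "ball (cvec p) \<rho>"
  have F': "holomorphic_vf ?B (F i)" if "i < n" for i
    by (rule holomorphic_vf_subset[OF F[OF that]]) (use \<rho>d(2)[OF that] in auto)
  have FX': "F i (cvec x) = X i x" if "i < n" "x \<in> ball p \<rho>" for i x
    by (rule FX[OF that(1)]) (use \<rho>d(2)[OF that(1)] that(2) in simp)
  have U\<rho>: "ball p \<rho> \<subseteq> U" using d0 \<rho>d by auto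
  define G where "G i = (if i < n then F i else conj_vf (F (i - n)))" for i
  obtain e where e: "e \<notin> vec.span ((\<lambda>i. G i (cvec p)) ` {..<2*n})"
    using exists_transversal[where 'm='m and k="2*n" and f="\<lambda>i. G i (cvec p)"] N by auto
  define E where "E i = (if i < 2*n then G i else (\<lambda>_. e))" for i
  have E_hol: "holomorphic_vf ?B (E i)" for i
  proof -
    have "holomorphic_vf ?B (G i)" if "i < 2 * n"
      unfolding G_def using F' that by (auto intro!: holomorphic_conj_vf[of ?B] simp del: mem_ball)
    moreover have "holomorphic_vf ?B (\<lambda>_. e)" unfolding holomorphic_vf_iff by (auto intro: hol_const)
    ultimately show ?thesis by (simp add: E_def)
  qed
  have pU: "p \<in> ball p \<rho>" using \<rho> by simp
  have indep: "\<forall>i<CARD('m). c i = 0" if c: "(\<Sum>i<CARD('m). c i *s E i (cvec p)) = 0" for c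
  proof -
    have s1: "(\<Sum>i<2*n. c i *s G i (cvec p)) + c (2*n) *s e = 0"
      using c by (simp add: N E_def)
    have inspan: "(\<Sum>i<2*n. c i *s G i (cvec p)) \<in> vec.span ((\<lambda>i. G i (cvec p)) ` {..<2*n})"
      by (intro vec.span_sum vec.span_scale vec.span_base) auto
    have ce: "c (2*n) = 0"
    proof (rule ccontr)
      assume nz: "c (2*n) \<noteq> 0"
      have "c (2*n) *s e = - (\<Sum>i<2*n. c i *s G i (cvec p))" using s1 by (simp add: eq_neg_iff_add_eq_0 add.commute)
      then have "(inverse (c (2*n)) * c (2*n)) *s e = inverse (c (2*n)) *s (- (\<Sum>i<2*n. c i *s G i (cvec p)))"
        by (metis vector_smult_assoc)
      then have "e = inverse (c (2*n)) *s (- (\<Sum>i<2*n. c i *s G i (cvec p)))" using nz by simp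
      also have "\<dots> \<in> vec.span ((\<lambda>i. G i (cvec p)) ` {..<2*n})"
        by (intro vec.span_scale vec.span_neg inspan)
      finally show False using e by blast
    qed
    have split: "(\<Sum>i<2*n. c i *s G i (cvec p)) = (\<Sum>i<n. c i *s X i p) + (\<Sum>i<n. c (n+i) *s cnjv (X i p))"
    proof -
      have "(\<Sum>i<2*n. c i *s G i (cvec p)) = (\<Sum>i<n. c i *s G i (cvec p)) + (\<Sum>i<n. c (n+i) *s G (n+i) (cvec p))"
        using sum.atLeastLessThan_concat[of 0 n "n+n" "\<lambda>i. c i *s G i (cvec p)"]
          sum.shift_bounds_nat_ivl[of "\<lambda>i. c i *s G i (cvec p)" 0 n n]
        by (simp add: atLeast0LessThan add.commute mult_2)
      then show ?thesis using FX'[OF _ pU] by (simp add: G_def conj_vf_def)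
    qed
    let ?h = "\<Sum>i<n. c i *s X i p" and ?k = "\<Sum>i<n. cnj (c (n+i)) *s X i p"
    have hk: "?h + cnjv ?k = 0"
      using s1 ce split by (simp add: cnjv_sum cnjv_simps)
    have inH: "?h \<in> H p" "?k \<in> H p" unfolding HX[OF U(2)]
      by (intro vec.span_sum vec.span_scale vec.span_base; auto)+
    have sub: "vec.subspace (H p)" unfolding HX[OF U(2)] by (rule vec.subspace_span)
    have "cnjv ?k = - ?h" using hk by (simp add: eq_neg_iff_add_eq_0 add.commute)
    then have "cnjv ?k \<in> H p" using vec.subspace_neg[OF sub inH(1)] by simp
    moreover have "cnjv ?k \<in> conj_dist H p" unfolding conj_dist_def by (rule imageI[OF inH(2)])
    ultimately have "cnjv ?k = 0" using tr by blast
    then have k0: "?k = 0" by (metis cnjv_cnjv cnjv_simps(3))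
    with hk have h0: "?h = 0" by (simp add: cnjv_simps)
    have dimX: "vec.dim (vec.span ((\<lambda>i. X i p) ` {..<n})) = n" using dimH[OF U(2)] HX[OF U(2)] by simp
    have "c i = 0" if "i < n" for i using frame_independent[OF dimX h0 that] .
    moreover have "c (n+i) = 0" if "i < n" for i using frame_independent[OF dimX k0 that] by simp
    ultimately have *: "c i = 0" if "i < n \<or> (\<exists>j<n. i = n + j) \<or> i = 2*n" for i
      using ce that by blast
    have "i < n \<or> (\<exists>j<n. i = n + j) \<or> i = 2*n" if "i < 2*n+1" for i
      using that by presburger
    with * show ?thesis unfolding N by blast
  qed
  have pB: "cvec p \<in> ?B" using \<rho> by simp
  obtain V \<kappa> where V: "open V" "cvec p \<in> V" "V \<subseteq> ?B"
    and \<kappa>: "\<And>z v. z \<in> V \<Longrightarrow> (\<Sum>i<CARD('m). \<kappa> i z v *s E i z) = v"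
    "\<And>z i j. z \<in> V \<Longrightarrow> i < CARD('m) \<Longrightarrow> j < CARD('m) \<Longrightarrow> \<kappa> i z (E j z) = (if i = j then 1 else 0)"
    "\<And>z i v w. \<kappa> i z (v + w) = \<kappa> i z v + \<kappa> i z w"
    "\<And>z i c v. \<kappa> i z (c *s v) = c * \<kappa> i z v"
    "\<And>i Y W. holomorphic_vf W Y \<Longrightarrow> open W \<Longrightarrow> W \<subseteq> V \<Longrightarrow> hol W (\<lambda>z. \<kappa> i z (Y z))"
  proof (rule local_coframe[where E=E and U="?B" and a="cvec p"])
    show "holomorphic_vf ?B (E i)" for i by (rule E_hol)
    show "\<forall>i<CARD('m). c i = 0" if "(\<Sum>i<CARD('m). c i *s E i (cvec p)) = 0" for c
      using indep[OF that] .
  qed (rule open_ball, rule pB, rule that, assumption+)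
  obtain r where r: "r > 0" "ball (cvec p) r \<subseteq> V" using V openE by blast
  have rB: "ball (cvec p) r \<subseteq> ?B" using r V by blast
  have r\<rho>: "ball p r \<subseteq> ball p \<rho>"
    using rB cvec_in_ball by blast
  have "cr_chart n M H p r E \<kappa>"
  proof (unfold_locales)
    show "cr_structure n M H" by fact
    show "0 < r" by fact
    show "ball p r \<subseteq> M" using r\<rho> U\<rho> U by blast
    show "holomorphic_vf (ball (cvec p) r) (E i)" for i by (rule holomorphic_vf_subset[OF E_hol rB])
    show "E (n + i) z = conj_vf (E i) z" if "i < n" for i z using that by (simp add: E_def G_def)
    show "real_analytic_on (ball p r) (\<lambda>x. E i (cvec x))" if "i < n" for i
    proof (rule real_analytic_cong[OF real_analytic_subset[OF Xa[OF that]] open_ball])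
      show "ball p r \<subseteq> U" using r\<rho> U\<rho> by blast
      show "X i x = E i (cvec x)" if "x \<in> ball p r" for x
        using FX'[of i x] r\<rho> that \<open>i < n\<close> by (auto simp: E_def G_def simp del: mem_ball)
    qed
    show "H x = vec.span ((\<lambda>i. E i (cvec x)) ` {..<n})" if x: "x \<in> ball p r" for x
    proof -
      have "x \<in> U" "x \<in> ball p \<rho>" using x r\<rho> U\<rho> by blast+
      then show ?thesis unfolding HX[OF \<open>x \<in> U\<close>]
        by (intro arg_cong[where f=vec.span] image_cong refl) (auto simp: E_def G_def FX' simp del: mem_ball)
    qed
    show "hol W (\<lambda>z. \<kappa> i z (Y z))" if "holomorphic_vf W Y" "open W" "W \<subseteq> ball (cvec p) r" for W Y i
      using \<kappa>(5) that r by blast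
  qed (use \<kappa> r N in \<open>auto simp del: mem_ball\<close>)
  then show ?thesis using that by blast
qed

lemma cr_chart_shrink:
  assumes "cr_chart n M H p r E \<kappa>" "0 < r'" "r' \<le> r"
  shows "cr_chart n M H p r' E \<kappa>"
proof -
  interpret cr_chart n M H p r E \<kappa> by fact
  have sub: "ball (cvec p) r' \<subseteq> B" "ball p r' \<subseteq> ball p r" using assms by auto
  show ?thesis
  proof (unfold_locales)
    show "cr_structure n M H" by (rule cr)
    show "0 < r'" by fact
    show "ball p r' \<subseteq> M" using sub ball_sub by blast
    show "holomorphic_vf (ball (cvec p) r') (E i)" if "i < 2*n+1" for i
      by (rule holomorphic_vf_subset[OF E_hol[OF that] sub(1)])
    show "real_analytic_on (ball p r') (\<lambda>x. E i (cvec x))" if "i < n" for i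
      by (rule real_analytic_subset[OF E_analytic[OF that] sub(2)])
    show "hol W (\<lambda>z. \<kappa> i z (Y z))" if "holomorphic_vf W Y" "open W" "W \<subseteq> ball (cvec p) r'" for W Y i
      using \<kappa>_hol that sub by blast
    show "E (n + i) z = conj_vf (E i) z" if "i < n" "z \<in> ball (cvec p) r'" for i z
      using E_conj that sub by blast
    show "H x = vec.span ((\<lambda>i. E i (cvec x)) ` {..<n})" if "x \<in> ball p r'" for x
      using H_span that sub by blast
    show "(\<Sum>i<2*n+1. \<kappa> i z v *s E i z) = v" if "z \<in> ball (cvec p) r'" for z v
      using \<kappa>_sum that sub by blast
    show "\<kappa> i z (E j z) = (if i = j then 1 else 0)" if "z \<in> ball (cvec p) r'" "i < 2*n+1" "j < 2*n+1" for i j z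
      using \<kappa>_E that sub by blast
  qed (simp_all add: \<kappa>_add \<kappa>_scale)
qed

section \<open>A holomorphic frame of the Levi kernel\<close>

context cr_chart
begin

lemma \<omega>_expand_right: "z \<in> B \<Longrightarrow> \<omega> z u v = (\<Sum>j<2*n. \<kappa> j z v * \<omega> z u (E j z))"
proof -
  assume z: "z \<in> B"
  have "\<omega> z u (E j z) = (\<Sum>i<2*n. \<kappa> i z u * levi_coeff i j z)" if j: "j < 2*n" for j
  proof -
    have "(\<Sum>l<2*n. \<kappa> i z u * \<kappa> l z (E j z) * levi_coeff i l z) = \<kappa> i z u * levi_coeff i j z" for i
    proof -
      have "(\<Sum>l<2*n. \<kappa> i z u * \<kappa> l z (E j z) * levi_coeff i l z) = (\<Sum>l<2*n. if l = j then \<kappa> i z u * levi_coeff i l z else 0)"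
        by (intro sum.cong refl) (use z j \<kappa>_E in auto)
      then show ?thesis using j by simp
    qed
    then show ?thesis by (simp add: \<omega>_def)
  qed
  then have "(\<Sum>j<2*n. \<kappa> j z v * \<omega> z u (E j z)) = (\<Sum>j<2*n. \<Sum>i<2*n. \<kappa> j z v * (\<kappa> i z u * levi_coeff i j z))"
    by (simp add: sum_distrib_left)
  also have "\<dots> = \<omega> z u v"
    unfolding \<omega>_def by (subst sum.swap) (simp add: mult_ac)
  finally show ?thesis ..
qed

lemma \<omega>_zero: "\<omega> z 0 v = 0" "\<omega> z v 0 = 0"
  by (simp_all add: \<omega>_def)

lemma levi_kernel_subspace:
  assumes x: "x \<in> ball p r" shows "vec.subspace (levi_kernel M H x)"
  unfolding levi_kernel_eq[OF x]
  by (rule vec.subspaceI) (simp_all add: Esp_simps \<omega>_simps \<omega>_zero)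

text \<open>
  The kernel of a holomorphic matrix \<open>\<Lambda>\<close> with one-dimensional kernels at the real points has a
  holomorphic frame. Instead of choosing a minor, the matrix is made invertible by a perturbation of rank
  one: with \<open>w\<close> outside the range of \<open>\<Lambda> p\<close> and a coordinate \<open>c0\<close> that does not vanish on the kernel at \<open>p\<close>, the matrix
  \<open>\<Lambda>' v = \<Lambda> v + v $ c0 *s w\<close> is invertible near \<open>p\<close>, and the solution of \<open>\<Lambda>' k = w\<close> is the generator of the
  kernel with \<open>c0\<close>-coordinate \<open>1\<close>.
\<close>

lemma levi_kernel_frame:
  assumes dimK: "\<forall>q\<in>M. vec.dim (levi_kernel M H q) = 1"
  obtains r' k where "0 < r'" "r' \<le> r" "holomorphic_vf (ball (cvec p) r') k"
    "\<And>z. z \<in> ball (cvec p) r' \<Longrightarrow> k z \<noteq> 0"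
    "\<And>x. x \<in> ball p r' \<Longrightarrow> levi_kernel M H x = range (\<lambda>c. c *s k (cvec x))"
proof -
  have N: "CARD('m) = 2 * n + 1" using cr by (simp add: cr_structure_def)
  have pp: "p \<in> ball p r" "cvec p \<in> B" using r by auto
  have K1: "\<exists>k. k \<noteq> 0 \<and> levi_kernel M H x = range (\<lambda>c. c *s k)" if x: "x \<in> ball p r" for x
  proof -
    have "x \<in> M" using x ball_sub by (rule set_rev_mp)
    with dimK have d: "vec.dim (levi_kernel M H x) = 1" by (rule bspec)
    show ?thesis by (rule dim_one_range[OF levi_kernel_subspace[OF x] d]) (intro exI conjI)
  qed
  obtain b :: "'m \<Rightarrow> nat" where b: "bij_betw b UNIV {..<2*n+1}"
    using ex_bij_betw_finite_nat[of "UNIV :: 'm set"] N by (auto simp: lessThan_atLeast0)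
  have bN: "b c < 2*n+1" for c using b by (auto simp: bij_betw_def)
  have b_onto: "\<exists>c. b c = i" if "i < 2*n+1" for i
    using b that unfolding bij_betw_def by (metis imageE lessThan_iff)
  \<comment> \<open>the equations of the Levi kernel: the coordinates beyond \<open>H\<close> vanish, and so does \<open>\<omega>\<close> with each conjugate frame field\<close>
  define l where "l i z v = (if i < n then \<Sum>j<n. \<kappa> j z v * levi_coeff j (n+i) z else \<kappa> i z v)" for i z v
  have l_lin: "l i z (v + w) = l i z v + l i z w" "l i z (c *s v) = c * l i z v" for i z v w c
    by (auto simp: l_def \<kappa>_simps sum.distrib sum_distrib_left algebra_simps)
  have l_sum: "l i z (\<Sum>a\<in>S. f a) = (\<Sum>a\<in>S. l i z (f a))" for i z S and f :: "'m \<Rightarrow> complex^'m"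
  proof (induction S rule: infinite_finite_induct)
    case (infinite S) then show ?case using l_lin(2)[of i z 0 0] by simp
  next
    case empty then show ?case using l_lin(2)[of i z 0 0] by simp
  qed (simp add: l_lin)
  have ker: "v \<in> levi_kernel M H x \<longleftrightarrow> (\<forall>i<2*n+1. l i (cvec x) v = 0)" if x: "x \<in> ball p r" for x v
  proof -
    have xB: "cvec x \<in> B" using x by simp
    have "v \<in> levi_kernel M H x \<longleftrightarrow> v \<in> Esp {..<n} (cvec x) \<and> (\<forall>j\<in>{n..<2*n}. \<omega> (cvec x) v (E j (cvec x)) = 0)"
    proof -
      have "(\<forall>w\<in>Esp {n..<2*n} (cvec x). \<omega> (cvec x) v w = 0) \<longleftrightarrow> (\<forall>j\<in>{n..<2*n}. \<omega> (cvec x) v (E j (cvec x)) = 0)"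
      proof
        assume "\<forall>j\<in>{n..<2*n}. \<omega> (cvec x) v (E j (cvec x)) = 0"
        then have "\<kappa> j (cvec x) w * \<omega> (cvec x) v (E j (cvec x)) = 0" if "w \<in> Esp {n..<2*n} (cvec x)" "j < 2*n" for w j
          using that by (cases "n \<le> j") (auto simp: Esp_iff)
        then have "(\<Sum>j<2*n. \<kappa> j (cvec x) w * \<omega> (cvec x) v (E j (cvec x))) = 0" if "w \<in> Esp {n..<2*n} (cvec x)" for w
          using that by (intro sum.neutral) auto
        then show "\<forall>w\<in>Esp {n..<2*n} (cvec x). \<omega> (cvec x) v w = 0"
          using trans[OF \<omega>_expand_right[OF xB]] by blast
      next
        assume *: "\<forall>w\<in>Esp {n..<2*n} (cvec x). \<omega> (cvec x) v w = 0"
        show "\<forall>j\<in>{n..<2*n}. \<omega> (cvec x) v (E j (cvec x)) = 0"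
        proof
          fix j assume "j \<in> {n..<2*n}"
          then have "E j (cvec x) \<in> Esp {n..<2*n} (cvec x)" by (intro E_in_Esp[OF xB]) auto
          with * show "\<omega> (cvec x) v (E j (cvec x)) = 0" by (rule bspec)
        qed
      qed
      then show ?thesis unfolding levi_kernel_eq[OF x] by simp
    qed
    also have "\<dots> \<longleftrightarrow> (\<forall>i<2*n+1. l i (cvec x) v = 0)"
    proof -
      have w: "\<omega> (cvec x) v (E (n+i) (cvec x)) = l i (cvec x) v" if v: "v \<in> Esp {..<n} (cvec x)" and i: "i < n" for i
      proof -
        have "E (n+i) (cvec x) \<in> Esp {n+i} (cvec x)" using E_in_Esp[OF xB] i by simp
        then have "\<omega> (cvec x) v (E (n+i) (cvec x)) = (\<Sum>a<n. \<Sum>c\<in>{n+i}. \<kappa> a (cvec x) v * \<kappa> c (cvec x) (E (n+i) (cvec x)) * levi_coeff a c (cvec x))"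
          by (intro \<omega>_restrict v) (use i in auto)
        then show ?thesis using i \<kappa>_E[OF xB, of "n+i" "n+i"] by (simp add: l_def)
      qed
      have e: "v \<in> Esp {..<n} (cvec x) \<longleftrightarrow> (\<forall>i<2*n+1. n \<le> i \<longrightarrow> l i (cvec x) v = 0)"
        unfolding Esp_iff l_def by (simp add: not_less)
      show ?thesis
      proof
        assume *: "v \<in> Esp {..<n} (cvec x) \<and> (\<forall>j\<in>{n..<2*n}. \<omega> (cvec x) v (E j (cvec x)) = 0)"
        have "l i (cvec x) v = 0" if "i < n" for i
          using w[of i, OF conjunct1[OF *] that] bspec[OF conjunct2[OF *], of "n+i"] that by simp
        moreover have "l i (cvec x) v = 0" if "i < 2*n+1" "n \<le> i" for i
          using e * that by simp
        ultimately have "l i (cvec x) v = 0" if "i < 2*n+1" for i using that by (cases "i < n") simp_all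
        then show "\<forall>i<2*n+1. l i (cvec x) v = 0" by simp
      next
        assume *: "\<forall>i<2*n+1. l i (cvec x) v = 0"
        then have v: "v \<in> Esp {..<n} (cvec x)" using e by simp
        have "\<omega> (cvec x) v (E j (cvec x)) = 0" if "j \<in> {n..<2*n}" for j
        proof -
          have "j - n < n" "j - n < 2*n+1" using that by auto
          then show ?thesis using w[OF v, of "j - n"] *[rule_format, of "j - n"] that by simp
        qed
        then show "v \<in> Esp {..<n} (cvec x) \<and> (\<forall>j\<in>{n..<2*n}. \<omega> (cvec x) v (E j (cvec x)) = 0)"
          using v by blast
      qed
    qed
    finally show ?thesis .
  qed
  define \<Lambda> where "\<Lambda> z = (\<chi> a c. l (b a) z (axis c 1))" for z
  have \<Lambda>v: "(\<Lambda> z *v v) $ a = l (b a) z v" for z v a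
  proof -
    have "l (b a) z v = l (b a) z (\<Sum>c\<in>UNIV. v $ c *s axis c 1)" by (simp add: basis_expansion)
    then show ?thesis by (simp add: l_sum l_lin \<Lambda>_def matrix_vector_mult_def mult.commute)
  qed
  have \<Lambda>ker: "v \<in> levi_kernel M H x \<longleftrightarrow> \<Lambda> (cvec x) *v v = 0" if "x \<in> ball p r" for x v
    unfolding ker[OF that] vec_eq_iff \<Lambda>v using bN b_onto by (metis zero_index)
  have hol_\<kappa>_axis: "hol B (\<lambda>z. \<kappa> i z (axis c 1))" for i c
    by (intro \<kappa>_hol) (auto simp: holomorphic_vf_iff intro: hol_const)
  have \<Lambda>_hol: "hol B (\<lambda>z. \<Lambda> z $ a $ c)" for a c
    unfolding \<Lambda>_def l_def by (cases "b a < n") (auto intro!: hol_sum hol_mult hol_\<kappa>_axis levi_coeff_hol)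
  obtain k0 where k0: "k0 \<noteq> 0" "levi_kernel M H p = range (\<lambda>c. c *s k0)" using K1[OF pp(1)] by blast
  obtain c0 where c0: "k0 $ c0 \<noteq> 0" using k0(1) by (metis vec_eq_iff zero_index)
  have "k0 \<in> levi_kernel M H p" unfolding k0(2) by (rule range_eqI[of _ _ 1]) simp
  then have "\<Lambda> (cvec p) *v k0 = 0" using \<Lambda>ker[OF pp(1)] by simp
  then have "\<not> invertible (\<Lambda> (cvec p))"
    using k0(1) matrix_left_invertible_ker invertible_left_inverse by blast
  then have "\<not> surj ((*v) (\<Lambda> (cvec p)))"
    using matrix_right_invertible_surjective invertible_right_inverse by blast
  \<comment> \<open>the kernel at \<open>p\<close> is nontrivial, so the range at \<open>p\<close> is proper\<close>
  then obtain w where w: "\<And>v. \<Lambda> (cvec p) *v v \<noteq> w" by (metis surj_def)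
  have w0: "w \<noteq> 0" using w[of 0] by auto
  define \<Lambda>' where "\<Lambda>' z = (\<chi> a c. \<Lambda> z $ a $ c + (if c = c0 then w $ a else 0))" for z
  have \<Lambda>'v: "\<Lambda>' z *v v = \<Lambda> z *v v + v $ c0 *s w" for z v
    by (simp add: \<Lambda>'_def matrix_vector_mult_def vec_eq_iff distrib_right sum.distrib if_distrib[where f="\<lambda>x. x * _"] cong: if_cong)
  have \<Lambda>'_hol: "hol B (\<lambda>z. \<Lambda>' z $ a $ c)" for a c
    unfolding \<Lambda>'_def by (auto intro!: hol_add \<Lambda>_hol hol_const)
  have "det (\<Lambda>' (cvec p)) \<noteq> 0"
  proof -
    have "v = 0" if v: "\<Lambda>' (cvec p) *v v = 0" for v
    proof -
      have eq: "\<Lambda> (cvec p) *v v = - (v $ c0) *s w"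
        using v \<Lambda>'v[of "cvec p" v] by (simp add: eq_neg_iff_add_eq_0 vector_smult_lneg)
      have v0: "v $ c0 = 0"
      proof (rule ccontr)
        assume nz: "v $ c0 \<noteq> 0"
        have "\<Lambda> (cvec p) *v ((- inverse (v $ c0)) *s v) = (- inverse (v $ c0)) *s (\<Lambda> (cvec p) *v v)"
          by (rule vector_scalar_commute)
        also have "\<dots> = w" unfolding eq vector_smult_assoc using nz by simp
        finally show False using w by blast
      qed
      then have "\<Lambda> (cvec p) *v v = 0" using eq by simp
      then have "v \<in> range (\<lambda>c. c *s k0)" using \<Lambda>ker[OF pp(1)] k0(2) by blast
      then obtain c where "v = c *s k0" by blast
      with v0 c0 show "v = 0" by simp
    qed
    then show ?thesis
      using matrix_left_invertible_ker invertible_left_inverse invertible_det_nz by blast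
  qed
  then obtain V where V: "open V" "cvec p \<in> V" "V \<subseteq> B" and nz: "\<And>z. z \<in> V \<Longrightarrow> det (\<Lambda>' z) \<noteq> 0"
    using hol_nonzero_nbhd[OF hol_det[OF \<Lambda>'_hol] open_ball pp(2)] by blast
  define k where "k z = matrix_inv (\<Lambda>' z) *v w" for z
  have k_hol: "holomorphic_vf V k"
    unfolding k_def
    by (rule hol_matrix_solve(1)[OF hol_subset[OF \<Lambda>'_hol V(3)] _ V(1) nz]) (auto simp: holomorphic_vf_iff intro: hol_const)
  have k_sol: "\<Lambda>' z *v k z = w" if "z \<in> V" for z
    using matrix_inv_inverse(1)[OF nz[OF that]] by (simp add: k_def matrix_vector_mul_assoc)
  have k_nz: "k z \<noteq> 0" if "z \<in> V" for z using k_sol[OF that] w0 by auto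
  obtain r0 where r0: "r0 > 0" "ball (cvec p) r0 \<subseteq> V" using V openE by blast
  define r' where "r' = min r0 r"
  show ?thesis
  proof (rule that[of r' k])
    show "0 < r'" "r' \<le> r" using r r0 by (auto simp: r'_def)
    have sub: "ball (cvec p) r' \<subseteq> V" using r0 by (auto simp: r'_def)
    show "holomorphic_vf (ball (cvec p) r') k" by (rule holomorphic_vf_subset[OF k_hol sub])
    show "k z \<noteq> 0" if "z \<in> ball (cvec p) r'" for z using k_nz sub that by blast
    fix x assume x: "x \<in> ball p r'"
    then have xr: "x \<in> ball p r" by (simp add: r'_def)
    have xV: "cvec x \<in> V" using x sub cvec_in_ball by blast
    obtain kx where kx: "kx \<noteq> 0" "levi_kernel M H x = range (\<lambda>c. c *s kx)" using K1[OF xr] by blast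
    have "kx \<in> levi_kernel M H x" unfolding kx(2) by (rule range_eqI[of _ _ 1]) simp
    then have "\<Lambda>' (cvec x) *v kx = kx $ c0 *s w" using \<Lambda>ker[OF xr] \<Lambda>'v by simp
    then have "matrix_inv (\<Lambda>' (cvec x)) *v (\<Lambda>' (cvec x) *v kx) = kx $ c0 *s k (cvec x)"
      by (simp add: k_def vector_scalar_commute)
    then have kk: "kx = kx $ c0 *s k (cvec x)"
      using matrix_inv_inverse(2)[OF nz[OF xV]] by (simp add: matrix_vector_mul_assoc)
    then have c: "kx $ c0 \<noteq> 0" using kx(1) by (metis vec.scale_zero_left)
    have "range (\<lambda>c. c *s kx) = range (\<lambda>c. c *s k (cvec x))"
    proof (intro equalityI subsetI)
      fix v assume "v \<in> range (\<lambda>c. c *s kx)"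
      then obtain a where "v = a *s kx" by blast
      then have "v = (a * kx $ c0) *s k (cvec x)" using kk by (metis vector_smult_assoc)
      then show "v \<in> range (\<lambda>c. c *s k (cvec x))" by blast
    next
      fix v assume "v \<in> range (\<lambda>c. c *s k (cvec x))"
      then obtain a where a: "v = a *s k (cvec x)" by blast
      have "v = (a / kx $ c0) *s (kx $ c0 *s k (cvec x))" using a c by (simp add: vector_smult_assoc)
      then have "v = (a / kx $ c0) *s kx" using kk by simp
      then show "v \<in> range (\<lambda>c. c *s kx)" by blast
    qed
    then show "levi_kernel M H x = range (\<lambda>c. c *s k (cvec x))" using kx(2) by simp
  qed
qed

end

section \<open>The operators ad\<close>

text \<open>
  The field \<open>k\<close> generates the holomorphic extension of the Levi kernel, its conjugate \<open>kb\<close> that of the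
  conjugate kernel.
\<close>

locale levi_chart = cr_chart n M H p r E \<kappa>
  for n :: nat and M :: "(real^'m) set" and H :: "real^'m \<Rightarrow> (complex^'m) set"
    and p :: "real^'m" and r :: real
    and E :: "nat \<Rightarrow> complex^'m \<Rightarrow> complex^'m"
    and \<kappa> :: "nat \<Rightarrow> complex^'m \<Rightarrow> complex^'m \<Rightarrow> complex" +
  fixes k :: "complex^'m \<Rightarrow> complex^'m"
  assumes k_hol: "holomorphic_vf B k" and k_nz: "z \<in> B \<Longrightarrow> k z \<noteq> 0"
    and K_eq: "x \<in> ball p r \<Longrightarrow> levi_kernel M H x = range (\<lambda>c. c *s k (cvec x))"
begin

definition kb :: "complex^'m \<Rightarrow> complex^'m" where "kb = conj_vf k"

lemma kb_real: "kb (cvec x) = cnjv (k (cvec x))" by (simp add: kb_def conj_vf_def)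

lemma cnjv_B: "z \<in> B \<Longrightarrow> cnjv z \<in> B" using cnjv_ball by blast

lemma kb_hol: "holomorphic_vf B kb"
  unfolding kb_def by (rule holomorphic_conj_vf[OF k_hol cnjv_B])

lemma kb_nz: "z \<in> B \<Longrightarrow> kb z \<noteq> 0"
  unfolding kb_def conj_vf_def using k_nz[OF cnjv_B] by (metis cnjv_cnjv cnjv_simps(3))

lemma conj_K_eq: "x \<in> ball p r \<Longrightarrow> conj_dist (levi_kernel M H) x = range (\<lambda>c. c *s kb (cvec x))"
proof -
  assume x: "x \<in> ball p r"
  have "cnjv (c *s k (cvec x)) = cnj c *s kb (cvec x)" for c by (simp add: cnjv_simps kb_real)
  then have "cnjv ` range (\<lambda>c. c *s k (cvec x)) = range (\<lambda>c. cnj c *s kb (cvec x))" by (simp add: image_image)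
  also have "\<dots> = (\<lambda>c. c *s kb (cvec x)) ` range cnj" by (simp add: image_image)
  also have "range cnj = UNIV" by (metis complex_cnj_cnj surjI)
  finally show ?thesis unfolding conj_dist_def K_eq[OF x] .
qed

lemma k_in_K: "x \<in> ball p r \<Longrightarrow> k (cvec x) \<in> levi_kernel M H x"
  unfolding K_eq by (rule range_eqI[of _ _ 1]) simp

lemma k_Esp: "z \<in> B \<Longrightarrow> k z \<in> Esp {..<n} z"
proof (rule Esp_identity_ball[OF k_hol])
  fix x assume x: "x \<in> ball p r"
  show "k (cvec x) \<in> Esp {..<n} (cvec x)" using k_in_K[OF x] levi_kernel_eq[OF x] by blast
qed

lemma kb_Esp: "z \<in> B \<Longrightarrow> kb z \<in> Esp {n..<2*n} z"
proof (rule Esp_identity_ball[OF kb_hol])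
  fix x assume x: "x \<in> ball p r"
  then have "k (cvec x) \<in> Esp {..<n} (cvec x)" by (intro k_Esp) simp
  from cnjv_Esp(1)[OF x _ this] show "kb (cvec x) \<in> Esp {n..<2*n} (cvec x)"
    by (simp add: kb_real conj_idx_image lessThan_subset_iff)
qed

lemma Esp_imp_Levi: "v \<in> Esp {..<n} z \<Longrightarrow> v \<in> Esp {..<2*n} z" "v \<in> Esp {n..<2*n} z \<Longrightarrow> v \<in> Esp {..<2*n} z"
  by (auto simp: Esp_iff)

lemma frame_in_Levi: "z \<in> B \<Longrightarrow> j < 2*n \<Longrightarrow> E j z \<in> Esp {..<2*n} z"
  by (rule E_in_Esp) auto

lemma \<omega>_hol:
  assumes X: "holomorphic_vf B X" and Y: "holomorphic_vf B Y"
  shows "hol B (\<lambda>z. \<omega> z (X z) (Y z))"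
  unfolding \<omega>_def by (intro hol_sum hol_mult \<kappa>_hol X Y open_ball levi_coeff_hol order_refl) auto

lemma \<omega>_zeroI:
  assumes z: "z \<in> B" and "\<And>j. j < 2*n \<Longrightarrow> \<omega> z u (E j z) = 0" shows "\<omega> z u v = 0"
  using trans[OF \<omega>_expand_right[OF z] sum.neutral] assms(2) by auto

lemma \<omega>_identity:
  assumes X: "holomorphic_vf B X" and re: "\<And>x j. x \<in> ball p r \<Longrightarrow> j < 2*n \<Longrightarrow> \<omega> (cvec x) (X (cvec x)) (E j (cvec x)) = 0"
    and z: "z \<in> B"
  shows "\<omega> z (X z) v = 0"
proof (rule \<omega>_zeroI[OF z])
  fix j assume j: "j < 2*n"
  show "\<omega> z (X z) (E j z) = 0"
    by (rule hol_identity[OF \<omega>_hol[OF X E_hol] _ z]) (use j re in auto)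
qed

text \<open>
  The Levi kernel is in the radical of \<open>\<omega>\<close>; this says that brackets with \<open>k\<close> preserve \<open>H + conj H\<close>.
\<close>

lemma \<omega>_k: "z \<in> B \<Longrightarrow> \<omega> z (k z) v = 0"
proof (rule \<omega>_identity[OF k_hol])
  fix x j assume x: "x \<in> ball p r" and j: "j < 2*n"
  have xB: "cvec x \<in> B" using x by simp
  show "\<omega> (cvec x) (k (cvec x)) (E j (cvec x)) = 0"
  proof (cases "j < n")
    case True
    then have "E j (cvec x) \<in> Esp {..<n} (cvec x)" by (intro E_in_Esp xB) auto
    then show ?thesis by (rule \<omega>_H[OF k_Esp[OF xB] _ xB])
  next
    case False
    then have "E j (cvec x) \<in> Esp {n..<2*n} (cvec x)" using j by (intro E_in_Esp xB) auto
    then show ?thesis using k_in_K[OF x] levi_kernel_eq[OF x] by blast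
  qed
qed

lemma bracket_conj_real:
  assumes X: "holomorphic_vf B X" and Y: "holomorphic_vf B Y" and x: "x \<in> ball p r"
  shows "hol_bracket (conj_vf X) (conj_vf Y) (cvec x) = cnjv (hol_bracket X Y (cvec x))"
  using hol_bracket_conj[OF X Y, of "cvec x"] x by simp

lemma bracket_kb_frame:
  assumes x: "x \<in> ball p r" and j: "j < 2*n"
  shows "hol_bracket kb (E j) (cvec x) = cnjv (hol_bracket k (E (conj_idx j)) (cvec x))"
proof -
  have j': "conj_idx j < 2*n + 1" "conj_idx (conj_idx j) = j" "conj_idx j < 2*n" using conj_idx_simps(3,4) j by (auto simp: less_SucI)
  have "hol_bracket kb (E j) (cvec x) = hol_bracket (conj_vf k) (conj_vf (E (conj_idx j))) (cvec x)"
  proof (rule hol_bracket_cong[OF open_ball])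
    show "cvec x \<in> B" using x by simp
    show "holomorphic_vf B kb" by (rule kb_hol)
    show "holomorphic_vf B (E j)" using j by (intro E_hol) auto
  qed (use j' E_conj_idx[of _ "conj_idx j"] in \<open>auto simp: kb_def\<close>)
  then show ?thesis using bracket_conj_real[OF k_hol E_hol x] j' by simp
qed

lemma cnjv_Levi: "x \<in> ball p r \<Longrightarrow> v \<in> Esp {..<2*n} (cvec x) \<Longrightarrow> cnjv v \<in> Esp {..<2*n} (cvec x)"
  using cnjv_Esp(1)[of x "{..<2*n}" v] by (simp add: conj_idx_image)

lemma bracket_top_zero:
  assumes X: "holomorphic_vf V X" and XW: "\<And>z. z \<in> V \<Longrightarrow> X z \<in> Esp {..<2*n} z"
    and Y: "holomorphic_vf V Y" and YW: "\<And>z. z \<in> V \<Longrightarrow> Y z \<in> Esp {..<2*n} z"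
    and V: "open V" "V \<subseteq> B" "z \<in> V"
  shows "hol_bracket X Y z \<in> Esp {..<2*n} z \<longleftrightarrow> \<omega> z (X z) (Y z) = 0"
proof -
  have t: "\<kappa> (2*n) z (hol_bracket X Y z) = \<omega> z (X z) (Y z)"
    by (rule hol_bracket_top[OF X XW Y YW V])
  show ?thesis by (simp only: Esp_top t)
qed

lemma \<omega>_kb: "z \<in> B \<Longrightarrow> \<omega> z (kb z) v = 0"
proof (rule \<omega>_identity[OF kb_hol])
  fix x j assume x: "x \<in> ball p r" and j: "j < 2*n"
  have xB: "cvec x \<in> B" using x by simp
  have j': "conj_idx j < 2*n" "conj_idx j < 2*n+1" "j < 2*n+1" using conj_idx_simps(4)[OF j] j by auto
  have "hol_bracket k (E (conj_idx j)) (cvec x) \<in> Esp {..<2*n} (cvec x)"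
    by (subst bracket_top_zero[OF k_hol Esp_imp_Levi(1)[OF k_Esp] E_hol[OF j'(2)] frame_in_Levi[OF _ j'(1)] open_ball order_refl xB])
      (auto intro: \<omega>_k xB)
  then have "hol_bracket kb (E j) (cvec x) \<in> Esp {..<2*n} (cvec x)"
    unfolding bracket_kb_frame[OF x j] by (rule cnjv_Levi[OF x])
  then show "\<omega> (cvec x) (kb (cvec x)) (E j (cvec x)) = 0"
    by (subst (asm) bracket_top_zero[OF kb_hol Esp_imp_Levi(2)[OF kb_Esp] E_hol[OF j'(3)] frame_in_Levi[OF _ j] open_ball order_refl xB])
qed

text \<open>
  Most statements come in conjugate pairs: about \<open>k\<close> acting from \<open>conj H\<close> to \<open>H\<close>, and about \<open>kb\<close> acting from \<open>H\<close> to
  \<open>conj H\<close>. In \<open>side q I J\<close> the field \<open>q\<close> acts from the span of \<open>J\<close> to the span of \<open>I\<close>.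
\<close>

definition side :: "(complex^'m \<Rightarrow> complex^'m) \<Rightarrow> nat set \<Rightarrow> nat set \<Rightarrow> bool" where
  "side q I J \<longleftrightarrow> (q = k \<and> I = {..<n} \<and> J = {n..<2*n}) \<or> (q = kb \<and> I = {n..<2*n} \<and> J = {..<n})"

lemma side_k: "side k {..<n} {n..<2*n}" and side_kb: "side kb {n..<2*n} {..<n}"
  by (simp_all add: side_def)

lemma side_sub:
  assumes "side q I J"
  shows "I \<subseteq> {..<2*n}" "J \<subseteq> {..<2*n}" "I \<inter> J = {}" "I \<union> J = {..<2*n}" "I \<subseteq> {..<2*n+1}" "J \<subseteq> {..<2*n+1}"
    "finite I" "finite J" "2*n \<notin> I" "2*n \<notin> J"
  using assms by (auto simp: side_def)

lemma side_vf:
  assumes "side q I J"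
  shows "holomorphic_vf B q" "z \<in> B \<Longrightarrow> q z \<noteq> 0" "z \<in> B \<Longrightarrow> q z \<in> Esp I z" "z \<in> B \<Longrightarrow> \<omega> z (q z) v = 0"
  using assms k_hol kb_hol k_nz kb_nz k_Esp kb_Esp \<omega>_k \<omega>_kb by (auto simp: side_def)

lemma side_isotropic:
  assumes "side q I J" "z \<in> B"
  shows "u \<in> Esp J z \<Longrightarrow> v \<in> Esp J z \<Longrightarrow> \<omega> z u v = 0" "u \<in> Esp I z \<Longrightarrow> v \<in> Esp I z \<Longrightarrow> \<omega> z u v = 0"
  using assms \<omega>_H \<omega>_Hb by (auto simp: side_def)

lemma side_bracket:
  assumes "side q I J" "z \<in> B"
  shows "i \<in> J \<Longrightarrow> j \<in> J \<Longrightarrow> hol_bracket (E i) (E j) z \<in> Esp J z"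
    "i \<in> I \<Longrightarrow> j \<in> I \<Longrightarrow> hol_bracket (E i) (E j) z \<in> Esp I z"
  using assms bracket_H bracket_Hb by (auto simp: side_def)

lemma side_imp_Levi: 
  assumes "side q I J" shows "v \<in> Esp I z \<Longrightarrow> v \<in> Esp {..<2*n} z" "v \<in> Esp J z \<Longrightarrow> v \<in> Esp {..<2*n} z"
  using Esp_mono[OF side_sub(1)[OF assms]] Esp_mono[OF side_sub(2)[OF assms]] by blast+

lemma involutive_Esp:
  assumes I: "I \<subseteq> {..<2*n+1}" and br: "\<And>i j z. i \<in> I \<Longrightarrow> j \<in> I \<Longrightarrow> z \<in> B \<Longrightarrow> hol_bracket (E i) (E j) z \<in> Esp I z"
    and F: "holomorphic_vf V F" and FI: "\<And>z. z \<in> V \<Longrightarrow> F z \<in> Esp I z"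
    and G: "holomorphic_vf V G" and GI: "\<And>z. z \<in> V \<Longrightarrow> G z \<in> Esp I z"
    and V: "open V" "V \<subseteq> B" "z \<in> V"
  shows "hol_bracket F G z \<in> Esp I z"
proof -
  let ?S = "\<Sum>i\<in>I. \<Sum>j\<in>I. (\<kappa> i z (F z) * \<kappa> j z (G z)) *s hol_bracket (E i) (E j) z"
  have "hol_bracket F G z - ?S \<in> Esp (I \<union> I) z"
    by (rule hol_bracket_Esp[OF F FI I G GI I V])
  moreover have "?S \<in> Esp I z" using br V by (intro Esp_simps) auto
  ultimately have "(hol_bracket F G z - ?S) + ?S \<in> Esp I z" by (intro Esp_simps(2)) auto
  then show ?thesis by simp
qed

lemma side_involutive:
  assumes s: "side q I J"
    and F: "holomorphic_vf V F" and FI: "\<And>z. z \<in> V \<Longrightarrow> F z \<in> Esp J z"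
    and G: "holomorphic_vf V G" and GI: "\<And>z. z \<in> V \<Longrightarrow> G z \<in> Esp J z"
    and V: "open V" "V \<subseteq> B" "z \<in> V"
  shows "hol_bracket F G z \<in> Esp J z"
  by (rule involutive_Esp[OF side_sub(6)[OF s] side_bracket(1)[OF s] F FI G GI V])

lemma H_involutive:
  assumes F: "holomorphic_vf V F" and FI: "\<And>z. z \<in> V \<Longrightarrow> F z \<in> Esp {..<n} z"
    and G: "holomorphic_vf V G" and GI: "\<And>z. z \<in> V \<Longrightarrow> G z \<in> Esp {..<n} z"
    and V: "open V" "V \<subseteq> B" "z \<in> V"
  shows "hol_bracket F G z \<in> Esp {..<n} z"
  by (rule side_involutive[OF side_kb F FI G GI V])

lemma kernel_bracket_Levi:
  assumes s: "side q I J" and F: "holomorphic_vf V F" and FW: "\<And>z. z \<in> V \<Longrightarrow> F z \<in> Esp {..<2*n} z"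
    and V: "open V" "V \<subseteq> B" "z \<in> V"
  shows "hol_bracket q F z \<in> Esp {..<2*n} z" "hol_bracket F q z \<in> Esp {..<2*n} z"
proof -
  have zB: "z \<in> B" using V by auto
  have q: "holomorphic_vf V q" using holomorphic_vf_subset[OF side_vf(1)[OF s] V(2)] .
  have qW: "q z \<in> Esp {..<2*n} z" if "z \<in> V" for z using side_imp_Levi(1)[OF s side_vf(3)[OF s]] that V(2) by blast
  show 1: "hol_bracket q F z \<in> Esp {..<2*n} z"
    using bracket_top_zero[OF q qW F FW V] side_vf(4)[OF s zB] by simp
  show "hol_bracket F q z \<in> Esp {..<2*n} z"
    by (subst hol_bracket_antisym) (use 1 in \<open>simp add: Esp_iff \<kappa>_minus\<close>)
qed

definition proj :: "nat set \<Rightarrow> complex^'m \<Rightarrow> complex^'m \<Rightarrow> complex^'m" where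
  "proj I z v = (\<Sum>i\<in>I. \<kappa> i z v *s E i z)"

lemma proj_simps: "proj I z (v + w) = proj I z v + proj I z w" "proj I z (v - w) = proj I z v - proj I z w"
  "proj I z (c *s v) = c *s proj I z v" "proj I z 0 = 0" "proj I z (- v) = - proj I z v"
  by (simp_all add: proj_def \<kappa>_simps sum.distrib sum_subtractf sum_negf vec.scale_sum_right
      vec.scale_left_distrib vec.scale_left_diff_distrib)

lemma proj_Esp: "z \<in> B \<Longrightarrow> I \<subseteq> {..<2*n+1} \<Longrightarrow> proj I z v \<in> Esp I z"
  unfolding proj_def by (rule Esp_lincomb) auto

lemma proj_ident: "z \<in> B \<Longrightarrow> I \<subseteq> {..<2*n+1} \<Longrightarrow> v \<in> Esp I z \<Longrightarrow> proj I z v = v"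
  unfolding proj_def by (rule Esp_expand[symmetric])

lemma proj_eq_0: "I \<subseteq> {..<2*n+1} \<Longrightarrow> I \<inter> J = {} \<Longrightarrow> v \<in> Esp J z \<Longrightarrow> proj I z v = 0"
  unfolding proj_def by (rule sum.neutral) (auto simp: Esp_iff)

lemma proj_split:
  assumes s: "side q I J" and z: "z \<in> B" and v: "v \<in> Esp {..<2*n} z"
  shows "v = proj I z v + proj J z v"
proof -
  have "v = (\<Sum>i\<in>I \<union> J. \<kappa> i z v *s E i z)"
    unfolding side_sub(4)[OF s] by (rule Esp_expand[OF z _ v]) auto
  also have "\<dots> = proj I z v + proj J z v"
    unfolding proj_def by (rule sum.union_disjoint) (use side_sub[OF s] in auto)
  finally show ?thesis .
qed

text \<open>
  A lift of the operator \<open>ad\<^sub>q\<close> from quotients to vectors. It depends only on the coordinates in \<open>J\<close>, so it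
  vanishes on the span of \<open>I\<close>, which realizes the extension by zero to the other summand.
\<close>

definition ad :: "(complex^'m \<Rightarrow> complex^'m) \<Rightarrow> nat set \<Rightarrow> nat set \<Rightarrow> complex^'m \<Rightarrow> complex^'m \<Rightarrow> complex^'m" where
  "ad q I J z y = proj I z (\<Sum>j\<in>J. \<kappa> j z y *s hol_bracket q (E j) z)"

lemma ad_simps: "ad q I J z (y + y') = ad q I J z y + ad q I J z y'" "ad q I J z (c *s y) = c *s ad q I J z y"
   "ad q I J z (y - y') = ad q I J z y - ad q I J z y'"
  by (simp_all add: ad_def proj_simps[symmetric] \<kappa>_simps vec.scale_left_distrib vec.scale_left_diff_distrib sum.distrib
      sum_subtractf vec.scale_sum_right)

lemma ad_Esp: "side q I J \<Longrightarrow> z \<in> B \<Longrightarrow> ad q I J z y \<in> Esp I z"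
  unfolding ad_def using proj_Esp side_sub(5) by blast

lemma ad_frame:
  assumes s: "side q I J" and z: "z \<in> B" and j: "j \<in> J"
  shows "ad q I J z (E j z) = proj I z (hol_bracket q (E j) z)"
proof -
  have "(\<Sum>i\<in>J. \<kappa> i z (E j z) *s hol_bracket q (E i) z) = (\<Sum>i\<in>J. if i = j then hol_bracket q (E i) z else 0)"
    using j side_sub(6)[OF s] z by (intro sum.cong refl) (auto simp: \<kappa>_E subset_iff)
  then show ?thesis using j side_sub(8)[OF s] by (simp add: ad_def)
qed

lemma proj_sum: "proj I z (\<Sum>j\<in>S. f j) = (\<Sum>j\<in>S. proj I z (f j))"
  by (induction S rule: infinite_finite_induct) (simp_all add: proj_simps)

lemma ad_expand:
  assumes s: "side q I J" and z: "z \<in> B"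
  shows "ad q I J z y = (\<Sum>j\<in>J. \<kappa> j z y *s ad q I J z (E j z))"
proof -
  have "ad q I J z y = (\<Sum>j\<in>J. \<kappa> j z y *s proj I z (hol_bracket q (E j) z))"
    by (simp add: ad_def proj_sum proj_simps)
  also have "\<dots> = (\<Sum>j\<in>J. \<kappa> j z y *s ad q I J z (E j z))"
    by (intro sum.cong refl) (simp add: ad_frame[OF s z])
  finally show ?thesis .
qed

text \<open>
  The Jacobi identity for \<open>q\<close>, \<open>E i\<close>, \<open>E j\<close>. As \<open>[E i, E j]\<close> stays in the span of \<open>J\<close> and \<open>q\<close> is in the radical of \<open>\<omega>\<close>, the first
  term has no transversal component.
\<close>

lemma ad_skew_frame:
  assumes s: "side q I J" and z: "z \<in> B" and ij: "i \<in> J" "j \<in> J"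
  shows "\<omega> z (ad q I J z (E i z)) (E j z) + \<omega> z (E i z) (ad q I J z (E j z)) = 0"
proof -
  have lt: "l < 2*n" "l < 2*n+1" if "l \<in> J" for l using side_sub(2)[OF s] that by auto
  have EJ: "E l z \<in> Esp J z" if "l \<in> J" "z \<in> B" for l z using E_in_Esp[OF that(2,1) lt(2)[OF that(1)]] .
  have Eh: "holomorphic_vf B (E l)" if "l \<in> J" for l using E_hol[OF lt(2)[OF that]] .
  note q = side_vf(1)[OF s]
  have qE: "holomorphic_vf B (hol_bracket q (E l))" "z \<in> B \<Longrightarrow> hol_bracket q (E l) z \<in> Esp {..<2*n} z"
    "holomorphic_vf B (hol_bracket (E l) q)" "z \<in> B \<Longrightarrow> hol_bracket (E l) q z \<in> Esp {..<2*n} z" if "l \<in> J" for l z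
    using holomorphic_vf_bracket[OF q Eh[OF that] open_ball] holomorphic_vf_bracket[OF Eh[OF that] q open_ball]
      kernel_bracket_Levi[OF s Eh[OF that] side_imp_Levi(2)[OF s EJ[OF that]] open_ball order_refl] by auto
  have 1: "hol_bracket q (hol_bracket (E i) (E j)) z \<in> Esp {..<2*n} z"
  proof (rule kernel_bracket_Levi(1)[OF s _ _ open_ball order_refl z])
    show "holomorphic_vf B (hol_bracket (E i) (E j))" by (intro holomorphic_vf_bracket Eh ij open_ball)
    show "hol_bracket (E i) (E j) z \<in> Esp {..<2*n} z" if "z \<in> B" for z
      using side_imp_Levi(2)[OF s side_bracket(1)[OF s that ij]] .
  qed
  have t: "\<kappa> (2*n) z (hol_bracket (E a) (hol_bracket q (E b)) z) = \<omega> z (E a z) (hol_bracket q (E b) z)"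
    "\<kappa> (2*n) z (hol_bracket (E a) (hol_bracket (E b) q) z) = \<omega> z (E a z) (hol_bracket (E b) q z)" if ab: "a \<in> J" "b \<in> J" for a b
    using hol_bracket_top[OF Eh[OF ab(1)] side_imp_Levi(2)[OF s EJ[OF ab(1)]] qE(1,2)[OF ab(2)] open_ball order_refl z]
      hol_bracket_top[OF Eh[OF ab(1)] side_imp_Levi(2)[OF s EJ[OF ab(1)]] qE(3,4)[OF ab(2)] open_ball order_refl z] by auto
  have red: "\<omega> z (E a z) (hol_bracket q (E b) z) = \<omega> z (E a z) (ad q I J z (E b z))" if ab: "a \<in> J" "b \<in> J" for a b
  proof -
    have "\<omega> z (E a z) (hol_bracket q (E b) z) = \<omega> z (E a z) (proj I z (hol_bracket q (E b) z) + proj J z (hol_bracket q (E b) z))"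
      by (rule arg_cong[OF proj_split[OF s z qE(2)[OF ab(2) z]]])
    also have "\<dots> = \<omega> z (E a z) (ad q I J z (E b z))"
      unfolding \<omega>_simps ad_frame[OF s z ab(2)]
      using side_isotropic(1)[OF s z EJ[OF ab(1) z] proj_Esp[OF z side_sub(6)[OF s]]] by simp
    finally show ?thesis .
  qed
  have "\<kappa> (2*n) z (hol_bracket q (hol_bracket (E i) (E j)) z + hol_bracket (E i) (hol_bracket (E j) q) z
     + hol_bracket (E j) (hol_bracket q (E i)) z) = 0"
    by (subst jacobi[OF q Eh[OF ij(1)] Eh[OF ij(2)] open_ball z]) simp
  then have "\<omega> z (E i z) (hol_bracket (E j) q z) + \<omega> z (E j z) (hol_bracket q (E i) z) = 0"
    using 1 t ij by (simp add: \<kappa>_simps Esp_top)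
  moreover have "\<omega> z (E i z) (hol_bracket (E j) q z) = - \<omega> z (E i z) (hol_bracket q (E j) z)"
    using hol_bracket_antisym[of "E j" q z] \<omega>_simps(4)[of z "E i z" "-1" "hol_bracket q (E j) z"]
    by (simp add: vector_sneg_minus1[symmetric])
  ultimately have "\<omega> z (E j z) (ad q I J z (E i z)) = \<omega> z (E i z) (ad q I J z (E j z))"
    using red ij by simp
  then show ?thesis using \<omega>_antisym[of z "ad q I J z (E i z)" "E j z"] by simp
qed

lemma \<omega>_sum: "\<omega> z (\<Sum>j\<in>S. f j) v = (\<Sum>j\<in>S. \<omega> z (f j) v)" "\<omega> z v (\<Sum>j\<in>S. f j) = (\<Sum>j\<in>S. \<omega> z v (f j))"
  by (induction S rule: infinite_finite_induct; simp add: \<omega>_simps \<omega>_zero)+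

text \<open>
  In other words, \<open>ad\<close> belongs to the symplectic Lie algebra of \<open>\<omega>\<close>.
\<close>

lemma ad_skew:
  assumes s: "side q I J" and z: "z \<in> B" and y: "y \<in> Esp J z" "y' \<in> Esp J z"
  shows "\<omega> z (ad q I J z y) y' + \<omega> z y (ad q I J z y') = 0"
proof -
  let ?c = "\<lambda>j. \<kappa> j z y" and ?d = "\<lambda>j. \<kappa> j z y'" and ?A = "\<lambda>j. ad q I J z (E j z)"
  have y1: "y = (\<Sum>j\<in>J. ?c j *s E j z)" and y2: "y' = (\<Sum>j\<in>J. ?d j *s E j z)"
    by (rule Esp_expand[OF z side_sub(6)[OF s] y(1)], rule Esp_expand[OF z side_sub(6)[OF s] y(2)])
  have "\<omega> z (ad q I J z y) y' = \<omega> z (\<Sum>i\<in>J. ?c i *s ?A i) (\<Sum>j\<in>J. ?d j *s E j z)"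
    by (rule arg_cong2[OF ad_expand[OF s z] y2])
  also have "\<dots> = (\<Sum>i\<in>J. \<Sum>j\<in>J. ?c i * ?d j * \<omega> z (?A i) (E j z))"
    by (subst sum.swap) (simp add: \<omega>_sum \<omega>_simps sum_distrib_left mult_ac)
  finally have 1: "\<omega> z (ad q I J z y) y' = (\<Sum>i\<in>J. \<Sum>j\<in>J. ?c i * ?d j * \<omega> z (?A i) (E j z))" .
  have "\<omega> z y (ad q I J z y') = \<omega> z (\<Sum>i\<in>J. ?c i *s E i z) (\<Sum>j\<in>J. ?d j *s ?A j)"
    by (rule arg_cong2[OF y1 ad_expand[OF s z]])
  also have "\<dots> = (\<Sum>i\<in>J. \<Sum>j\<in>J. ?c i * ?d j * \<omega> z (E i z) (?A j))"
    by (subst sum.swap) (simp add: \<omega>_sum \<omega>_simps sum_distrib_left mult_ac)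
  finally have 2: "\<omega> z y (ad q I J z y') = (\<Sum>i\<in>J. \<Sum>j\<in>J. ?c i * ?d j * \<omega> z (E i z) (?A j))" .
  have "\<omega> z (ad q I J z y) y' + \<omega> z y (ad q I J z y')
    = (\<Sum>i\<in>J. \<Sum>j\<in>J. ?c i * ?d j * (\<omega> z (?A i) (E j z) + \<omega> z (E i z) (?A j)))"
    unfolding 1 2 by (simp add: sum.distrib[symmetric] distrib_left)
  also have "\<dots> = 0"
    by (intro sum.neutral ballI) (simp add: ad_skew_frame[OF s z])
  finally show ?thesis .
qed

end

section \<open>The operators ad computed with sections\<close>

context levi_chart
begin

text \<open>
  Tensoriality of \<open>ad\<close> in both arguments. The derivative of the coefficient \<open>\<phi>\<close> only contributes a multiple
  of \<open>q\<close>.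
\<close>

lemma ad_bracket:
  assumes s: "side q I J" and \<phi>: "hol V \<phi>" and Fq: "\<And>z. z \<in> V \<Longrightarrow> F z = \<phi> z *s q z"
    and G: "holomorphic_vf V G" and GJ: "\<And>z. z \<in> V \<Longrightarrow> G z \<in> Esp J z"
    and V: "open V" "V \<subseteq> B" "z \<in> V"
  obtains c where "proj I z (hol_bracket F G z) = \<phi> z *s ad q I J z (G z) - c *s q z"
    "hol_bracket F G z \<in> Esp {..<2*n} z"
proof -
  have zB: "z \<in> B" using V by auto
  have lt: "l < 2*n" "l < 2*n+1" if "l \<in> J" for l using side_sub(2)[OF s] that by auto
  have Eh: "holomorphic_vf V (E l)" if "l \<in> J" for l
    using holomorphic_vf_subset[OF E_hol[OF lt(2)[OF that]] V(2)] .
  have qh: "holomorphic_vf V q" by (rule holomorphic_vf_subset[OF side_vf(1)[OF s] V(2)])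
  let ?T = "\<Sum>j\<in>J. fd (\<lambda>z. \<kappa> j z (G z)) z (F z) *s E j z"
  let ?S = "\<Sum>j\<in>J. \<kappa> j z (G z) *s hol_bracket q (E j) z"
  let ?c = "fd \<phi> z (G z)"
  have "hol_bracket F G z = (\<Sum>i\<in>{0::nat}. \<Sum>j\<in>J. (\<phi> z * \<kappa> j z (G z)) *s hol_bracket q (E j) z)
     + ?T - (\<Sum>i\<in>{0::nat}. ?c *s q z)"
  proof (rule hol_bracket_lincomb[where V=V])
    show "F z = (\<Sum>i\<in>{0::nat}. \<phi> z *s q z)" if "z \<in> V" for z using Fq[OF that] by simp
    show "G z = (\<Sum>j\<in>J. \<kappa> j z (G z) *s E j z)" if "z \<in> V" for z
      by (rule Esp_expand[OF _ side_sub(6)[OF s] GJ[OF that]]) (use that V in auto)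
    show "hol V (\<lambda>z. \<kappa> j z (G z))" for j by (rule \<kappa>_hol[OF G V(1,2)])
  qed (rule qh \<phi> Eh V; assumption?)+
  then have eq: "hol_bracket F G z = \<phi> z *s ?S + ?T - ?c *s q z"
    by (simp add: vec.scale_sum_right)
  have T: "?T \<in> Esp J z" by (rule Esp_lincomb[OF zB side_sub(6)[OF s] order_refl])
  have "proj I z (hol_bracket F G z) = \<phi> z *s ad q I J z (G z) - ?c *s q z"
    unfolding eq proj_simps ad_def proj_eq_0[OF side_sub(5,3)[OF s] T]
      proj_ident[OF zB side_sub(5)[OF s] side_vf(3)[OF s zB]] by simp
  moreover have "hol_bracket F G z \<in> Esp {..<2*n} z"
    unfolding eq
  proof (intro Esp_simps(2-5))
    show "hol_bracket q (E j) z \<in> Esp {..<2*n} z" if "j \<in> J" for j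
      by (rule kernel_bracket_Levi(1)[OF s E_hol[OF lt(2)[OF that]] frame_in_Levi[OF _ lt(1)[OF that]] open_ball order_refl zB])
    show "E j z \<in> Esp {..<2*n} z" if "j \<in> J" for j by (rule frame_in_Levi[OF zB lt(1)[OF that]])
    show "q z \<in> Esp {..<2*n} z" by (rule side_imp_Levi(1)[OF s side_vf(3)[OF s zB]])
  qed
  ultimately show ?thesis using that by blast
qed

lemma inj_conj_idx: "I \<subseteq> {..<2*n} \<Longrightarrow> inj_on conj_idx I"
  by (rule inj_on_inverseI[of _ conj_idx]) (use conj_idx_simps(3) in auto)

lemma proj_cnjv:
  assumes x: "x \<in> ball p r" and I: "I \<subseteq> {..<2*n}" and v: "v \<in> Esp {..<2*n} (cvec x)"
  shows "proj (conj_idx ` I) (cvec x) (cnjv v) = cnjv (proj I (cvec x) v)"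
proof -
  have "proj (conj_idx ` I) (cvec x) (cnjv v) = (\<Sum>i\<in>I. \<kappa> (conj_idx i) (cvec x) (cnjv v) *s E (conj_idx i) (cvec x))"
    unfolding proj_def by (simp add: sum.reindex[OF inj_conj_idx[OF I]])
  also have "\<dots> = (\<Sum>i\<in>I. cnjv (\<kappa> i (cvec x) v *s E i (cvec x)))"
  proof (intro sum.cong refl)
    fix i assume "i \<in> I"
    then have i: "i < 2*n" using I by auto
    have "\<kappa> (conj_idx i) (cvec x) (cnjv v) = cnj (\<kappa> (conj_idx (conj_idx i)) (cvec x) v)"
      by (rule cnjv_Esp(2)[OF x order_refl v conj_idx_simps(4)[OF i]])
    then show "\<kappa> (conj_idx i) (cvec x) (cnjv v) *s E (conj_idx i) (cvec x) = cnjv (\<kappa> i (cvec x) v *s E i (cvec x))"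
      by (simp add: cnjv_simps E_conj_idx_real[OF x i] conj_idx_simps(3)[OF i])
  qed
  finally show ?thesis by (simp add: proj_def cnjv_sum)
qed

lemma ad_conj:
  assumes x: "x \<in> ball p r" and y: "y \<in> Esp {n..<2*n} (cvec x)"
  shows "ad kb {n..<2*n} {..<n} (cvec x) (cnjv y) = cnjv (ad k {..<n} {n..<2*n} (cvec x) y)"
proof -
  have xB: "cvec x \<in> B" using x by simp
  have sub: "{n..<2*n} \<subseteq> {..<2*n}" "{..<n} \<subseteq> {..<2*n}" by auto
  let ?v = "\<Sum>j\<in>{n..<2*n}. \<kappa> j (cvec x) y *s hol_bracket k (E j) (cvec x)"
  have "(\<Sum>j<n. \<kappa> j (cvec x) (cnjv y) *s hol_bracket kb (E j) (cvec x))
      = (\<Sum>j\<in>conj_idx ` {n..<2*n}. \<kappa> j (cvec x) (cnjv y) *s hol_bracket kb (E j) (cvec x))"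
    by (simp only: conj_idx_image)
  also have "\<dots> = (\<Sum>j\<in>{n..<2*n}. \<kappa> (conj_idx j) (cvec x) (cnjv y) *s hol_bracket kb (E (conj_idx j)) (cvec x))"
    by (simp add: sum.reindex[OF inj_conj_idx[OF sub(1)]])
  also have "\<dots> = (\<Sum>j\<in>{n..<2*n}. cnjv (\<kappa> j (cvec x) y *s hol_bracket k (E j) (cvec x)))"
  proof (intro sum.cong refl)
    fix j assume "j \<in> {n..<2*n}"
    then have j: "j < 2*n" by auto
    have "\<kappa> (conj_idx j) (cvec x) (cnjv y) = cnj (\<kappa> (conj_idx (conj_idx j)) (cvec x) y)"
      by (rule cnjv_Esp(2)[OF x sub(1) y conj_idx_simps(4)[OF j]])
    then show "\<kappa> (conj_idx j) (cvec x) (cnjv y) *s hol_bracket kb (E (conj_idx j)) (cvec x)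
       = cnjv (\<kappa> j (cvec x) y *s hol_bracket k (E j) (cvec x))"
      by (simp add: cnjv_simps bracket_kb_frame[OF x conj_idx_simps(4)[OF j]] conj_idx_simps(3)[OF j])
  qed
  finally have eq: "(\<Sum>j<n. \<kappa> j (cvec x) (cnjv y) *s hol_bracket kb (E j) (cvec x)) = cnjv ?v"
    by (simp add: cnjv_sum)
  have v: "?v \<in> Esp {..<2*n} (cvec x)"
  proof (intro Esp_simps(4,5))
    fix j assume "j \<in> {n..<2*n}"
    then have j: "j < 2*n" "j < 2*n+1" by auto
    show "hol_bracket k (E j) (cvec x) \<in> Esp {..<2*n} (cvec x)"
      by (rule kernel_bracket_Levi(1)[OF side_k E_hol[OF j(2)] frame_in_Levi[OF _ j(1)] open_ball order_refl xB])
  qed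
  show ?thesis unfolding ad_def eq using proj_cnjv[OF x sub(2) v] by (simp add: conj_idx_image)
qed

text \<open>
  The Jacobi identity for \<open>k\<close>, \<open>kb\<close> and a field in \<open>H + conj H\<close> shows that \<open>[k, kb]\<close> is in the radical of \<open>\<omega>\<close>, so its
  \<open>H\<close>-component is in the Levi kernel: \<open>K + conj K\<close> is involutive.
\<close>

lemma proj_bracket_k_kb:
  assumes x: "x \<in> ball p r"
  shows "proj {..<n} (cvec x) (hol_bracket k kb (cvec x)) \<in> range (\<lambda>c. c *s k (cvec x))"
proof -
  let ?z = "cvec x" let ?u = "hol_bracket k kb (cvec x)"
  have z: "?z \<in> B" using x by simp
  have kW: "k z \<in> Esp {..<2*n} z" "kb z \<in> Esp {..<2*n} z" if "z \<in> B" for z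
    using Esp_imp_Levi k_Esp kb_Esp that by blast+
  have u: "?u \<in> Esp {..<2*n} ?z" by (rule kernel_bracket_Levi(1)[OF side_k kb_hol kW(2) open_ball order_refl z])
  have u0: "\<omega> ?z ?u v = 0" for v
  proof (rule \<omega>_zeroI[OF z])
    fix j assume j: "j < 2*n"
    then have Eh: "holomorphic_vf B (E j)" by (intro E_hol) auto
    note EW = frame_in_Levi[OF _ j]
    have 1: "hol_bracket k (hol_bracket kb (E j)) ?z \<in> Esp {..<2*n} ?z"
      by (rule kernel_bracket_Levi(1)[OF side_k holomorphic_vf_bracket[OF kb_hol Eh open_ball]
            kernel_bracket_Levi(1)[OF side_kb Eh EW open_ball order_refl] open_ball order_refl z])
    have 2: "hol_bracket kb (hol_bracket (E j) k) ?z \<in> Esp {..<2*n} ?z"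
      by (rule kernel_bracket_Levi(1)[OF side_kb holomorphic_vf_bracket[OF Eh k_hol open_ball]
            kernel_bracket_Levi(2)[OF side_k Eh EW open_ball order_refl] open_ball order_refl z])
    have 3: "\<kappa> (2*n) ?z (hol_bracket (E j) (hol_bracket k kb) ?z) = \<omega> ?z (E j ?z) ?u"
      by (rule hol_bracket_top[OF Eh EW holomorphic_vf_bracket[OF k_hol kb_hol open_ball]
            kernel_bracket_Levi(1)[OF side_k kb_hol kW(2) open_ball order_refl] open_ball order_refl z])
    have "\<kappa> (2*n) ?z (hol_bracket k (hol_bracket kb (E j)) ?z + hol_bracket kb (hol_bracket (E j) k) ?z
      + hol_bracket (E j) (hol_bracket k kb) ?z) = 0"
      by (subst jacobi[OF k_hol kb_hol Eh open_ball z]) simp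
    then have "\<omega> ?z (E j ?z) ?u = 0" using 1 2 3 by (simp add: \<kappa>_simps Esp_top)
    then show "\<omega> ?z ?u (E j ?z) = 0" using \<omega>_antisym[of ?z ?u "E j ?z"] by simp
  qed
  let ?a = "proj {..<n} ?z ?u" and ?b = "proj {n..<2*n} ?z ?u"
  have a: "?a \<in> Esp {..<n} ?z" by (rule proj_Esp[OF z]) auto
  have b: "?b \<in> Esp {n..<2*n} ?z" by (rule proj_Esp[OF z]) auto
  have "\<omega> ?z ?a v = 0" if v: "v \<in> Esp {n..<2*n} ?z" for v
  proof -
    have "0 = \<omega> ?z (?a + ?b) v"
      using arg_cong[OF proj_split[OF side_k z u], of "\<lambda>u. \<omega> ?z u v"] u0[of v] by simp
    then show ?thesis using \<omega>_Hb[OF b v z] by (simp add: \<omega>_simps)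
  qed
  then have "?a \<in> levi_kernel M H x" using a levi_kernel_eq[OF x] by blast
  then show ?thesis using K_eq[OF x] by simp
qed

text \<open>
  As \<open>side\<close>, with the conjugate field \<open>q'\<close>, which acts in the opposite direction, made explicit.
\<close>

definition sides where
  "sides q q' I J \<longleftrightarrow> (q = k \<and> q' = kb \<and> I = {..<n} \<and> J = {n..<2*n}) \<or> (q = kb \<and> q' = k \<and> I = {n..<2*n} \<and> J = {..<n})"

lemma sides_side: "sides q q' I J \<Longrightarrow> side q I J" "sides q q' I J \<Longrightarrow> side q' J I"
  by (auto simp: sides_def side_def)

lemma ad_k_of_kb:
  assumes x: "x \<in> ball p r"
  shows "ad k {..<n} {n..<2*n} (cvec x) (kb (cvec x)) \<in> range (\<lambda>c. c *s k (cvec x))"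
proof -
  have z: "cvec x \<in> B" using x by simp
  obtain c where c: "proj {..<n} (cvec x) (hol_bracket k kb (cvec x)) = 1 *s ad k {..<n} {n..<2*n} (cvec x) (kb (cvec x)) - c *s k (cvec x)"
    by (rule ad_bracket[OF side_k hol_const[of B 1] _ kb_hol kb_Esp open_ball order_refl z, of k]) auto
  obtain d where d: "proj {..<n} (cvec x) (hol_bracket k kb (cvec x)) = d *s k (cvec x)"
    using proj_bracket_k_kb[OF x] by blast
  have "ad k {..<n} {n..<2*n} (cvec x) (kb (cvec x)) = d *s k (cvec x) + c *s k (cvec x)"
    using c d by (simp add: eq_diff_eq)
  also have "\<dots> = (d + c) *s k (cvec x)" by (rule vec.scale_left_distrib[symmetric])
  finally show ?thesis by (rule range_eqI)
qed

text \<open>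
  Hence \<open>ad\<close> maps \<open>K + conj K\<close> to itself and is well defined on the quotient by this sum.
\<close>

lemma ad_partner:
  assumes s: "sides q q' I J" and x: "x \<in> ball p r"
  shows "ad q I J (cvec x) (q' (cvec x)) \<in> range (\<lambda>c. c *s q (cvec x))"
  using s unfolding sides_def
proof (elim disjE conjE)
  assume eq: "q = kb" "q' = k" "I = {n..<2*n}" "J = {..<n}"
  obtain d where d: "ad k {..<n} {n..<2*n} (cvec x) (kb (cvec x)) = d *s k (cvec x)"
    using ad_k_of_kb[OF x] by blast
  have "ad kb {n..<2*n} {..<n} (cvec x) (cnjv (kb (cvec x))) = cnjv (d *s k (cvec x))"
    unfolding d[symmetric] by (rule ad_conj[OF x kb_Esp]) (use x in simp)
  then have "ad kb {n..<2*n} {..<n} (cvec x) (k (cvec x)) = cnj d *s kb (cvec x)"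
    by (simp add: kb_real cnjv_simps)
  then show ?thesis unfolding eq by (rule range_eqI)
qed (use ad_k_of_kb[OF x] in simp)

text \<open>
  A section of a line distribution is a multiple of the generator with holomorphic coefficient \<open>\<phi>\<close>, the
  quotient of the coordinates at an index where the generator does not vanish.
\<close>

lemma line_section_extension:
  assumes V: "V \<in> sections_at M D x" and x: "x \<in> ball p r" and s: "side q I J"
    and D: "\<And>y. y \<in> ball p r \<Longrightarrow> D y = range (\<lambda>c. c *s q (cvec y))"
  obtains \<delta> F \<phi> where "\<delta> > 0" "ball (cvec x) \<delta> \<subseteq> B" "holomorphic_vf (ball (cvec x) \<delta>) F"
    "\<And>y. y \<in> ball x \<delta> \<Longrightarrow> V y = F (cvec y)" "hol (ball (cvec x) \<delta>) \<phi>"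
    "\<And>z. z \<in> ball (cvec x) \<delta> \<Longrightarrow> F z = \<phi> z *s q z"
proof -
  have z: "cvec x \<in> B" using x by simp
  obtain d F where F: "d > 0" "ball (cvec x) d \<subseteq> B" "holomorphic_vf (ball (cvec x) d) F"
    "\<And>y. y \<in> ball x d \<Longrightarrow> V y = F (cvec y) \<and> F (cvec y) \<in> D y \<and> y \<in> ball p r"
    by (rule section_extension[OF V x], rule that, assumption+)
  obtain i where i: "\<kappa> i (cvec x) (q (cvec x)) \<noteq> 0"
  proof -
    have "\<exists>i. \<kappa> i (cvec x) (q (cvec x)) \<noteq> 0"
    proof (rule ccontr)
      assume "\<not> ?thesis"
      then have "(\<Sum>i<2*n+1. \<kappa> i (cvec x) (q (cvec x)) *s E i (cvec x)) = 0" by simp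
      then show False using \<kappa>_sum[OF z] side_vf(2)[OF s z] by simp
    qed
    then show ?thesis using that by blast
  qed
  have hq: "hol B (\<lambda>z. \<kappa> i z (q z))" by (rule \<kappa>_hol[OF side_vf(1)[OF s] open_ball order_refl])
  obtain U where U: "open U" "cvec x \<in> U" "U \<subseteq> B" "\<And>z. z \<in> U \<Longrightarrow> \<kappa> i z (q z) \<noteq> 0"
    using hol_nonzero_nbhd[OF hq open_ball z i] by blast
  obtain e where e: "e > 0" "ball (cvec x) e \<subseteq> U" using U openE by blast
  let ?\<delta> = "min d e" let ?b = "ball (cvec x) ?\<delta>"
  have sub: "?b \<subseteq> B" "?b \<subseteq> U" "?b \<subseteq> ball (cvec x) d" using F(2) e by auto
  have F': "holomorphic_vf ?b F" by (rule holomorphic_vf_subset[OF F(3) sub(3)])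
  define \<phi> where "\<phi> z = \<kappa> i z (F z) / \<kappa> i z (q z)" for z
  have \<phi>: "hol ?b \<phi>"
    unfolding \<phi>_def by (rule hol_divide[OF \<kappa>_hol[OF F' open_ball sub(1)] hol_subset[OF hq sub(1)]]) (use U(4) sub(2) in blast)
  have qh: "holomorphic_vf ?b q" by (rule holomorphic_vf_subset[OF side_vf(1)[OF s] sub(1)])
  show ?thesis
  proof (rule that[of ?\<delta> F \<phi>])
    show "?\<delta> > 0" using F e by simp
    show "V y = F (cvec y)" if "y \<in> ball x ?\<delta>" for y using F(4)[of y] that by simp
    fix z assume zb: "z \<in> ?b"
    show "F z = \<phi> z *s q z"
      unfolding vec_eq_iff
    proof
      fix a
      have h: "hol ?b (\<lambda>z. F z $ a - \<phi> z * q z $ a)"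
        using F' qh \<phi> by (auto simp: holomorphic_vf_iff intro!: hol_diff hol_mult)
      have "F z $ a - \<phi> z * q z $ a = 0"
      proof (rule hol_identity[OF h _ zb])
        fix y assume y: "y \<in> ball x ?\<delta>"
        then have "y \<in> ball x d" by simp
        then have "F (cvec y) \<in> D y" "y \<in> ball p r" using F(4) by blast+
        then obtain c where c: "F (cvec y) = c *s q (cvec y)" using D by blast
        have "cvec y \<in> ?b" using y cvec_in_ball by blast
        then have "\<kappa> i (cvec y) (q (cvec y)) \<noteq> 0" using U(4) sub(2) by blast
        then have "\<phi> (cvec y) = c" by (simp add: \<phi>_def c \<kappa>_scale)
        then show "F (cvec y) $ a - \<phi> (cvec y) * q (cvec y) $ a = 0" by (simp add: c)
      qed
      then show "F z $ a = (\<phi> z *s q z) $ a" by simp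
    qed
  qed (rule sub F' \<phi>)+
qed

lemma bracket_line_section:
  assumes V: "V \<in> sections_at M KA x" and x: "x \<in> ball p r" and s: "side q I J"
    and KA: "\<And>y. y \<in> ball p r \<Longrightarrow> KA y = range (\<lambda>c. c *s q (cvec y))"
    and Y: "Y \<in> sections_at M Bd x" and Bd: "\<And>y. y \<in> ball p r \<Longrightarrow> Bd y = Esp J (cvec y)"
    and v: "V x = t *s q (cvec x)"
  obtains c where "proj I (cvec x) (bracket V Y x) = t *s ad q I J (cvec x) (Y x) - c *s q (cvec x)"
    "bracket V Y x \<in> Esp {..<2*n} (cvec x)"
proof -
  have z: "cvec x \<in> B" using x by simp
  obtain d F \<phi> where F: "d > 0" "ball (cvec x) d \<subseteq> B" "holomorphic_vf (ball (cvec x) d) F"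
    "\<And>y. y \<in> ball x d \<Longrightarrow> V y = F (cvec y)" "hol (ball (cvec x) d) \<phi>"
    "\<And>z. z \<in> ball (cvec x) d \<Longrightarrow> F z = \<phi> z *s q z"
    by (rule line_section_extension[OF V x s KA], assumption, rule that, assumption+)
  obtain e G where G: "e > 0" "ball (cvec x) e \<subseteq> B" "holomorphic_vf (ball (cvec x) e) G"
    "\<And>y. y \<in> ball x e \<Longrightarrow> Y y = G (cvec y)" "\<And>z. z \<in> ball (cvec x) e \<Longrightarrow> G z \<in> Esp J z"
    by (rule section_extension_Esp[OF Y x Bd], assumption, rule that, assumption+)
  let ?V = "ball (cvec x) (min d e)"
  have sub: "?V \<subseteq> ball (cvec x) d" "?V \<subseteq> ball (cvec x) e" "?V \<subseteq> B" using F(2) by auto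
  have F': "holomorphic_vf ?V F" by (rule holomorphic_vf_subset[OF F(3) sub(1)])
  have G': "holomorphic_vf ?V G" by (rule holomorphic_vf_subset[OF G(3) sub(2)])
  have pos: "min d e > 0" using F(1) G(1) by simp
  have VF: "V y = F (cvec y)" and YG: "Y y = G (cvec y)" if "y \<in> ball x (min d e)" for y
    using that F(4) G(4) by auto
  have br: "bracket V Y x = hol_bracket F G (cvec x)"
    by (rule bracket_eq_hol_bracket[OF F' pos VF G' YG])
  have xV: "cvec x \<in> ?V" using pos by simp
  have Fq: "F z = \<phi> z *s q z" and GJ: "G z \<in> Esp J z" if "z \<in> ?V" for z
    using that F(6) G(5) sub by blast+
  have Y0: "Y x = G (cvec x)" using YG[of x] pos by simp
  have "F (cvec x) = t *s q (cvec x)" using VF[of x] v pos by simp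
  then have "(\<phi> (cvec x) - t) *s q (cvec x) = 0" using Fq[OF xV] by (simp add: vec.scale_left_diff_distrib)
  then have \<phi>t: "\<phi> (cvec x) = t" using side_vf(2)[OF s z] by simp
  show ?thesis
    by (rule ad_bracket[OF s hol_subset[OF F(5) sub(1)] Fq G' GJ open_ball sub(3) xV])
      (assumption, assumption, rule that, simp only: br \<phi>t Y0, simp only: br)
qed

text \<open>
  Whatever sections are used to compute it, a value of the operator \<open>ad_op\<close> is given by \<open>ad\<close> up to a multiple of \<open>q\<close>.
\<close>

lemma ad_op_elim:
  assumes s: "sides q q' I J" and x: "x \<in> ball p r"
    and A: "\<And>y. y \<in> ball p r \<Longrightarrow> A y = Esp I (cvec y)" and KA: "\<And>y. y \<in> ball p r \<Longrightarrow> KA y = range (\<lambda>c. c *s q (cvec y))"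
    and Bd: "\<And>y. y \<in> ball p r \<Longrightarrow> Bd y = Esp J (cvec y)" and KB: "\<And>y. y \<in> ball p r \<Longrightarrow> KB y = range (\<lambda>c. c *s q' (cvec y))"
    and w: "w \<in> ad_op M A KA Bd KB x (t *s q (cvec x)) y"
  obtains c V where "w = t *s ad q I J (cvec x) y + c *s q (cvec x)" "V \<in> sections_at M KA x" "V x = t *s q (cvec x)"
proof -
  note s1 = sides_side(1)[OF s]
  let ?z = "cvec x"
  have z: "?z \<in> B" using x by simp
  obtain V Y where wA: "w \<in> A x" and V: "V \<in> sections_at M KA x" "V x = t *s q ?z" and Y: "Y \<in> sections_at M Bd x"
    and Yy: "Y x - y \<in> KB x" and wV: "w - bracket V Y x \<in> KA x + Bd x"
    using w unfolding ad_op_def mem_Collect_eq by (elim conjE bexE)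
  obtain c where c: "proj I ?z (bracket V Y x) = t *s ad q I J ?z (Y x) - c *s q ?z"
    by (rule bracket_line_section[OF V(1) x s1 KA Y Bd V(2)], assumption, assumption, rule that, assumption)
  obtain b where b: "Y x - y = b *s q' ?z" using Yy KB[OF x] by blast
  obtain e where e: "ad q I J ?z (q' ?z) = e *s q ?z" using ad_partner[OF s x] by blast
  have Yx: "ad q I J ?z (Y x) = ad q I J ?z y + (b * e) *s q ?z"
  proof -
    have "Y x = y + b *s q' ?z" using b by (simp add: algebra_simps)
    then show ?thesis by (simp add: ad_simps e vector_smult_assoc)
  qed
  obtain f v where f: "w - bracket V Y x = f *s q ?z + v" and v: "v \<in> Esp J ?z"
    using wV unfolding KA[OF x] Bd[OF x] by (elim set_plus_elim) blast
  have w1: "w = proj I ?z w" using proj_ident[OF z side_sub(5)[OF s1], of w] wA A[OF x] by simp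
  have "proj I ?z w - proj I ?z (bracket V Y x) = f *s q ?z"
    unfolding proj_simps(2)[symmetric] f proj_simps proj_eq_0[OF side_sub(5,3)[OF s1] v]
      proj_ident[OF z side_sub(5)[OF s1] side_vf(3)[OF s1 z]] by simp
  then have "w = f *s q ?z + (t *s (ad q I J ?z y + (b * e) *s q ?z) - c *s q ?z)"
    using w1 c Yx by (metis diff_add_cancel)
  also have "\<dots> = t *s ad q I J ?z y + (f + t * (b * e) - c) *s q ?z"
    by (simp add: vec.scale_right_distrib vec.scale_left_distrib vec.scale_left_diff_distrib vector_smult_assoc)
  finally show ?thesis using that V by blast
qed

lemma ad_op_intro:
  assumes s: "sides q q' I J" and x: "x \<in> ball p r"
    and A: "\<And>y. y \<in> ball p r \<Longrightarrow> A y = Esp I (cvec y)" and KA: "\<And>y. y \<in> ball p r \<Longrightarrow> KA y = range (\<lambda>c. c *s q (cvec y))"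
    and Bd: "\<And>y. y \<in> ball p r \<Longrightarrow> Bd y = Esp J (cvec y)" and KB: "\<And>y. y \<in> ball p r \<Longrightarrow> KB y = range (\<lambda>c. c *s q' (cvec y))"
    and V: "V \<in> sections_at M KA x" "V x = t *s q (cvec x)" and y: "y \<in> Esp J (cvec x)"
  shows "t *s ad q I J (cvec x) y + c *s q (cvec x) \<in> ad_op M A KA Bd KB x (t *s q (cvec x)) y"
proof -
  note s1 = sides_side(1)[OF s]
  let ?z = "cvec x"
  have z: "?z \<in> B" using x by simp
  obtain Y where Y: "Y \<in> sections_at M Bd x" "Y x = y"
    by (rule constant_section[OF x side_sub(2)[OF s1] y Bd], assumption, rule that, assumption+)
  obtain d where d: "proj I ?z (bracket V Y x) = t *s ad q I J ?z (Y x) - d *s q ?z"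
    and W: "bracket V Y x \<in> Esp {..<2*n} ?z"
    by (rule bracket_line_section[OF V(1) x s1 KA Y(1) Bd V(2)], assumption, assumption, rule that, assumption+)
  let ?w = "t *s ad q I J ?z y + c *s q ?z"
  have "?w - bracket V Y x = ?w - (proj I ?z (bracket V Y x) + proj J ?z (bracket V Y x))"
    by (rule arg_cong[OF proj_split[OF s1 z W]])
  also have "\<dots> = (c + d) *s q ?z + proj J ?z (- bracket V Y x)"
    unfolding d Y(2) by (simp add: vec.scale_left_distrib proj_simps)
  also have "\<dots> \<in> KA x + Bd x"
    unfolding KA[OF x] Bd[OF x] by (rule set_plus_intro[OF rangeI proj_Esp[OF z side_sub(6)[OF s1]]])
  finally have 1: "?w - bracket V Y x \<in> KA x + Bd x" .
  have "?w \<in> A x" unfolding A[OF x]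
    by (intro Esp_simps ad_Esp[OF s1 z] side_vf(3)[OF s1 z])
  moreover have "Y x - y \<in> KB x" unfolding KB[OF x] Y(2) by (rule range_eqI[of _ _ 0]) simp
  ultimately show ?thesis unfolding ad_op_def mem_Collect_eq using V Y(1) 1 by blast
qed

end

section \<open>The algebra of the symbol\<close>

lemma commutator_mult: "commutator A B *v v = A *v (B *v v) - B *v (A *v v)"
  by (simp add: commutator_def matrix_vector_mult_diff_rdistrib matrix_vector_mul_assoc)

lemma mat_mult_vec:
  fixes A :: "complex^'m^'m"
  shows "(mat c ** A) *v v = c *s (A *v v)"
proof -
  have "mat c *v w = c *s (w :: complex^'m)" for w
    by (simp add: matrix_vector_mult_def mat_def vec_eq_iff if_distrib[where f="\<lambda>x. x * _"] cong: if_cong)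
  then show ?thesis by (simp only: matrix_vector_mul_assoc[symmetric])
qed

lemmas mv_simps = commutator_mult mat_mult_vec matrix_vector_mult_add_rdistrib matrix_vector_mult_diff_rdistrib
  matrix_vector_right_distrib matrix_vector_mult_diff_distrib vector_scalar_commute

lemma commutator_rules:
  fixes T T' A :: "complex^'m^'m"
  shows "commutator (T + T') A = commutator T A + commutator T' A"
    "commutator (mat c ** T) A = mat c ** commutator T A"
    "commutator (commutator T T') A = commutator T (commutator T' A) - commutator T' (commutator T A)"
    "commutator 0 A = 0"
proof -
  have "commutator (T + T') A *v v = (commutator T A + commutator T' A) *v v" for v
    by (simp add: mv_simps)
  then show "commutator (T + T') A = commutator T A + commutator T' A" by (simp add: matrix_eq)
  have "commutator (mat c ** T) A *v v = (mat c ** commutator T A) *v v" for v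
    by (simp add: mv_simps vec.scale_right_diff_distrib)
  then show "commutator (mat c ** T) A = mat c ** commutator T A" by (simp add: matrix_eq)
  have "commutator (commutator T T') A *v v = (commutator T (commutator T' A) - commutator T' (commutator T A)) *v v" for v
    by (simp add: mv_simps)
  then show "commutator (commutator T T') A = commutator T (commutator T' A) - commutator T' (commutator T A)"
    by (simp add: matrix_eq)
  have "commutator 0 A *v v = 0 *v v" for v by (simp add: mv_simps)
  then show "commutator 0 A = 0" by (simp add: matrix_eq)
qed

text \<open>
  The linear algebra of the symbol, on representatives: \<open>W\<close> is \<open>H + conj H\<close>, \<open>S\<close> is \<open>K + conj K\<close>, and \<open>P\<close> and \<open>Q\<close> are the
  preimages of the two summands of \<open>W / S\<close>. The operators \<open>A\<close> and \<open>B\<close> are \<open>ad\<close> for the two generators. The sets \<open>\<Sigma>\<close>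
  and \<open>\<Sigma>'\<close> of admissible multiples of the generators are kept as arbitrary subspaces of the scalars, so
  that no section of the Levi kernel with prescribed value has to be produced.
\<close>

locale symbol_algebra =
  fixes W S P Q :: "(complex^'m) set" and \<omega> :: "complex^'m \<Rightarrow> complex^'m \<Rightarrow> complex"
    and A B :: "complex^'m \<Rightarrow> complex^'m" and \<Sigma> \<Sigma>' :: "complex set"
  assumes sub: "vec.subspace W" "vec.subspace S" "vec.subspace P" "vec.subspace Q"
    and incl: "S \<subseteq> P" "S \<subseteq> Q" "P \<subseteq> W" "Q \<subseteq> W"
    and A: "A (v + w) = A v + A w" "A (c *s v) = c *s A v"
    and AP: "v \<in> W \<Longrightarrow> A v \<in> P" and AS: "v \<in> P \<Longrightarrow> A v \<in> S"
    and B: "B (v + w) = B v + B w" "B (c *s v) = c *s B v"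
    and BQ: "v \<in> W \<Longrightarrow> B v \<in> Q" and BS: "v \<in> Q \<Longrightarrow> B v \<in> S"
    and \<omega>: "\<omega> (u + u') v = \<omega> u v + \<omega> u' v" "\<omega> (c *s u) v = c * \<omega> u v"
      "\<omega> u (v + v') = \<omega> u v + \<omega> u v'" "\<omega> u (c *s v) = c * \<omega> u v"
    and \<omega>S: "v \<in> S \<Longrightarrow> \<omega> v w = 0" "v \<in> S \<Longrightarrow> \<omega> w v = 0"
    and skewA: "v \<in> W \<Longrightarrow> w \<in> W \<Longrightarrow> \<omega> (A v) w + \<omega> v (A w) = 0"
    and skewB: "v \<in> W \<Longrightarrow> w \<in> W \<Longrightarrow> \<omega> (B v) w + \<omega> v (B w) = 0"
    and \<Sigma>: "0 \<in> \<Sigma>" "s \<in> \<Sigma> \<Longrightarrow> t \<in> \<Sigma> \<Longrightarrow> s + t \<in> \<Sigma>" "s \<in> \<Sigma> \<Longrightarrow> c * s \<in> \<Sigma>"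
    and \<Sigma>': "0 \<in> \<Sigma>'" "s \<in> \<Sigma>' \<Longrightarrow> t \<in> \<Sigma>' \<Longrightarrow> s + t \<in> \<Sigma>'" "s \<in> \<Sigma>' \<Longrightarrow> c * s \<in> \<Sigma>'"
begin

lemma subspace_mem:
  "v \<in> W \<Longrightarrow> w \<in> W \<Longrightarrow> v + w \<in> W" "v \<in> W \<Longrightarrow> w \<in> W \<Longrightarrow> v - w \<in> W" "v \<in> W \<Longrightarrow> c *s v \<in> W" "0 \<in> W"
  "v \<in> S \<Longrightarrow> w \<in> S \<Longrightarrow> v + w \<in> S" "v \<in> S \<Longrightarrow> w \<in> S \<Longrightarrow> v - w \<in> S" "v \<in> S \<Longrightarrow> c *s v \<in> S" "0 \<in> S"
  "v \<in> P \<Longrightarrow> w \<in> P \<Longrightarrow> v + w \<in> P" "v \<in> P \<Longrightarrow> w \<in> P \<Longrightarrow> v - w \<in> P" "v \<in> P \<Longrightarrow> c *s v \<in> P" "0 \<in> P"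
  "v \<in> Q \<Longrightarrow> w \<in> Q \<Longrightarrow> v + w \<in> Q" "v \<in> Q \<Longrightarrow> w \<in> Q \<Longrightarrow> v - w \<in> Q" "v \<in> Q \<Longrightarrow> c *s v \<in> Q" "0 \<in> Q"
  using sub by (auto intro: vec.subspace_add vec.subspace_diff vec.subspace_scale vec.subspace_0)

lemma A_diff: "A (v - w) = A v - A w"
proof -
  have "A v = A ((v - w) + w)" by simp
  also have "\<dots> = A (v - w) + A w" by (rule A)
  finally show ?thesis by simp
qed

lemma B_diff: "B (v - w) = B v - B w"
proof -
  have "B v = B ((v - w) + w)" by simp
  also have "\<dots> = B (v - w) + B w" by (rule B)
  finally show ?thesis by simp
qed

definition gl :: "(complex^'m^'m) set" where
  "gl = {T. (*v) T ` W \<subseteq> W \<and> (*v) T ` S \<subseteq> S}"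

definition lift where
  "lift R \<Phi> = {T \<in> gl. \<exists>s\<in>R. \<forall>v\<in>W. T *v v - s *s \<Phi> v \<in> S}"

definition csp where
  "csp = {T \<in> gl. \<exists>l. \<forall>x\<in>W. \<forall>y\<in>W. \<omega> (T *v x) y + \<omega> x (T *v y) = l * \<omega> x y}"

text \<open>
  The endomorphisms satisfying all the conditions that define \<open>g00\<close>. They form a Lie algebra, so the
  maximal subalgebra is this set.
\<close>

definition stabilizer where
  "stabilizer = {T \<in> csp. (*v) T ` P \<subseteq> P \<and> (*v) T ` Q \<subseteq> Q \<and> (\<forall>X\<in>lift \<Sigma> A. commutator T X \<in> lift \<Sigma> A) \<and>
     (\<forall>X\<in>lift \<Sigma>' B. commutator T X \<in> lift \<Sigma>' B)}"

lemma glD: "T \<in> gl \<Longrightarrow> v \<in> W \<Longrightarrow> T *v v \<in> W" "T \<in> gl \<Longrightarrow> v \<in> S \<Longrightarrow> T *v v \<in> S"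
  unfolding gl_def by auto

lemma glI: "(\<And>v. v \<in> W \<Longrightarrow> T *v v \<in> W) \<Longrightarrow> (\<And>v. v \<in> S \<Longrightarrow> T *v v \<in> S) \<Longrightarrow> T \<in> gl"
  unfolding gl_def by auto

lemma gl_closed:
  "0 \<in> gl" "T \<in> gl \<Longrightarrow> T' \<in> gl \<Longrightarrow> T + T' \<in> gl" "T \<in> gl \<Longrightarrow> T' \<in> gl \<Longrightarrow> T - T' \<in> gl" "T \<in> gl \<Longrightarrow> mat c ** T \<in> gl"
  "T \<in> gl \<Longrightarrow> T' \<in> gl \<Longrightarrow> commutator T T' \<in> gl"
  by (rule glI; simp add: mv_simps glD subspace_mem)+

lemma lift_closed:
  assumes R: "0 \<in> R" "\<And>s t. s \<in> R \<Longrightarrow> t \<in> R \<Longrightarrow> s + t \<in> R" "\<And>s c. s \<in> R \<Longrightarrow> c * s \<in> R"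
  shows "0 \<in> lift R \<Phi>" "T \<in> lift R \<Phi> \<Longrightarrow> T' \<in> lift R \<Phi> \<Longrightarrow> T + T' \<in> lift R \<Phi>"
    "T \<in> lift R \<Phi> \<Longrightarrow> mat c ** T \<in> lift R \<Phi>" "T \<in> lift R \<Phi> \<Longrightarrow> T' \<in> lift R \<Phi> \<Longrightarrow> T - T' \<in> lift R \<Phi>"
proof -
  show "0 \<in> lift R \<Phi>" unfolding lift_def using R(1) gl_closed(1) subspace_mem(8) by (auto intro!: bexI[of _ 0])
  show add: "T + T' \<in> lift R \<Phi>" if TT: "T \<in> lift R \<Phi>" "T' \<in> lift R \<Phi>" for T T'
  proof -
    obtain s t where st: "s \<in> R" "t \<in> R" "\<forall>v\<in>W. T *v v - s *s \<Phi> v \<in> S" "\<forall>v\<in>W. T' *v v - t *s \<Phi> v \<in> S"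
      "T \<in> gl" "T' \<in> gl"
      using TT unfolding lift_def by blast
    have "(T + T') *v v - (s + t) *s \<Phi> v \<in> S" if "v \<in> W" for v
    proof -
      have eq: "(T + T') *v v - (s + t) *s \<Phi> v = (T *v v - s *s \<Phi> v) + (T' *v v - t *s \<Phi> v)"
        by (simp add: mv_simps vec.scale_left_distrib)
      show ?thesis unfolding eq by (rule subspace_mem(5)[OF bspec[OF st(3) that] bspec[OF st(4) that]])
    qed
    then show ?thesis using st R(2) gl_closed(2) unfolding lift_def by blast
  qed
  show sc: "mat c ** T \<in> lift R \<Phi>" if T: "T \<in> lift R \<Phi>" for T c
  proof -
    obtain s where s: "s \<in> R" "\<forall>v\<in>W. T *v v - s *s \<Phi> v \<in> S" "T \<in> gl" using T unfolding lift_def by blast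
    have "(mat c ** T) *v v - (c * s) *s \<Phi> v \<in> S" if "v \<in> W" for v
    proof -
      have eq: "(mat c ** T) *v v - (c * s) *s \<Phi> v = c *s (T *v v - s *s \<Phi> v)"
        by (simp add: mv_simps vec.scale_right_diff_distrib)
      show ?thesis unfolding eq by (rule subspace_mem(7)[OF bspec[OF s(2) that]])
    qed
    then show ?thesis using s R(3) gl_closed(4) unfolding lift_def by blast
  qed
  show "T - T' \<in> lift R \<Phi>" if "T \<in> lift R \<Phi>" "T' \<in> lift R \<Phi>"
  proof -
    have "(T + mat (-1) ** T') *v v = (T - T') *v v" for v
      by (simp only: mv_simps) (simp add: vec_eq_iff)
    then have "T + mat (-1) ** T' = T - T'" by (simp add: matrix_eq)
    then show ?thesis using add[OF that(1) sc[OF that(2), of "-1"]] by simp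
  qed
qed

lemma csp_closed:
  "0 \<in> csp" "T \<in> csp \<Longrightarrow> T' \<in> csp \<Longrightarrow> T + T' \<in> csp" "T \<in> csp \<Longrightarrow> mat c ** T \<in> csp"
  "T \<in> csp \<Longrightarrow> T' \<in> csp \<Longrightarrow> commutator T T' \<in> csp"
proof -
  have \<omega>0: "\<omega> 0 w = 0" "\<omega> w 0 = 0" for w using \<omega>S subspace_mem(8) by auto
  show "0 \<in> csp" unfolding csp_def using gl_closed(1) \<omega>0 by (auto intro!: exI[of _ 0])
  have csp_iff: "T \<in> csp \<longleftrightarrow> T \<in> gl \<and> (\<exists>l. \<forall>x\<in>W. \<forall>y\<in>W. \<omega> (T *v x) y + \<omega> x (T *v y) = l * \<omega> x y)" for T
    by (simp add: csp_def)
  have \<omega>d: "\<omega> (u - u') v = \<omega> u v - \<omega> u' v" "\<omega> v (u - u') = \<omega> v u - \<omega> v u'" for u u' v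
  proof -
    have "u - u' = u + (-1) *s u'" by (simp add: vec_eq_iff)
    then show "\<omega> (u - u') v = \<omega> u v - \<omega> u' v" "\<omega> v (u - u') = \<omega> v u - \<omega> v u'"
      using \<omega>(1)[of u "(-1) *s u'" v] \<omega>(2)[of "-1" u' v] \<omega>(3)[of v u "(-1) *s u'"] \<omega>(4)[of v "-1" u'] by simp_all
  qed
  show "mat c ** T \<in> csp" if T: "T \<in> csp"
  proof -
    obtain l where l: "T \<in> gl" "\<forall>x\<in>W. \<forall>y\<in>W. \<omega> (T *v x) y + \<omega> x (T *v y) = l * \<omega> x y"
      using T unfolding csp_iff by blast
    have "\<omega> ((mat c ** T) *v x) y + \<omega> x ((mat c ** T) *v y) = (c * l) * \<omega> x y" if "x \<in> W" "y \<in> W" for x y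
    proof -
      have "\<omega> ((mat c ** T) *v x) y + \<omega> x ((mat c ** T) *v y) = c * (\<omega> (T *v x) y + \<omega> x (T *v y))"
        by (simp add: mat_mult_vec \<omega> distrib_left)
      also have "\<dots> = c * (l * \<omega> x y)" using l(2) that by simp
      finally show ?thesis by simp
    qed
    then show ?thesis unfolding csp_iff using gl_closed(4)[OF l(1)] by blast
  qed
  assume "T \<in> csp" "T' \<in> csp"
  then obtain l l' where l: "T \<in> gl" "\<And>x y. x \<in> W \<Longrightarrow> y \<in> W \<Longrightarrow> \<omega> (T *v x) y + \<omega> x (T *v y) = l * \<omega> x y"
    and l': "T' \<in> gl" "\<And>x y. x \<in> W \<Longrightarrow> y \<in> W \<Longrightarrow> \<omega> (T' *v x) y + \<omega> x (T' *v y) = l' * \<omega> x y"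
    unfolding csp_iff by blast
  have "\<omega> ((T + T') *v x) y + \<omega> x ((T + T') *v y) = (l + l') * \<omega> x y" if "x \<in> W" "y \<in> W" for x y
    using l(2)[OF that] l'(2)[OF that] by (simp add: mv_simps \<omega> algebra_simps)
  then show "T + T' \<in> csp" unfolding csp_iff using gl_closed(2)[OF l(1) l'(1)] by blast
  have "\<omega> (commutator T T' *v x) y + \<omega> x (commutator T T' *v y) = 0 * \<omega> x y" if xy: "x \<in> W" "y \<in> W" for x y
  proof -
    note gx = glD(1)[OF l(1)] glD(1)[OF l'(1)]
    have e1: "\<omega> (T *v (T' *v x)) y + \<omega> (T' *v x) (T *v y) = l * \<omega> (T' *v x) y" using l(2) gx xy by blast
    have e2: "\<omega> (T' *v (T *v x)) y + \<omega> (T *v x) (T' *v y) = l' * \<omega> (T *v x) y" using l'(2) gx xy by blast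
    have e3: "\<omega> (T *v x) (T' *v y) + \<omega> x (T *v (T' *v y)) = l * \<omega> x (T' *v y)" using l(2) gx xy by blast
    have e4: "\<omega> (T' *v x) (T *v y) + \<omega> x (T' *v (T *v y)) = l' * \<omega> x (T *v y)" using l'(2) gx xy by blast
    have e5: "l * (\<omega> (T' *v x) y + \<omega> x (T' *v y)) = l' * (\<omega> (T *v x) y + \<omega> x (T *v y))"
      using l(2)[OF xy] l'(2)[OF xy] by simp
    have "\<omega> (commutator T T' *v x) y + \<omega> x (commutator T T' *v y)
      = (\<omega> (T *v (T' *v x)) y + \<omega> (T' *v x) (T *v y)) - (\<omega> (T' *v (T *v x)) y + \<omega> (T *v x) (T' *v y))
       + (\<omega> (T *v x) (T' *v y) + \<omega> x (T *v (T' *v y))) - (\<omega> (T' *v x) (T *v y) + \<omega> x (T' *v (T *v y)))"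
      by (simp add: commutator_mult \<omega>d)
    also have "\<dots> = 0 * \<omega> x y" unfolding e1 e2 e3 e4 using e5 by (simp add: algebra_simps)
    finally show ?thesis .
  qed
  then show "commutator T T' \<in> csp" unfolding csp_iff using gl_closed(5)[OF l(1) l'(1)] by blast
qed

lemma lift_skew_csp:
  assumes skew: "\<And>v w. v \<in> W \<Longrightarrow> w \<in> W \<Longrightarrow> \<omega> (\<Phi> v) w + \<omega> v (\<Phi> w) = 0"
  shows "lift R \<Phi> \<subseteq> csp"
proof
  fix T assume "T \<in> lift R \<Phi>"
  then obtain s where s: "T \<in> gl" "\<And>v. v \<in> W \<Longrightarrow> T *v v - s *s \<Phi> v \<in> S" unfolding lift_def by blast
  have "\<omega> (T *v x) y + \<omega> x (T *v y) = 0 * \<omega> x y" if xy: "x \<in> W" "y \<in> W" for x y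
  proof -
    have "\<omega> (T *v x) y = \<omega> (s *s \<Phi> x + (T *v x - s *s \<Phi> x)) y" by simp
    also have "\<dots> = s * \<omega> (\<Phi> x) y"
      by (simp only: \<omega> \<omega>S(1)[OF s(2)[OF xy(1)]] add_0_right)
    finally have 1: "\<omega> (T *v x) y = s * \<omega> (\<Phi> x) y" .
    have "\<omega> x (T *v y) = \<omega> x (s *s \<Phi> y + (T *v y - s *s \<Phi> y))" by simp
    also have "\<dots> = s * \<omega> x (\<Phi> y)"
      by (simp only: \<omega> \<omega>S(2)[OF s(2)[OF xy(2)]] add_0_right)
    finally have 2: "\<omega> x (T *v y) = s * \<omega> x (\<Phi> y)" .
    from 1 2 show ?thesis using skew[OF xy] by (simp add: distrib_left[symmetric])
  qed
  then show "T \<in> csp" unfolding csp_def using s(1) by blast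
qed

lemma stabilizer_subalgebra: "lie_subalgebra stabilizer"
proof -
  note lA = lift_closed[OF \<Sigma>] and lB = lift_closed[OF \<Sigma>']
  have img: "(*v) T ` X \<subseteq> X \<longleftrightarrow> (\<forall>v\<in>X. T *v v \<in> X)" for T :: "complex^'m^'m" and X by auto
  have stabilizer_iff: "T \<in> stabilizer \<longleftrightarrow> T \<in> csp \<and> (\<forall>v\<in>P. T *v v \<in> P) \<and> (\<forall>v\<in>Q. T *v v \<in> Q) \<and>
    (\<forall>X\<in>lift \<Sigma> A. commutator T X \<in> lift \<Sigma> A) \<and> (\<forall>X\<in>lift \<Sigma>' B. commutator T X \<in> lift \<Sigma>' B)" for T
    unfolding stabilizer_def img by simp
  show ?thesis
    unfolding lie_subalgebra_def
  proof (intro conjI ballI allI)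
    show "0 \<in> stabilizer" unfolding stabilizer_iff commutator_rules by (simp add: csp_closed lA lB subspace_mem)
    fix T T' assume T: "T \<in> stabilizer" and T': "T' \<in> stabilizer"
    show "T + T' \<in> stabilizer"
      using T T' unfolding stabilizer_iff commutator_rules by (simp add: csp_closed lA lB subspace_mem mv_simps)
    show "commutator T T' \<in> stabilizer"
      using T T' unfolding stabilizer_iff commutator_rules by (simp add: csp_closed lA lB subspace_mem mv_simps)
  next
    fix c T assume T: "T \<in> stabilizer"
    show "mat c ** T \<in> stabilizer"
      using T unfolding stabilizer_iff commutator_rules by (simp add: csp_closed lA lB subspace_mem mv_simps)
  qed
qed

text \<open>
  Modulo \<open>S\<close> the commutator is a multiple of \<open>BA - AB\<close>. Since \<open>AA\<close> and \<open>BB\<close> vanish modulo \<open>S\<close>, bracketing once more with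
  \<open>A\<close> or \<open>B\<close> gives multiples of \<open>ABA\<close> and \<open>BAB\<close>. By hypothesis these are multiples of \<open>A\<close> and \<open>B\<close>, so the commutator
  normalizes both lines.
\<close>

lemma commutator_in_stabilizer:
  assumes \<nu>: "\<And>v. v \<in> W \<Longrightarrow> A (B (A v)) - \<nu> *s A v \<in> S" and \<mu>: "\<And>v. v \<in> W \<Longrightarrow> B (A (B v)) - \<mu> *s B v \<in> S"
    and C: "C \<in> lift \<Sigma>' B" and T: "T \<in> lift \<Sigma> A"
  shows "commutator C T \<in> stabilizer"
proof -
  have lin: "v = u + (v - u)" for u v :: "complex^'m" by simp
  have AW: "A v \<in> W" "B v \<in> W" if "v \<in> W" for v using AP BQ incl that by blast+
  have AS': "A v \<in> S" "B v \<in> S" if "v \<in> S" for v using AS BS incl that by blast+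
  obtain s where s: "s \<in> \<Sigma>" "T \<in> gl" "\<And>v. v \<in> W \<Longrightarrow> T *v v - s *s A v \<in> S" using T unfolding lift_def by blast
  obtain t where t: "t \<in> \<Sigma>'" "C \<in> gl" "\<And>v. v \<in> W \<Longrightarrow> C *v v - t *s B v \<in> S" using C unfolding lift_def by blast
  let ?X = "commutator C T"
  have Xgl: "?X \<in> gl" by (rule gl_closed(5)[OF t(2) s(2)])
  have X: "?X *v v - (s * t) *s (B (A v) - A (B v)) \<in> S" if v: "v \<in> W" for v
  proof -
    let ?a = "T *v v - s *s A v" and ?b = "C *v v - t *s B v"
    have "C *v (T *v v) = C *v (s *s A v + ?a)" by simp
    also have "\<dots> = s *s (C *v A v) + C *v ?a" by (simp only: mv_simps)
    finally have 1: "C *v (T *v v) = s *s (C *v A v) + C *v ?a" .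
    have "T *v (C *v v) = T *v (t *s B v + ?b)" by simp
    also have "\<dots> = t *s (T *v B v) + T *v ?b" by (simp only: mv_simps)
    finally have 2: "T *v (C *v v) = t *s (T *v B v) + T *v ?b" .
    have "?X *v v - (s * t) *s (B (A v) - A (B v))
       = s *s (C *v A v - t *s B (A v)) + C *v ?a - t *s (T *v B v - s *s A (B v)) - T *v ?b"
      unfolding commutator_mult 1 2 by (simp add: vec.scale_right_diff_distrib mult.commute)
    also have "\<dots> \<in> S"
      by (intro subspace_mem s t AW v glD(2)[OF s(2)] glD(2)[OF t(2)])
    finally show ?thesis .
  qed
  have XP: "?X *v v \<in> P" if v: "v \<in> P" for v
  proof -
    have vW: "v \<in> W" using v incl by blast
    have "?X *v v = (?X *v v - (s * t) *s (B (A v) - A (B v))) + (s * t) *s (B (A v) - A (B v))" by simp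
    also have "\<dots> \<in> P"
      by (intro subspace_mem subsetD[OF incl(1) X[OF vW]] subsetD[OF incl(1) AS'(2)[OF AS[OF v]]] AP[OF AW(2)[OF vW]])
    finally show ?thesis .
  qed
  have XQ: "?X *v v \<in> Q" if v: "v \<in> Q" for v
  proof -
    have vW: "v \<in> W" using v incl by blast
    have "?X *v v = (?X *v v - (s * t) *s (B (A v) - A (B v))) + (s * t) *s (B (A v) - A (B v))" by simp
    also have "\<dots> \<in> Q"
      by (intro subspace_mem subsetD[OF incl(2) X[OF vW]] subsetD[OF incl(2) AS'(1)[OF BS[OF v]]] BQ[OF AW(1)[OF vW]])
    finally show ?thesis .
  qed
  have XA: "commutator ?X Y \<in> lift \<Sigma> A" if Y: "Y \<in> lift \<Sigma> A" for Y
  proof -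
    obtain s' where s': "Y \<in> gl" "\<And>v. v \<in> W \<Longrightarrow> Y *v v - s' *s A v \<in> S" using Y unfolding lift_def by blast
    \<comment> \<open>\<open>[X, A] = X A - A X\<close> with \<open>X = s t (B A - A B)\<close>, and \<open>A A = 0\<close> modulo \<open>S\<close>\<close>
    let ?c = "(- 2 * s' * t * \<nu>) * s"
    have "commutator ?X Y *v v - ?c *s A v \<in> S" if v: "v \<in> W" for v
    proof -
      let ?a = "Y *v v - s' *s A v" and ?D = "\<lambda>v. B (A v) - A (B v)"
      let ?b = "?X *v v - (s * t) *s ?D v"
      have DW: "?D v \<in> W" by (intro subspace_mem AW v)
      have "?X *v (Y *v v) = ?X *v (s' *s A v + ?a)" by simp
      also have "\<dots> = s' *s (?X *v A v) + ?X *v ?a" by (simp only: matrix_vector_right_distrib vector_scalar_commute)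
      finally have 1: "?X *v (Y *v v) = s' *s (?X *v A v) + ?X *v ?a" .
      have "Y *v (?X *v v) = Y *v ((s * t) *s ?D v + ?b)" by simp
      also have "\<dots> = (s * t) *s (Y *v ?D v) + Y *v ?b" by (simp only: matrix_vector_right_distrib vector_scalar_commute)
      finally have 2: "Y *v (?X *v v) = (s * t) *s (Y *v ?D v) + Y *v ?b" .
      have AD: "A (?D v) = A (B (A v)) - A (A (B v))" by (rule A_diff)
      have "commutator ?X Y *v v - ?c *s A v
        = s' *s (?X *v A v - (s * t) *s ?D (A v)) + ?X *v ?a - (s * t) *s (Y *v ?D v - s' *s A (?D v)) - Y *v ?b
          + (s' * (s * t)) *s (B (A (A v))) + (s' * (s * t)) *s (A (A (B v)))
          - (2 * (s' * (s * t))) *s (A (B (A v)) - \<nu> *s A v)"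
        unfolding commutator_mult[of ?X Y] 1 2 AD by (simp add: vec_eq_iff algebra_simps)
      also have "\<dots> \<in> S"
        by (intro subspace_mem X AW v s' glD(2)[OF Xgl] glD(2)[OF s'(1)] \<nu> DW AS'(2) AS AP)
      finally show ?thesis .
    qed
    then show ?thesis
      unfolding lift_def using gl_closed(5)[OF Xgl s'(1)] \<Sigma>(3)[OF s(1)] by blast
  qed
  have XB: "commutator ?X Y \<in> lift \<Sigma>' B" if Y: "Y \<in> lift \<Sigma>' B" for Y
  proof -
    obtain t' where t': "Y \<in> gl" "\<And>v. v \<in> W \<Longrightarrow> Y *v v - t' *s B v \<in> S" using Y unfolding lift_def by blast
    let ?c = "(2 * t' * s * \<mu>) * t"
    have "commutator ?X Y *v v - ?c *s B v \<in> S" if v: "v \<in> W" for v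
    proof -
      let ?a = "Y *v v - t' *s B v" and ?D = "\<lambda>v. B (A v) - A (B v)"
      let ?b = "?X *v v - (s * t) *s ?D v"
      have DW: "?D v \<in> W" by (intro subspace_mem AW v)
      have "?X *v (Y *v v) = ?X *v (t' *s B v + ?a)" by simp
      also have "\<dots> = t' *s (?X *v B v) + ?X *v ?a" by (simp only: matrix_vector_right_distrib vector_scalar_commute)
      finally have 1: "?X *v (Y *v v) = t' *s (?X *v B v) + ?X *v ?a" .
      have "Y *v (?X *v v) = Y *v ((s * t) *s ?D v + ?b)" by simp
      also have "\<dots> = (s * t) *s (Y *v ?D v) + Y *v ?b" by (simp only: matrix_vector_right_distrib vector_scalar_commute)
      finally have 2: "Y *v (?X *v v) = (s * t) *s (Y *v ?D v) + Y *v ?b" .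
      have BD: "B (?D v) = B (B (A v)) - B (A (B v))" by (rule B_diff)
      have "commutator ?X Y *v v - ?c *s B v
        = t' *s (?X *v B v - (s * t) *s ?D (B v)) + ?X *v ?a - (s * t) *s (Y *v ?D v - t' *s B (?D v)) - Y *v ?b
          - (t' * (s * t)) *s (A (B (B v))) - (t' * (s * t)) *s (B (B (A v)))
          + (2 * (t' * (s * t))) *s (B (A (B v)) - \<mu> *s B v)"
        unfolding commutator_mult[of ?X Y] 1 2 BD by (simp add: vec_eq_iff algebra_simps)
      also have "\<dots> \<in> S"
        by (intro subspace_mem X AW v t' glD(2)[OF Xgl] glD(2)[OF t'(1)] \<mu> DW AS'(1) BS BQ)
      finally show ?thesis .
    qed
    then show ?thesis
      unfolding lift_def using gl_closed(5)[OF Xgl t'(1)] \<Sigma>'(3)[OF t(1)] by blast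
  qed
  have "?X \<in> csp"
    using csp_closed(4) lift_skew_csp[OF skewA] lift_skew_csp[OF skewB] C T by blast
  then show ?thesis unfolding stabilizer_def using XP XQ XA XB by blast
qed

end

section \<open>Symbols of rank one are regular\<close>

lemma section_scalars_closed:
  fixes D :: "real^'m \<Rightarrow> (complex^'m) set" and v :: "complex^'m"
  assumes x: "x \<in> U" "open U" "U \<subseteq> M" and D: "\<And>y. y \<in> U \<Longrightarrow> vec.subspace (D y)"
  defines "R \<equiv> {s. \<exists>V\<in>sections_at M D x. V x = s *s v}"
  shows "0 \<in> R" "s \<in> R \<Longrightarrow> t \<in> R \<Longrightarrow> s + t \<in> R" "s \<in> R \<Longrightarrow> c * s \<in> R"
proof -
  have "(\<lambda>_. 0) \<in> sections_at M D x"
    unfolding sections_at_def mem_Collect_eq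
    by (intro exI[of _ U] conjI ballI x real_analytic_zero vec.subspace_0 D)
  then show "0 \<in> R" unfolding R_def by force
  show "s + t \<in> R" if st: "s \<in> R" "t \<in> R"
  proof -
    obtain V W where V: "V \<in> sections_at M D x" "V x = s *s v" and W: "W \<in> sections_at M D x" "W x = t *s v"
      using st unfolding R_def by blast
    obtain UV where UV: "open UV" "x \<in> UV" "UV \<subseteq> M" "real_analytic_on UV V" "\<forall>y\<in>UV. V y \<in> D y"
      using V(1) unfolding sections_at_def by blast
    obtain UW where UW: "open UW" "x \<in> UW" "UW \<subseteq> M" "real_analytic_on UW W" "\<forall>y\<in>UW. W y \<in> D y"
      using W(1) unfolding sections_at_def by blast
    have "(\<lambda>y. V y + W y) \<in> sections_at M D x"
      unfolding sections_at_def mem_Collect_eq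
    proof (intro exI[of _ "U \<inter> (UV \<inter> UW)"] conjI ballI)
      show "real_analytic_on (U \<inter> (UV \<inter> UW)) (\<lambda>y. V y + W y)"
        by (intro real_analytic_add real_analytic_subset[OF UV(4)] real_analytic_subset[OF UW(4)]) auto
      show "V y + W y \<in> D y" if "y \<in> U \<inter> (UV \<inter> UW)" for y
        using that UV(5) UW(5) vec.subspace_add[OF D] by blast
    qed (use x UV UW in auto)
    moreover have "V x + W x = (s + t) *s v" by (simp add: V W vec.scale_left_distrib)
    ultimately show ?thesis unfolding R_def by (intro CollectI bexI)
  qed
  show "c * s \<in> R" if s: "s \<in> R"
  proof -
    obtain V where V: "V \<in> sections_at M D x" "V x = s *s v"
      using s unfolding R_def by blast
    obtain UV where UV: "open UV" "x \<in> UV" "UV \<subseteq> M" "real_analytic_on UV V" "\<forall>y\<in>UV. V y \<in> D y"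
      using V(1) unfolding sections_at_def by blast
    have "(\<lambda>y. c *s V y) \<in> sections_at M D x"
      unfolding sections_at_def mem_Collect_eq
    proof (intro exI[of _ "U \<inter> UV"] conjI ballI)
      show "real_analytic_on (U \<inter> UV) (\<lambda>y. c *s V y)"
        by (intro real_analytic_scale real_analytic_subset[OF UV(4)]) auto
      show "c *s V y \<in> D y" if "y \<in> U \<inter> UV" for y
        using that UV(5) vec.subspace_scale[OF D] by blast
    qed (use x UV in auto)
    moreover have "c *s V x = (c * s) *s v" by (simp add: V vector_smult_assoc)
    ultimately show ?thesis unfolding R_def by (intro CollectI bexI)
  qed
qed

context levi_chart
begin

lemma levi_dist_kernel_eq: "x \<in> ball p r \<Longrightarrow> levi_dist (levi_kernel M H) x = range (\<lambda>c. c *s k (cvec x)) + range (\<lambda>c. c *s kb (cvec x))"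
  unfolding levi_dist_def by (simp only: K_eq conj_K_eq)

lemma ad_proj:
  assumes s: "side q I J" and z: "z \<in> B" shows "ad q I J z (proj J z v) = ad q I J z v"
proof -
  have "\<kappa> j z (proj J z v) = \<kappa> j z v" if "j \<in> J" for j
    unfolding proj_def using \<kappa>_lincomb[OF z side_sub(6)[OF s]] that side_sub(6)[OF s] by auto
  then show ?thesis unfolding ad_def by (intro arg_cong[where f="proj I z"] sum.cong) auto
qed

lemma ad_eq_0:
  assumes s: "side q I J" and v: "v \<in> Esp I z" shows "ad q I J z v = 0"
proof -
  have "\<kappa> j z v = 0" if "j \<in> J" for j
    using v side_sub(3,6)[OF s] that unfolding Esp_iff by blast
  then show ?thesis by (simp add: ad_def proj_simps)
qed

lemma ad_skew_W:
  assumes s: "side q I J" and z: "z \<in> B" and v: "v \<in> Esp {..<2*n} z" and w: "w \<in> Esp {..<2*n} z"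
  shows "\<omega> z (ad q I J z v) w + \<omega> z v (ad q I J z w) = 0"
proof -
  have PI: "proj I z u \<in> Esp I z" and PJ: "proj J z u \<in> Esp J z" for u
    using proj_Esp[OF z side_sub(5)[OF s]] proj_Esp[OF z side_sub(6)[OF s]] by blast+
  have "\<omega> z (ad q I J z v) w = \<omega> z (ad q I J z v) (proj I z w + proj J z w)"
    by (rule arg_cong[OF proj_split[OF s z w]])
  also have "\<dots> = \<omega> z (ad q I J z (proj J z v)) (proj J z w)"
    using side_isotropic(2)[OF s z ad_Esp[OF s z] PI] by (simp add: \<omega>_simps ad_proj[OF s z])
  finally have 1: "\<omega> z (ad q I J z v) w = \<omega> z (ad q I J z (proj J z v)) (proj J z w)" .
  have "\<omega> z v (ad q I J z w) = \<omega> z (proj I z v + proj J z v) (ad q I J z w)"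
    by (rule arg_cong[OF proj_split[OF s z v], of "\<lambda>v. \<omega> z v (ad q I J z w)"])
  also have "\<dots> = \<omega> z (proj J z v) (ad q I J z (proj J z w))"
    using side_isotropic(2)[OF s z PI ad_Esp[OF s z]] by (simp add: \<omega>_simps ad_proj[OF s z])
  finally have 2: "\<omega> z v (ad q I J z w) = \<omega> z (proj J z v) (ad q I J z (proj J z w))" .
  show ?thesis unfolding 1 2 by (rule ad_skew[OF s z PJ PJ])
qed

text \<open>
  The two conditions in the definitions of the lifts of \<open>g02\<close> and \<open>g0m2\<close>, on the two summands, amount to one: \<open>T\<close>
  is a multiple of \<open>ad\<close> modulo \<open>K + conj K\<close>.
\<close>

lemma lift_iff:
  assumes s: "sides q q' I J" and x: "x \<in> ball p r"
    and A: "\<And>y. y \<in> ball p r \<Longrightarrow> A y = Esp I (cvec y)" and KA: "\<And>y. y \<in> ball p r \<Longrightarrow> KA y = range (\<lambda>c. c *s q (cvec y))"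
    and Bd: "\<And>y. y \<in> ball p r \<Longrightarrow> Bd y = Esp J (cvec y)" and KB: "\<And>y. y \<in> ball p r \<Longrightarrow> KB y = range (\<lambda>c. c *s q' (cvec y))"
    and S: "S = KA x + KB x"
  shows "(\<exists>v\<in>KA x. (\<forall>y\<in>Bd x. T *v y \<in> ad_op M A KA Bd KB x v y + KB x) \<and> (\<forall>u\<in>A x. T *v u \<in> S)) \<longleftrightarrow>
    (\<exists>t\<in>{t. \<exists>V\<in>sections_at M KA x. V x = t *s q (cvec x)}. \<forall>v\<in>Esp {..<2*n} (cvec x). T *v v - t *s ad q I J (cvec x) v \<in> S)"
    (is "?L \<longleftrightarrow> ?R")
proof
  let ?z = "cvec x"
  note s1 = sides_side(1)[OF s]
  have z: "?z \<in> B" using x by simp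
  have S_iff: "u \<in> S \<longleftrightarrow> (\<exists>a b. u = a *s q ?z + b *s q' ?z)" for u
    unfolding S KA[OF x] KB[OF x] by (auto simp: set_plus_def)
  have S_sub: "vec.subspace S" unfolding S KA[OF x] KB[OF x] by (intro subspace_plus subspace_line)
  {
    assume ?L
    then obtain v where v: "v \<in> KA x" "\<And>y. y \<in> Bd x \<Longrightarrow> T *v y \<in> ad_op M A KA Bd KB x v y + KB x"
      "\<And>u. u \<in> A x \<Longrightarrow> T *v u \<in> S" by blast
    obtain t where t: "v = t *s q ?z" using v(1) KA[OF x] by blast
    have *: "(\<exists>V\<in>sections_at M KA x. V x = t *s q ?z) \<and> T *v y - t *s ad q I J ?z y \<in> S" if y: "y \<in> Bd x" for y
    proof -
      obtain w e where w: "T *v y = w + e" "w \<in> ad_op M A KA Bd KB x (t *s q ?z) y" "e \<in> KB x"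
        using v(2)[OF y] unfolding t by (elim set_plus_elim) blast
      obtain b where b: "e = b *s q' ?z" using w(3) KB[OF x] by blast
      obtain c V where c: "w = t *s ad q I J ?z y + c *s q ?z" "V \<in> sections_at M KA x" "V x = t *s q ?z"
        by (rule ad_op_elim[OF s x A KA Bd KB w(2)], assumption, assumption, assumption, assumption, rule that, assumption+)
      have "T *v y - t *s ad q I J ?z y = c *s q ?z + b *s q' ?z" by (simp add: w(1) c(1) b)
      then show ?thesis unfolding S_iff using c(2,3) by blast
    qed
    have "0 \<in> Bd x" unfolding Bd[OF x] by (rule Esp_simps(1))
    then have tR: "t \<in> {t. \<exists>V\<in>sections_at M KA x. V x = t *s q ?z}" using * by blast
    have "T *v w - t *s ad q I J ?z w \<in> S" if w: "w \<in> Esp {..<2*n} ?z" for w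
    proof -
      have "proj I ?z w \<in> A x" "proj J ?z w \<in> Bd x"
        unfolding A[OF x] Bd[OF x] by (rule proj_Esp[OF z side_sub(5)[OF s1]], rule proj_Esp[OF z side_sub(6)[OF s1]])
      then have 1: "T *v (proj I ?z w) \<in> S" "T *v proj J ?z w - t *s ad q I J ?z (proj J ?z w) \<in> S" using v(3) * by blast+
      have "T *v w = T *v (proj I ?z w + proj J ?z w)" by (rule arg_cong[OF proj_split[OF s1 z w]])
      then have "T *v w - t *s ad q I J ?z w = T *v (proj I ?z w) + (T *v proj J ?z w - t *s ad q I J ?z (proj J ?z w))"
        by (simp add: matrix_vector_right_distrib ad_proj[OF s1 z])
      then show ?thesis using vec.subspace_add[OF S_sub 1] by simp
    qed
    with tR show ?R by blast
  }
  assume ?R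
  then obtain t V where V: "V \<in> sections_at M KA x" "V x = t *s q ?z"
    and T: "\<And>v. v \<in> Esp {..<2*n} ?z \<Longrightarrow> T *v v - t *s ad q I J ?z v \<in> S" by blast
  show ?L
  proof (intro bexI[of _ "t *s q ?z"] conjI ballI)
    show "t *s q ?z \<in> KA x" unfolding KA[OF x] by (rule rangeI)
    fix y assume y: "y \<in> Bd x"
    then have yJ: "y \<in> Esp J ?z" using Bd[OF x] by simp
    obtain c b where cb: "T *v y - t *s ad q I J ?z y = c *s q ?z + b *s q' ?z"
      using T[OF side_imp_Levi(2)[OF s1 yJ]] S_iff by blast
    have "T *v y = (t *s ad q I J ?z y + c *s q ?z) + b *s q' ?z"
      using cb by (simp add: diff_eq_eq add.assoc add.commute add.left_commute)
    also have "\<dots> \<in> ad_op M A KA Bd KB x (t *s q ?z) y + KB x"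
    proof (rule set_plus_intro)
      show "t *s ad q I J ?z y + c *s q ?z \<in> ad_op M A KA Bd KB x (t *s q ?z) y"
        by (rule ad_op_intro[OF s x A KA Bd KB V yJ])
      show "b *s q' ?z \<in> KB x" unfolding KB[OF x] by (rule rangeI)
    qed
    finally show "T *v y \<in> ad_op M A KA Bd KB x (t *s q ?z) y + KB x" .
  next
    fix u assume "u \<in> A x"
    then have u: "u \<in> Esp I ?z" using A[OF x] by simp
    show "T *v u \<in> S" using T[OF side_imp_Levi(1)[OF s1 u]] ad_eq_0[OF s1 u] by simp
  qed
qed

lemma sides_k: "sides k kb {..<n} {n..<2*n}" and sides_kb: "sides kb k {n..<2*n} {..<n}"
  by (simp_all add: sides_def)

text \<open>
  If \<open>A v = c(v) u\<close> modulo \<open>q\<close>, then \<open>A B A v = c(v) A B u = c(v) c(B u) u = c(B u) A v\<close>.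
\<close>

lemma rank_one_cube:
  assumes s: "sides q q' I J" and x: "x \<in> ball p r"
    and u: "\<And>v. \<exists>c b. ad q I J (cvec x) v = c *s u + b *s q (cvec x)"
  obtains \<nu> where "\<And>v. ad q I J (cvec x) (ad q' J I (cvec x) (ad q I J (cvec x) v)) - \<nu> *s ad q I J (cvec x) v \<in> range (\<lambda>c. c *s q (cvec x))"
proof -
  let ?z = "cvec x" let ?A = "ad q I J (cvec x)" and ?B = "ad q' J I (cvec x)"
  have s': "sides q' q J I" using s by (auto simp: sides_def)
  obtain e where e: "?A (q' ?z) = e *s q ?z" using ad_partner[OF s x] by blast
  obtain f where f: "?B (q ?z) = f *s q' ?z" using ad_partner[OF s' x] by blast
  obtain \<nu> d where \<nu>: "?A (?B u) = \<nu> *s u + d *s q ?z" using u by blast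
  have "?A (?B (?A v)) - \<nu> *s ?A v \<in> range (\<lambda>c. c *s q ?z)" for v
  proof -
    obtain c b where cb: "?A v = c *s u + b *s q ?z" using u by blast
    have "?A (?B (?A v)) = c *s (\<nu> *s u + d *s q ?z) + (b * f * e) *s q ?z"
      by (simp add: cb ad_simps f e \<nu> vector_smult_assoc)
    then have "?A (?B (?A v)) - \<nu> *s ?A v = (c * d + b * f * e - \<nu> * b) *s q ?z"
      by (simp add: cb vec_eq_iff algebra_simps)
    then show ?thesis by (rule range_eqI)
  qed
  then show ?thesis using that by blast
qed

lemma rank_one_conjugate:
  assumes x: "x \<in> ball p r"
    and u: "\<And>v. \<exists>c b. ad kb {n..<2*n} {..<n} (cvec x) v = c *s u + b *s kb (cvec x)"
  shows "\<exists>c b. ad k {..<n} {n..<2*n} (cvec x) v = c *s cnjv u + b *s k (cvec x)"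
proof -
  have z: "cvec x \<in> B" using x by simp
  let ?y = "proj {n..<2*n} (cvec x) v"
  have y: "?y \<in> Esp {n..<2*n} (cvec x)" by (rule proj_Esp[OF z]) auto
  obtain c b where cb: "ad kb {n..<2*n} {..<n} (cvec x) (cnjv ?y) = c *s u + b *s kb (cvec x)" using u by blast
  have "cnjv (ad k {..<n} {n..<2*n} (cvec x) ?y) = c *s u + b *s kb (cvec x)"
    using ad_conj[OF x y] cb by simp
  then have "ad k {..<n} {n..<2*n} (cvec x) ?y = cnjv (c *s u + b *s kb (cvec x))"
    by (metis cnjv_cnjv)
  also have "\<dots> = cnj c *s cnjv u + cnj b *s k (cvec x)" by (simp add: cnjv_simps kb_real)
  finally show ?thesis unfolding ad_proj[OF side_k z] by blast
qed

text \<open>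
  The symbol is regular as soon as \<open>ad\<close> for the conjugate kernel has rank at most one modulo \<open>conj K\<close>. By
  conjugation the same holds for the kernel itself, and the cubes \<open>ABA\<close> and \<open>BAB\<close> are then multiples of \<open>A\<close> and
  \<open>B\<close>.
\<close>

lemma regular_if_rank_one:
  assumes x: "x \<in> ball p r"
    and u: "\<And>v. \<exists>c b. ad kb {n..<2*n} {..<n} (cvec x) v = c *s u + b *s kb (cvec x)"
  shows "regular_symbol M H x"
proof -
  let ?z = "cvec x"
  let ?W = "levi_dist H x" and ?S = "levi_dist (levi_kernel M H) x"
  let ?P = "H x + conj_dist (levi_kernel M H) x" and ?Q = "conj_dist H x + levi_kernel M H x"
  let ?A = "ad k {..<n} {n..<2*n} ?z" and ?B = "ad kb {n..<2*n} {..<n} ?z"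
  let ?\<Sigma> = "{t. \<exists>V\<in>sections_at M (levi_kernel M H) x. V x = t *s k ?z}"
  let ?\<Sigma>' = "{t. \<exists>V\<in>sections_at M (conj_dist (levi_kernel M H)) x. V x = t *s kb ?z}"
  have z: "?z \<in> B" using x by simp
  note W = levi_dist_eq[OF x] and S = levi_dist_kernel_eq[OF x] and Hx = H_eq[OF x] and Hbx = conj_H_eq[OF x]
    and K = K_eq[OF x] and Kb = conj_K_eq[OF x]
  have kz: "k ?z \<in> Esp {..<n} ?z" and kbz: "kb ?z \<in> Esp {n..<2*n} ?z" using k_Esp[OF z] kb_Esp[OF z] .
  have \<omega>k: "\<omega> ?z v w = 0" "\<omega> ?z w v = 0" if v: "v \<in> ?S" for v w
  proof -
    obtain a b where "v = a *s k ?z + b *s kb ?z" using v unfolding S by (auto simp: set_plus_def)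
    then show "\<omega> ?z v w = 0" by (simp add: \<omega>_simps \<omega>_k[OF z] \<omega>_kb[OF z])
    then show "\<omega> ?z w v = 0" using \<omega>_antisym[of ?z w v] by simp
  qed
  have PI: "v \<in> ?P" if "v \<in> Esp {..<n} ?z" for v
    using set_plus_intro[OF that rangeI[of "\<lambda>c. c *s kb ?z" 0]] unfolding Hx Kb by simp
  have QI: "v \<in> ?Q" if "v \<in> Esp {n..<2*n} ?z" for v
    using set_plus_intro[OF that rangeI[of "\<lambda>c. c *s k ?z" 0]] unfolding Hbx K by simp
  have SI: "c *s k ?z \<in> ?S" "c *s kb ?z \<in> ?S" for c
  proof -
    show "c *s k ?z \<in> ?S" unfolding S
      using set_plus_intro[OF rangeI[of "\<lambda>c. c *s k ?z" c] rangeI[of "\<lambda>c. c *s kb ?z" 0]] by simp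
    show "c *s kb ?z \<in> ?S" unfolding S
      using set_plus_intro[OF rangeI[of "\<lambda>c. c *s k ?z" 0] rangeI[of "\<lambda>c. c *s kb ?z" c]] by simp
  qed
  have rK: "\<And>y. y \<in> ball p r \<Longrightarrow> vec.subspace (levi_kernel M H y)"
    "\<And>y. y \<in> ball p r \<Longrightarrow> vec.subspace (conj_dist (levi_kernel M H) y)"
    unfolding K_eq conj_K_eq by (rule subspace_line)+
  note \<Sigma> = section_scalars_closed[OF x open_ball ball_sub rK(1), where v="k ?z"]
    and \<Sigma>' = section_scalars_closed[OF x open_ball ball_sub rK(2), where v="kb ?z"]
  interpret symbol_algebra ?W ?S ?P ?Q "\<omega> ?z" ?A ?B ?\<Sigma> ?\<Sigma>'
  proof
    show "vec.subspace ?W" unfolding W by (rule Esp_subspace)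
    show "vec.subspace ?S" unfolding S by (intro subspace_plus subspace_line)
    show "vec.subspace ?P" unfolding Hx Kb by (intro subspace_plus subspace_line Esp_subspace)
    show "vec.subspace ?Q" unfolding Hbx K by (intro subspace_plus subspace_line Esp_subspace)
    show "?S \<subseteq> ?P" unfolding S Hx Kb by (intro set_plus_mono2 order_refl) (use Esp_simps(4)[OF kz] in auto)
    show "?S \<subseteq> ?Q" unfolding S Hbx K add.commute[of "range (\<lambda>c. c *s k ?z)"]
      by (intro set_plus_mono2 order_refl) (use Esp_simps(4)[OF kbz] in auto)
    have "a + b \<in> Esp {..<2*n} ?z" if "a \<in> Esp {..<n} ?z" "b \<in> Esp {n..<2*n} ?z" for a b
      using Esp_simps(2)[OF Esp_imp_Levi(1)[OF that(1)] Esp_imp_Levi(2)[OF that(2)]] .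
    then show "?P \<subseteq> ?W" "?Q \<subseteq> ?W"
      unfolding W Hx Kb Hbx K using Esp_simps(4)[OF kz] Esp_simps(4)[OF kbz]
      by (auto elim!: set_plus_elim) (metis add.commute)
    show "?A (v + w) = ?A v + ?A w" "?A (c *s v) = c *s ?A v" "?B (v + w) = ?B v + ?B w" "?B (c *s v) = c *s ?B v" for v w c
      by (simp_all add: ad_simps)
    show "?A v \<in> ?P" for v by (rule PI[OF ad_Esp[OF side_k z]])
    show "?B v \<in> ?Q" for v by (rule QI[OF ad_Esp[OF side_kb z]])
    show "?A v \<in> ?S" if v: "v \<in> ?P" for v
    proof -
      obtain h c where h: "v = h + c *s kb ?z" "h \<in> Esp {..<n} ?z"
        using v unfolding Hx Kb by (elim set_plus_elim) blast
      obtain e where e: "?A (kb ?z) = e *s k ?z" using ad_partner[OF sides_k x] by blast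
      have "?A v = (c * e) *s k ?z" by (simp add: h(1) ad_simps e ad_eq_0[OF side_k h(2)] vector_smult_assoc)
      then show ?thesis using SI(1) by simp
    qed
    show "?B v \<in> ?S" if v: "v \<in> ?Q" for v
    proof -
      obtain h c where h: "v = h + c *s k ?z" "h \<in> Esp {n..<2*n} ?z"
        using v unfolding Hbx K by (elim set_plus_elim) blast
      obtain e where e: "?B (k ?z) = e *s kb ?z" using ad_partner[OF sides_kb x] by blast
      have "?B v = (c * e) *s kb ?z" by (simp add: h(1) ad_simps e ad_eq_0[OF side_kb h(2)] vector_smult_assoc)
      then show ?thesis using SI(2) by simp
    qed
    show "\<omega> ?z (?A v) w + \<omega> ?z v (?A w) = 0" "\<omega> ?z (?B v) w + \<omega> ?z v (?B w) = 0" if "v \<in> ?W" "w \<in> ?W" for v w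
      using ad_skew_W[OF side_k z] ad_skew_W[OF side_kb z] that unfolding W by blast+
  qed (simp_all only: \<omega>_simps \<omega>k \<Sigma> \<Sigma>')
  have gl_eq: "gl_lift M H x = gl" unfolding gl_lift_def gl_def ..
  have g02: "g02_lift M H x = lift ?\<Sigma> ?A"
    unfolding g02_lift_def lift_def gl_eq
    using lift_iff[OF sides_k x H_eq K_eq conj_H_eq conj_K_eq levi_dist_def] W by simp
  have S': "?S = conj_dist (levi_kernel M H) x + levi_kernel M H x" unfolding levi_dist_def by (rule add.commute)
  have g0m2: "g0m2_lift M H x = lift ?\<Sigma>' ?B"
    unfolding g0m2_lift_def lift_def gl_eq
    using lift_iff[OF sides_kb x conj_H_eq conj_K_eq H_eq K_eq S'] W by simp
  have csp_eq: "csp_lift M H x = csp"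
  proof -
    have "(\<forall>a\<in>symplectic_form M H x (T *v u) v. \<forall>b\<in>symplectic_form M H x u (T *v v). \<forall>c\<in>symplectic_form M H x u v.
        a + b - l *s c \<in> ?W) \<longleftrightarrow> \<omega> ?z (T *v u) v + \<omega> ?z u (T *v v) = l * \<omega> ?z u v"
      if T: "T \<in> gl" and uv: "u \<in> ?W" "v \<in> ?W" for T u v l
    proof -
      have W_iff: "w \<in> ?W \<longleftrightarrow> \<kappa> (2*n) ?z w = 0" for w unfolding W Esp_top ..
      note sf = symplectic_form_eq[OF x glD(1)[OF T uv(1)] uv(2)] symplectic_form_eq[OF x uv(1) glD(1)[OF T uv(2)]]
        symplectic_form_eq[OF x uv]
      have top: "\<kappa> (2*n) ?z (c *s E (2*n) ?z) = c" for c using E_top[OF z] by (simp add: \<kappa>_scale)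
      show ?thesis
        unfolding sf W_iff
      proof
        assume *: "\<forall>a\<in>{w. \<kappa> (2*n) ?z w = \<omega> ?z (T *v u) v}. \<forall>b\<in>{w. \<kappa> (2*n) ?z w = \<omega> ?z u (T *v v)}.
          \<forall>c\<in>{w. \<kappa> (2*n) ?z w = \<omega> ?z u v}. \<kappa> (2*n) ?z (a + b - l *s c) = 0"
        have "\<kappa> (2*n) ?z (\<omega> ?z (T *v u) v *s E (2*n) ?z + \<omega> ?z u (T *v v) *s E (2*n) ?z - l *s (\<omega> ?z u v *s E (2*n) ?z)) = 0"
          by (intro *[rule_format]) (simp_all add: top)
        then show "\<omega> ?z (T *v u) v + \<omega> ?z u (T *v v) = l * \<omega> ?z u v"
          by (simp only: \<kappa>_simps(1-3)) (simp add: E_top[OF z])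
      qed (simp add: \<kappa>_simps)
    qed
    then show ?thesis unfolding csp_lift_def csp_def gl_eq by (auto cong: conj_cong)
  qed
  obtain \<nu> where \<nu>: "\<And>v. ?A (?B (?A v)) - \<nu> *s ?A v \<in> range (\<lambda>c. c *s k ?z)"
    by (rule rank_one_cube[OF sides_k x rank_one_conjugate[OF x u]], rule that, assumption)
  obtain \<mu> where \<mu>: "\<And>v. ?B (?A (?B v)) - \<mu> *s ?B v \<in> range (\<lambda>c. c *s kb ?z)"
    by (rule rank_one_cube[OF sides_kb x u], rule that, assumption)
  have lines: "range (\<lambda>c. c *s k ?z) \<subseteq> ?S" "range (\<lambda>c. c *s kb ?z) \<subseteq> ?S" using SI by auto
  have "g00_lift M H x = stabilizer"
    unfolding g00_lift_def csp_eq g02 g0m2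
  proof (rule Greatest_equality)
    show "lie_subalgebra stabilizer \<and> stabilizer \<subseteq> csp \<and> (\<forall>T\<in>stabilizer. (*v) T ` ?P \<subseteq> ?P \<and> (*v) T ` ?Q \<subseteq> ?Q) \<and>
      (\<forall>T\<in>stabilizer. \<forall>X\<in>lift ?\<Sigma> ?A. commutator T X \<in> lift ?\<Sigma> ?A) \<and> (\<forall>T\<in>stabilizer. \<forall>X\<in>lift ?\<Sigma>' ?B. commutator T X \<in> lift ?\<Sigma>' ?B)"
      using stabilizer_subalgebra unfolding stabilizer_def by blast
  next
    fix L assume "lie_subalgebra L \<and> L \<subseteq> csp \<and> (\<forall>T\<in>L. (*v) T ` ?P \<subseteq> ?P \<and> (*v) T ` ?Q \<subseteq> ?Q) \<and>
      (\<forall>T\<in>L. \<forall>X\<in>lift ?\<Sigma> ?A. commutator T X \<in> lift ?\<Sigma> ?A) \<and> (\<forall>T\<in>L. \<forall>X\<in>lift ?\<Sigma>' ?B. commutator T X \<in> lift ?\<Sigma>' ?B)"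
    then show "L \<le> stabilizer" unfolding stabilizer_def by blast
  qed
  moreover have "commutator C T \<in> stabilizer" if "C \<in> lift ?\<Sigma>' ?B" "T \<in> lift ?\<Sigma> ?A" for C T
    by (rule commutator_in_stabilizer[OF subsetD[OF lines(1) \<nu>] subsetD[OF lines(2) \<mu>] that])
  ultimately show ?thesis unfolding regular_symbol_def g02 g0m2 by simp
qed

end

section \<open>Uniqueness of the reconstruction\<close>

context cr_chart
begin

lemma E_independent:
  assumes z: "z \<in> B" and I: "I \<subseteq> {..<2*n+1}" and c: "(\<Sum>i\<in>I. c i *s E i z) = 0"
  shows "\<forall>i\<in>I. c i = 0"
proof
  fix i assume i: "i \<in> I"
  then have "\<kappa> i z (\<Sum>i\<in>I. c i *s E i z) = c i" using \<kappa>_lincomb[OF z I, of i c] I by auto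
  then show "c i = 0" using c by simp
qed

lemma dim_Esp:
  assumes z: "z \<in> B" and I: "I \<subseteq> {..<2*n+1}"
  shows "vec.dim (Esp I z) = card I"
proof -
  have fin: "finite I" using I by (rule finite_subset) simp
  note ind = independent_family[OF fin E_independent[OF z I]]
  have "vec.dim (Esp I z) = vec.dim ((\<lambda>i. E i z) ` I)"
    unfolding span_eq_Esp[OF z I, symmetric] by (rule vec.dim_span)
  also have "\<dots> = card ((\<lambda>i. E i z) ` I)" by (rule vec.dim_eq_card_independent[OF ind(2)])
  also have "\<dots> = card I" by (rule card_image[OF ind(1)])
  finally show ?thesis .
qed

end

context levi_chart
begin

text \<open>
  For \<open>a\<close> and \<open>l\<close> in \<open>{n..<2*n}\<close>, linear functionals that vanish on \<open>H\<close> and on \<open>kb\<close>. If \<open>\<kappa> a z (kb z) \<noteq> 0\<close>, then they detect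
  the vectors of \<open>conj H\<close> modulo \<open>kb\<close> (see \<open>\<rho>_zero\<close>).
\<close>

definition \<rho> :: "nat \<Rightarrow> nat \<Rightarrow> complex^'m \<Rightarrow> complex^'m \<Rightarrow> complex" where
  "\<rho> a l z v = \<kappa> l z v * \<kappa> a z (kb z) - \<kappa> a z v * \<kappa> l z (kb z)"

lemma \<rho>_simps: "\<rho> a l z (v + w) = \<rho> a l z v + \<rho> a l z w" "\<rho> a l z (v - w) = \<rho> a l z v - \<rho> a l z w"
  "\<rho> a l z (c *s v) = c * \<rho> a l z v" "\<rho> a l z (kb z) = 0" "\<rho> a l z 0 = 0" "\<rho> a l z (- v) = - \<rho> a l z v"
  by (simp_all add: \<rho>_def \<kappa>_simps algebra_simps)

lemma \<rho>_sum: "\<rho> a l z (\<Sum>i\<in>S. f i) = (\<Sum>i\<in>S. \<rho> a l z (f i))"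
  by (induction S rule: infinite_finite_induct) (simp_all add: \<rho>_simps)

lemma \<rho>_H: "a \<in> {n..<2*n} \<Longrightarrow> l \<in> {n..<2*n} \<Longrightarrow> v \<in> Esp {..<n} z \<Longrightarrow> \<rho> a l z v = 0"
  by (auto simp: \<rho>_def Esp_iff)

lemma \<rho>_proj: "z \<in> B \<Longrightarrow> a \<in> {n..<2*n} \<Longrightarrow> l \<in> {n..<2*n} \<Longrightarrow> \<rho> a l z (proj {n..<2*n} z v) = \<rho> a l z v"
proof -
  assume z: "z \<in> B" and al: "a \<in> {n..<2*n}" "l \<in> {n..<2*n}"
  have sub: "{n..<2*n} \<subseteq> {..<2*n+1}" by auto
  have "\<kappa> j z (proj {n..<2*n} z v) = \<kappa> j z v" if "j \<in> {n..<2*n}" for j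
    unfolding proj_def using \<kappa>_lincomb[OF z sub, of j] that by simp
  then show ?thesis using al by (simp add: \<rho>_def)
qed

lemma \<rho>_zero:
  assumes z: "z \<in> B" and a: "\<kappa> a z (kb z) \<noteq> 0" and w: "w \<in> Esp {n..<2*n} z"
    and 0: "\<And>l. l \<in> {n..<2*n} \<Longrightarrow> \<rho> a l z w = 0"
  shows "w = (\<kappa> a z w / \<kappa> a z (kb z)) *s kb z"
proof -
  let ?c = "\<kappa> a z w / \<kappa> a z (kb z)"
  have sub: "{n..<2*n} \<subseteq> {..<2*n+1}" by auto
  have "w = (\<Sum>l\<in>{n..<2*n}. \<kappa> l z w *s E l z)" by (rule Esp_expand[OF z sub w])
  also have "\<dots> = (\<Sum>l\<in>{n..<2*n}. ?c *s (\<kappa> l z (kb z) *s E l z))"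
  proof (intro sum.cong refl)
    fix l assume "l \<in> {n..<2*n}"
    from 0[OF this] have "\<kappa> l z w = ?c * \<kappa> l z (kb z)" using a by (simp add: \<rho>_def field_simps)
    then show "\<kappa> l z w *s E l z = ?c *s (\<kappa> l z (kb z) *s E l z)" by (simp add: vector_smult_assoc)
  qed
  also have "\<dots> = ?c *s (\<Sum>l\<in>{n..<2*n}. \<kappa> l z (kb z) *s E l z)" by (rule vec.scale_sum_right[symmetric])
  also have "(\<Sum>l\<in>{n..<2*n}. \<kappa> l z (kb z) *s E l z) = kb z" by (rule Esp_expand[OF z sub kb_Esp[OF z], symmetric])
  finally show ?thesis .
qed

abbreviation adb :: "complex^'m \<Rightarrow> complex^'m \<Rightarrow> complex^'m" where
  "adb \<equiv> ad kb {n..<2*n} {..<n}"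

lemma kb_index:
  assumes z: "z \<in> B" obtains a where "a \<in> {n..<2*n}" "\<kappa> a z (kb z) \<noteq> 0"
proof -
  have "\<exists>a\<in>{n..<2*n}. \<kappa> a z (kb z) \<noteq> 0"
  proof (rule ccontr)
    assume "\<not> ?thesis"
    then have "(\<Sum>l\<in>{n..<2*n}. \<kappa> l z (kb z) *s E l z) = 0" by (intro sum.neutral) auto
    moreover have "kb z = (\<Sum>l\<in>{n..<2*n}. \<kappa> l z (kb z) *s E l z)"
      by (rule Esp_expand[OF z _ kb_Esp[OF z]]) auto
    ultimately show False using kb_nz[OF z] by simp
  qed
  then show ?thesis using that by blast
qed

text \<open>
  The two-by-two minors of the matrix of \<open>ad\<close> for \<open>kb\<close> modulo \<open>kb\<close>. Being holomorphic, a minor that is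
  nonzero at \<open>p\<close> is nonzero near \<open>p\<close>.
\<close>

definition minor :: "nat \<Rightarrow> nat \<Rightarrow> nat \<Rightarrow> nat \<Rightarrow> nat \<Rightarrow> complex^'m \<Rightarrow> complex" where
  "minor a i j l l' z = \<rho> a l z (hol_bracket kb (E i) z) * \<rho> a l' z (hol_bracket kb (E j) z)
     - \<rho> a l z (hol_bracket kb (E j) z) * \<rho> a l' z (hol_bracket kb (E i) z)"

lemma \<rho>_adb_frame:
  assumes z: "z \<in> B" and al: "a \<in> {n..<2*n}" "l \<in> {n..<2*n}" and i: "i < n"
  shows "\<rho> a l z (adb z (E i z)) = \<rho> a l z (hol_bracket kb (E i) z)"
  using ad_frame[OF side_kb z, of i] i \<rho>_proj[OF z al] by simp

text \<open>
  If all minors vanish, every column of the matrix is a multiple of a single vector \<open>u\<close>, and the symbol is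
  regular.
\<close>

lemma nonregular_minor_nonzero:
  assumes x: "x \<in> ball p r" and nreg: "\<not> regular_symbol M H x"
  obtains a i j l l' where "a \<in> {n..<2*n}" "l \<in> {n..<2*n}" "l' \<in> {n..<2*n}" "i < n" "j < n" "minor a i j l l' (cvec x) \<noteq> 0"
proof -
  let ?z = "cvec x"
  have z: "?z \<in> B" using x by simp
  obtain a where a: "a \<in> {n..<2*n}" "\<kappa> a ?z (kb ?z) \<noteq> 0" using kb_index[OF z] by blast
  have "\<exists>i<n. \<exists>j<n. \<exists>l\<in>{n..<2*n}. \<exists>l'\<in>{n..<2*n}. minor a i j l l' ?z \<noteq> 0"
  proof (rule ccontr)
    assume "\<not> ?thesis"
    then have 0: "minor a i j l l' ?z = 0" if "i < n" "j < n" "l \<in> {n..<2*n}" "l' \<in> {n..<2*n}" for i j l l'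
      using that by blast
    let ?\<beta> = "\<lambda>i l. \<rho> a l ?z (adb ?z (E i ?z))"
    have m0: "?\<beta> i l * ?\<beta> j l' = ?\<beta> j l * ?\<beta> i l'" if "i < n" "j < n" "l \<in> {n..<2*n}" "l' \<in> {n..<2*n}" for i j l l'
    proof -
      have "?\<beta> i l * ?\<beta> j l' - ?\<beta> j l * ?\<beta> i l' = 0"
        unfolding \<rho>_adb_frame[OF z a(1) that(3,1)] \<rho>_adb_frame[OF z a(1) that(4,2)]
          \<rho>_adb_frame[OF z a(1) that(3,2)] \<rho>_adb_frame[OF z a(1) that(4,1)]
        using 0[OF that] unfolding minor_def .
      then show ?thesis by (rule eq_iff_diff_eq_0[THEN iffD2])
    qed
    have exp: "\<rho> a l ?z (adb ?z v) = (\<Sum>i<n. \<kappa> i ?z v * ?\<beta> i l)" for v l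
      by (subst ad_expand[OF side_kb z]) (simp add: \<rho>_sum \<rho>_simps)
    have "\<exists>u\<in>Esp {n..<2*n} ?z. \<forall>v. \<exists>c. \<forall>l\<in>{n..<2*n}. \<rho> a l ?z (adb ?z v) = c * \<rho> a l ?z u"
    proof (cases "\<exists>i<n. \<exists>l\<in>{n..<2*n}. ?\<beta> i l \<noteq> 0")
      case True
      then obtain i1 l1 where 1: "i1 < n" "l1 \<in> {n..<2*n}" "?\<beta> i1 l1 \<noteq> 0"
        by (elim exE conjE bexE)
      have *: "\<rho> a l ?z (adb ?z v) = (\<Sum>i<n. \<kappa> i ?z v * ?\<beta> i l1 / ?\<beta> i1 l1) * ?\<beta> i1 l" if l: "l \<in> {n..<2*n}" for v l
      proof (rule trans[OF exp], unfold sum_distrib_right, intro sum.cong refl)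
        fix i assume "i \<in> {..<n}"
        then have "i < n" by simp
        then have "?\<beta> i l * ?\<beta> i1 l1 = ?\<beta> i1 l * ?\<beta> i l1" by (rule m0[OF _ 1(1) l 1(2)])
        then have "?\<beta> i l = (?\<beta> i1 l * ?\<beta> i l1) / ?\<beta> i1 l1" by (rule eq_divide_imp[OF 1(3)])
        then have "?\<beta> i l = ?\<beta> i l1 / ?\<beta> i1 l1 * ?\<beta> i1 l" by (rule trans) (simp add: mult.commute)
        then show "\<kappa> i ?z v * ?\<beta> i l = \<kappa> i ?z v * ?\<beta> i l1 / ?\<beta> i1 l1 * ?\<beta> i1 l" by simp
      qed
      show ?thesis
        by (rule bexI[of _ "adb ?z (E i1 ?z)"], intro allI exI ballI, erule *, rule ad_Esp[OF side_kb z])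
    next
      case False
      have *: "\<rho> a l ?z (adb ?z v) = 0 * \<rho> a l ?z 0" if l: "l \<in> {n..<2*n}" for v l
      proof -
        have "?\<beta> i l = 0" if "i < n" for i
        proof (rule ccontr)
          assume "?\<beta> i l \<noteq> 0"
          with l that have "\<exists>i<n. \<exists>l\<in>{n..<2*n}. ?\<beta> i l \<noteq> 0" by (intro exI[of _ i] conjI bexI[of _ l])
          with False show False by (rule notE)
        qed
        then show ?thesis by (intro trans[OF exp]) simp
      qed
      show ?thesis
        by (rule bexI[of _ 0], intro allI exI ballI, erule *, rule Esp_simps(1))
    qed
    then obtain u where u: "u \<in> Esp {n..<2*n} ?z" "\<forall>v. \<exists>c. \<forall>l\<in>{n..<2*n}. \<rho> a l ?z (adb ?z v) = c * \<rho> a l ?z u"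
      by (elim bexE)
    have "\<exists>c b. adb ?z v = c *s u + b *s kb ?z" for v
    proof -
      obtain c where c: "\<forall>l\<in>{n..<2*n}. \<rho> a l ?z (adb ?z v) = c * \<rho> a l ?z u" using u(2) by blast
      let ?w = "adb ?z v - c *s u"
      have "?w = (\<kappa> a ?z ?w / \<kappa> a ?z (kb ?z)) *s kb ?z"
      proof (rule \<rho>_zero[OF z a(2)])
        show "?w \<in> Esp {n..<2*n} ?z" by (intro Esp_simps ad_Esp[OF side_kb z] u(1))
        show "\<rho> a l ?z ?w = 0" if "l \<in> {n..<2*n}" for l using c that by (simp add: \<rho>_simps)
      qed
      then have "adb ?z v = c *s u + (\<kappa> a ?z ?w / \<kappa> a ?z (kb ?z)) *s kb ?z" by (simp add: diff_eq_eq add.commute)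
      then show ?thesis by blast
    qed
    then have "regular_symbol M H x" by (rule regular_if_rank_one[OF x])
    then show False using nreg by blast
  qed
  then show ?thesis using that a(1) by blast
qed

lemma minor_hol:
  assumes "a \<in> {n..<2*n}" "l \<in> {n..<2*n}" "l' \<in> {n..<2*n}" "i < n" "j < n"
  shows "hol B (minor a i j l l')"
  unfolding minor_def[abs_def] \<rho>_def
  using assms
  by (intro hol_diff hol_mult \<kappa>_hol holomorphic_vf_bracket kb_hol E_hol open_ball order_refl) auto

text \<open>
  Near \<open>z\<close> the distribution \<open>H'\<close> is spanned by fields \<open>h m + b m *s kb\<close> with \<open>h m\<close> in \<open>H\<close>. The bracket of two of them has
  to vanish modulo \<open>H\<close> and \<open>kb\<close>, which gives \<open>b m ad (h s) = b s ad (h m)\<close>. If some \<open>b m\<close> were nonzero at \<open>z\<close>, all values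
  of \<open>ad\<close> at \<open>z\<close> would be proportional to \<open>ad (h m)\<close>, and all minors would vanish.
\<close>

lemma subdistribution_unique:
  assumes V: "open V" "V \<subseteq> B" and H': "hol_distribution V n H'" "hol_involutive V H'"
    and sub: "\<And>z. z \<in> V \<Longrightarrow> H' z \<subseteq> Esp {..<n} z + range (\<lambda>c. c *s kb z)"
    and tr: "\<And>z. z \<in> V \<Longrightarrow> H' z \<inter> range (\<lambda>c. c *s kb z) = {0}"
    and z: "z \<in> V" and ix: "a \<in> {n..<2*n}" "l \<in> {n..<2*n}" "l' \<in> {n..<2*n}" "i < n" "j < n"
    and minor: "minor a i j l l' z \<noteq> 0"
  shows "H' z = Esp {..<n} z"
proof -
  have zB: "z \<in> B" using V z by blast
  have "\<exists>U Y. open U \<and> z \<in> U \<and> U \<subseteq> V \<and> (\<forall>i<n. holomorphic_vf U (Y i)) \<and>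
        (\<forall>y\<in>U. H' y = vec.span ((\<lambda>i. Y i y) ` {..<n}) \<and> vec.dim (H' y) = n)"
    using H'(1) z unfolding hol_distribution_def by (rule bspec)
  then obtain U Y where U: "open U" "z \<in> U" "U \<subseteq> V" and Yh: "\<forall>i<n. holomorphic_vf U (Y i)"
    and HY: "\<forall>y\<in>U. H' y = vec.span ((\<lambda>i. Y i y) ` {..<n}) \<and> vec.dim (H' y) = n"
    by (elim exE conjE)
  have UB: "U \<subseteq> B" using U V by blast
  obtain c0 where c0: "c0 \<in> {n..<2*n}" "\<kappa> c0 z (kb z) \<noteq> 0" using kb_index[OF zB] by blast
  have c0lt: "c0 < 2*n+1" "c0 \<notin> {..<n}" using c0(1) by auto
  have hkb: "hol U (\<lambda>z. \<kappa> c0 z (kb z))" by (rule \<kappa>_hol[OF holomorphic_vf_subset[OF kb_hol UB] U(1) UB])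
  obtain N where N: "open N" "z \<in> N" "N \<subseteq> U" "\<And>y. y \<in> N \<Longrightarrow> \<kappa> c0 y (kb y) \<noteq> 0"
    using hol_nonzero_nbhd[OF hkb U(1,2) c0(2)] by blast
  have NB: "N \<subseteq> B" and NV: "N \<subseteq> V" using N UB U by blast+
  have Yh: "holomorphic_vf N (Y m)" if "m < n" for m
    by (rule holomorphic_vf_subset[OF Yh[rule_format, OF that] N(3)])
  have kbh: "holomorphic_vf N kb" by (rule holomorphic_vf_subset[OF kb_hol NB])
  have YH: "Y m y \<in> H' y" if "m < n" "y \<in> N" for m y
  proof -
    have "H' y = vec.span ((\<lambda>i. Y i y) ` {..<n})" using HY N(3) that(2) by blast
    moreover have "Y m y \<in> vec.span ((\<lambda>i. Y i y) ` {..<n})" by (rule vec.span_base) (use that in auto)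
    ultimately show ?thesis by simp
  qed
  \<comment> \<open>reading off the \<open>c0\<close>-coordinate, which vanishes on \<open>H\<close>\<close>
  define b where "b m y = \<kappa> c0 y (Y m y) / \<kappa> c0 y (kb y)" for m y
  define h where "h m y = Y m y - b m y *s kb y" for m y
  have bh: "hol N (b m)" if "m < n" for m
    unfolding b_def[abs_def] by (intro hol_divide \<kappa>_hol Yh[OF that] kbh N(1,4) NB)
  have bkh: "holomorphic_vf N (\<lambda>y. b m y *s kb y)" if "m < n" for m
    by (rule holomorphic_vf_scale[OF bh[OF that] kbh])
  have hh: "holomorphic_vf N (h m)" if "m < n" for m
    using Yh[OF that] bkh[OF that] unfolding h_def[abs_def] holomorphic_vf_iff by (auto intro!: hol_diff)
  have hE: "h m y \<in> Esp {..<n} y" if my: "m < n" "y \<in> N" for m y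
  proof -
    have "y \<in> V" using NV my(2) by blast
    then have "Y m y \<in> Esp {..<n} y + range (\<lambda>c. c *s kb y)" using YH[OF my] sub by blast
    then obtain g c where g: "Y m y = g + c *s kb y" "g \<in> Esp {..<n} y"
      by (elim set_plus_elim) blast
    have "\<kappa> c0 y g = 0" using g(2) c0lt unfolding Esp_iff by blast
    then have "b m y = c" using N(4)[OF my(2)] by (simp add: b_def g(1) \<kappa>_simps)
    then show ?thesis using g by (simp add: h_def)
  qed
  have involutive_relation: "b m z * \<rho> a q z (adb z (h s z)) = b s z * \<rho> a q z (adb z (h m z))"
    if m: "m < n" and s: "s < n" and q: "q \<in> {n..<2*n}" for m s q
  proof -
    note al = ix(1) q
    have Ysec: "Y t \<in> hol_sections_at V H' z" if "t < n" for t
      unfolding hol_sections_at_def mem_Collect_eq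
      by (intro exI[of _ N] conjI ballI N(1,2) NV Yh[OF that] YH[OF that])
    have "hol_bracket (Y m) (Y s) z \<in> H' z"
      using H'(2) z Ysec[OF m] Ysec[OF s] unfolding hol_involutive_def by blast
    then have "hol_bracket (Y m) (Y s) z \<in> Esp {..<n} z + range (\<lambda>c. c *s kb z)" using sub[OF z] by blast
    then obtain g c where g: "hol_bracket (Y m) (Y s) z = g + c *s kb z" "g \<in> Esp {..<n} z"
      by (elim set_plus_elim) blast
    have \<rho>0: "\<rho> a q z (hol_bracket (Y m) (Y s) z) = 0"
      unfolding g(1) \<rho>_simps using \<rho>_H[OF al g(2)] by simp
    have "hol_bracket (Y m) (Y s) z = hol_bracket (\<lambda>y. h m y + b m y *s kb y) (\<lambda>y. h s y + b s y *s kb y) z"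
      by (simp add: h_def)
    also have "\<dots> = hol_bracket (h m) (h s) z + hol_bracket (h m) (\<lambda>y. b s y *s kb y) z
        + hol_bracket (\<lambda>y. b m y *s kb y) (h s) z + hol_bracket (\<lambda>y. b m y *s kb y) (\<lambda>y. b s y *s kb y) z"
      by (rule hol_bracket_add[OF hh[OF m] hh[OF s] bkh[OF m] bkh[OF s] N(2)])
    finally have split: "hol_bracket (Y m) (Y s) z = \<dots>" .
    have mixed: "\<rho> a q z (hol_bracket (\<lambda>y. b t y *s kb y) (h t') z) = b t z * \<rho> a q z (adb z (h t' z))"
      if t: "t < n" "t' < n" for t t'
    proof -
      obtain c where c: "proj {n..<2*n} z (hol_bracket (\<lambda>y. b t y *s kb y) (h t') z) = b t z *s adb z (h t' z) - c *s kb z"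
        by (rule ad_bracket[OF side_kb bh[OF t(1)] refl hh[OF t(2)] hE[OF t(2)] N(1) NB N(2)], assumption, rule that, assumption)
      have "\<rho> a q z (hol_bracket (\<lambda>y. b t y *s kb y) (h t') z) = \<rho> a q z (b t z *s adb z (h t' z) - c *s kb z)"
        unfolding c[symmetric] by (rule \<rho>_proj[OF zB al, symmetric])
      then show ?thesis by (simp add: \<rho>_simps)
    qed
    have r1: "\<rho> a q z (hol_bracket (h m) (h s) z) = 0"
      by (rule \<rho>_H[OF al H_involutive[OF hh[OF m] hE[OF m] hh[OF s] hE[OF s] N(1) NB N(2)]])
    have r2: "\<rho> a q z (hol_bracket (h m) (\<lambda>y. b s y *s kb y) z) = - (b s z * \<rho> a q z (adb z (h m z)))"
      by (subst hol_bracket_antisym) (simp only: \<rho>_simps mixed[OF s m])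
    have "hol_bracket (\<lambda>y. b m y *s kb y) (\<lambda>y. b s y *s kb y) z
       = (\<Sum>i\<in>{0::nat}. \<Sum>j\<in>{0::nat}. (b m z * b s z) *s hol_bracket kb kb z)
        + (\<Sum>j\<in>{0::nat}. fd (b s) z (b m z *s kb z) *s kb z) - (\<Sum>i\<in>{0::nat}. fd (b m) z (b s z *s kb z) *s kb z)"
      by (rule hol_bracket_lincomb[where V=N]) (simp_all add: kbh bh m s N)
    then have r4: "\<rho> a q z (hol_bracket (\<lambda>y. b m y *s kb y) (\<lambda>y. b s y *s kb y) z) = 0"
      by (simp add: \<rho>_simps hol_bracket_def)
    show ?thesis using \<rho>0 unfolding split \<rho>_simps r1 r2 r4 mixed[OF m s] by simp
  qed
  have "b m z = 0" if m: "m < n" for m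
  proof (rule ccontr)
    assume bm: "b m z \<noteq> 0"
    have "H' z = vec.span ((\<lambda>i. Y i z) ` {..<n})" "vec.dim (H' z) = n" using HY U(2) by blast+
    then have Yind: "c t = 0" if "(\<Sum>i<n. c i *s Y i z) = 0" "t < n" for c t
      using frame_independent[of "\<lambda>i. Y i z" n c t] that by simp
    have H'sub: "vec.subspace (H' z)" using \<open>H' z = _\<close> vec.subspace_span by simp
    have hind: "\<forall>i\<in>{..<n}. c i = 0" if c: "(\<Sum>i<n. c i *s h i z) = 0" for c
    proof -
      have "(\<Sum>i<n. c i *s Y i z) = (\<Sum>i<n. c i *s h i z) + (\<Sum>i<n. c i * b i z) *s kb z"
        by (simp add: h_def vec.scale_right_diff_distrib sum_subtractf vec.scale_sum_left)
      then have "(\<Sum>i<n. c i *s Y i z) = (\<Sum>i<n. c i * b i z) *s kb z" using c by simp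
      moreover have "(\<Sum>i<n. c i *s Y i z) \<in> H' z"
        by (intro vec.subspace_sum[OF H'sub] vec.subspace_scale[OF H'sub] YH N(2)) auto
      ultimately have "(\<Sum>i<n. c i *s Y i z) \<in> H' z \<inter> range (\<lambda>c. c *s kb z)" by auto
      then have "(\<Sum>i<n. c i *s Y i z) = 0" using tr[OF z] by blast
      then show ?thesis using Yind by blast
    qed
    note ind = independent_family[where f="\<lambda>i. h i z", OF finite_lessThan hind]
    have span: "Esp {..<n} z \<subseteq> vec.span ((\<lambda>i. h i z) ` {..<n})"
    proof (rule vec.card_ge_dim_independent)
      show "(\<lambda>i. h i z) ` {..<n} \<subseteq> Esp {..<n} z" using hE N(2) by auto
      show "vec.independent ((\<lambda>i. h i z) ` {..<n})" by (rule ind(2))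
      show "vec.dim (Esp {..<n} z) \<le> card ((\<lambda>i. h i z) ` {..<n})"
        using dim_Esp[OF zB, of "{..<n}"] card_image[OF ind(1)] by auto
    qed
    have ad_proportional: "\<exists>C. \<forall>q\<in>{n..<2*n}. \<rho> a q z (adb z v) = C * \<rho> a q z (adb z (h m z))" if v: "v \<in> Esp {..<n} z" for v
    proof -
      have "v \<in> vec.span ((\<lambda>i. h i z) ` {..<n})" using span v by blast
      then show ?thesis
      proof (induction v rule: vec.span_induct_alt)
        case base
        have "\<rho> a q z (adb z 0) = 0" for q by (simp add: ad_def \<rho>_simps proj_simps)
        then show ?case by (intro exI[of _ 0]) simp
      next
        case (step c w y)
        obtain s where s: "s < n" "w = h s z" using step(1) by blast
        obtain C where C: "\<forall>q\<in>{n..<2*n}. \<rho> a q z (adb z y) = C * \<rho> a q z (adb z (h m z))" using step(2) by blast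
        have "\<rho> a q z (adb z (c *s w + y)) = (c * (b s z / b m z) + C) * \<rho> a q z (adb z (h m z))" if q: "q \<in> {n..<2*n}" for q
        proof -
          have "\<rho> a q z (adb z (h s z)) = b s z / b m z * \<rho> a q z (adb z (h m z))"
            using involutive_relation[OF m s(1) q] bm by (simp add: field_simps)
          then show ?thesis using C q by (simp add: ad_simps \<rho>_simps s(2) algebra_simps)
        qed
        then show ?case by blast
      qed
    qed
    have Ein: "E t z \<in> Esp {..<n} z" if "t < n" for t by (rule E_in_Esp[OF zB]) (use that in auto)
    obtain C where C: "\<forall>q\<in>{n..<2*n}. \<rho> a q z (adb z (E i z)) = C * \<rho> a q z (adb z (h m z))" using ad_proportional[OF Ein[OF ix(4)]] by blast
    obtain D where D: "\<forall>q\<in>{n..<2*n}. \<rho> a q z (adb z (E j z)) = D * \<rho> a q z (adb z (h m z))" using ad_proportional[OF Ein[OF ix(5)]] by blast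
    have "minor a i j l l' z = 0"
    proof -
      have 1: "\<rho> a q z (hol_bracket kb (E i) z) = C * \<rho> a q z (adb z (h m z))"
        and 2: "\<rho> a q z (hol_bracket kb (E j) z) = D * \<rho> a q z (adb z (h m z))" if q: "q \<in> {n..<2*n}" for q
        using trans[OF \<rho>_adb_frame[OF zB ix(1) q ix(4), symmetric] bspec[OF C q]]
          trans[OF \<rho>_adb_frame[OF zB ix(1) q ix(5), symmetric] bspec[OF D q]] .
      show ?thesis unfolding minor_def 1[OF ix(2)] 1[OF ix(3)] 2[OF ix(2)] 2[OF ix(3)] by simp
    qed
    then show False using minor by simp
  qed
  then have "Y m z \<in> Esp {..<n} z" if "m < n" for m
    using hE[OF that N(2)] that by (simp add: h_def)
  then have le: "H' z \<subseteq> Esp {..<n} z"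
    using HY U(2) vec.span_minimal[OF _ Esp_subspace, of "(\<lambda>i. Y i z) ` {..<n}" "{..<n}" z] by auto
  show ?thesis
  proof (rule vec.subspace_dim_equal[OF _ Esp_subspace le])
    show "vec.subspace (H' z)" using HY U(2) vec.subspace_span by simp
    show "vec.dim (H' z) \<ge> vec.dim (Esp {..<n} z)"
    proof -
      have "vec.dim (H' z) = n" using HY U(2) by blast
      moreover have "vec.dim (Esp {..<n} z) = card {..<n}" by (rule dim_Esp[OF zB]) auto
      ultimately show ?thesis by simp
    qed
  qed
qed

lemma recoverable_if_nonregular:
  assumes nreg: "\<not> regular_symbol M H p"
  shows "recoverable_near n M H p"
proof -
  have p: "p \<in> ball p r" "cvec p \<in> B" using r by auto
  obtain a i j l l' where ix: "a \<in> {n..<2*n}" "l \<in> {n..<2*n}" "l' \<in> {n..<2*n}" "i < n" "j < n"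
    and nz: "minor a i j l l' (cvec p) \<noteq> 0"
    by (rule nonregular_minor_nonzero[OF p(1) nreg])
  obtain N where N: "open N" "cvec p \<in> N" "N \<subseteq> B" "\<And>z. z \<in> N \<Longrightarrow> minor a i j l l' z \<noteq> 0"
    using hol_nonzero_nbhd[OF minor_hol[OF ix] open_ball p(2) nz] by blast
  obtain e where e: "e > 0" "ball (cvec p) e \<subseteq> N" using N openE by blast
  let ?\<Omega> = "ball (cvec p) e" let ?Hc = "Esp {..<n}" let ?Kc = "\<lambda>z. range (\<lambda>c. c *s k z)"
  have \<Omega>B: "?\<Omega> \<subseteq> B" using e N by blast
  have tauK: "tau_dist ?Kc z = range (\<lambda>c. c *s kb z)" for z
  proof -
    have "cnjv ` range (\<lambda>c. c *s k (cnjv z)) = (\<lambda>c. c *s kb z) ` range cnj"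
      by (simp add: image_image cnjv_simps kb_def conj_vf_def)
    moreover have "range cnj = UNIV" by (metis complex_cnj_cnj surjI)
    ultimately show ?thesis by (simp add: tau_dist_def)
  qed
  have Hdist: "hol_distribution V n ?Hc" if "open V" "V \<subseteq> B" for V
    unfolding hol_distribution_def
  proof (intro ballI exI[of _ V] exI[of _ E] conjI allI impI)
    show "holomorphic_vf V (E i)" if "i < n" for i
      by (rule holomorphic_vf_subset[OF E_hol]) (use that \<open>V \<subseteq> B\<close> in auto)
    fix z assume "z \<in> V"
    then have z: "z \<in> B" using \<open>V \<subseteq> B\<close> by blast
    show "?Hc z = vec.span ((\<lambda>i. E i z) ` {..<n})" by (rule span_eq_Esp[OF z, symmetric]) auto
    show "vec.dim (?Hc z) = n" using dim_Esp[OF z, of "{..<n}"] by auto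
  qed (use that in auto)
  have Kdist: "hol_distribution ?\<Omega> 1 ?Kc"
    unfolding hol_distribution_def
  proof (intro ballI exI[of _ ?\<Omega>] exI[of _ "\<lambda>_. k"] conjI allI impI)
    show "holomorphic_vf ?\<Omega> k" by (rule holomorphic_vf_subset[OF k_hol \<Omega>B])
    fix z assume "z \<in> ?\<Omega>"
    then have z: "z \<in> B" using \<Omega>B by blast
    have im: "(\<lambda>i. k z) ` {..<1::nat} = {k z}" by auto
    show "?Kc z = vec.span ((\<lambda>i. k z) ` {..<1::nat})" unfolding im vec.span_singleton ..
    have "vec.independent {k z}" using k_nz[OF z] by (simp add: vec.dependent_single)
    then have "vec.dim (vec.span {k z}) = card {k z}" by (rule vec.dim_span_eq_card_independent)
    then have "vec.dim (vec.span {k z}) = 1" by simp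
    then show "vec.dim (?Kc z) = 1" by (simp add: vec.span_singleton)
  qed auto
  have compl: "complexification n M H ?\<Omega> ?Hc ?Kc"
    unfolding complexification_def
  proof (intro conjI allI impI)
    show "cnjv ` ?\<Omega> = ?\<Omega>"
    proof (intro equalityI subsetI)
      fix z assume "z \<in> ?\<Omega>"
      then have "cnjv z \<in> ?\<Omega>" using cnjv_ball by blast
      then have "cnjv (cnjv z) \<in> cnjv ` ?\<Omega>" by (rule imageI)
      then show "z \<in> cnjv ` ?\<Omega>" by simp
    qed (use cnjv_ball in blast)
    have in_ball: "x \<in> ball p r" if "cvec x \<in> ?\<Omega>" for x using that \<Omega>B cvec_B by blast
    then show "{x. cvec x \<in> ?\<Omega>} \<subseteq> M" using ball_sub by blast
    show "hol_distribution ?\<Omega> n ?Hc" by (rule Hdist[OF open_ball \<Omega>B])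
    show "\<exists>k. hol_distribution ?\<Omega> k ?Kc" using Kdist by blast
    fix x assume x: "cvec x \<in> ?\<Omega>"
    show "?Hc (cvec x) = H x" by (rule H_eq[OF in_ball[OF x], symmetric])
    show "?Kc (cvec x) = levi_kernel M H x" by (rule K_eq[OF in_ball[OF x], symmetric])
  qed (auto intro: convex_connected)
  show ?thesis
    unfolding recoverable_near_def
  proof (intro exI conjI allI impI iffI)
    show "cvec p \<in> ?\<Omega>" using e by simp
    show "complexification n M H ?\<Omega> ?Hc ?Kc" by (rule compl)
  next
    fix V H' assume V: "open V \<and> V \<subseteq> ?\<Omega>"
      and H': "hol_distribution V n H' \<and> hol_involutive V H' \<and>
             (\<forall>z\<in>V. H' z \<subseteq> ?Hc z + tau_dist ?Kc z \<and> ?Kc z \<subseteq> H' z \<and> H' z \<inter> tau_dist ?Kc z = {0})"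
    have VB: "V \<subseteq> B" using V \<Omega>B by blast
    show "\<forall>z\<in>V. H' z = ?Hc z"
    proof
      fix z assume z: "z \<in> V"
      show "H' z = ?Hc z"
      proof (rule subdistribution_unique[OF _ VB _ _ _ _ z ix])
        show "minor a i j l l' z \<noteq> 0" using N(4) e(2) V z by blast
      qed (use V H' in \<open>auto simp: tauK\<close>)
    qed
  next
    fix V H' assume V: "open V \<and> V \<subseteq> ?\<Omega>" and eq: "\<forall>z\<in>V. H' z = ?Hc z"
    have VB: "V \<subseteq> B" using V \<Omega>B by blast
    show "hol_distribution V n H'"
    proof -
      have "hol_distribution V n ?Hc" using Hdist VB V by simp
      then have "\<exists>U X. open U \<and> c \<in> U \<and> U \<subseteq> V \<and> (\<forall>i<n. holomorphic_vf U (X i)) \<and>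
        (\<forall>z\<in>U. H' z = vec.span ((\<lambda>i. X i z) ` {..<n}) \<and> vec.dim (H' z) = n)" if c: "c \<in> V" for c
      proof -
        have "\<exists>U X. open U \<and> c \<in> U \<and> U \<subseteq> V \<and> (\<forall>i<n. holomorphic_vf U (X i)) \<and>
          (\<forall>z\<in>U. ?Hc z = vec.span ((\<lambda>i. X i z) ` {..<n}) \<and> vec.dim (?Hc z) = n)"
          using \<open>hol_distribution V n ?Hc\<close> c unfolding hol_distribution_def by (rule bspec)
        then obtain U X where U: "open U" "c \<in> U" "U \<subseteq> V" "\<forall>i<n. holomorphic_vf U (X i)"
          "\<forall>z\<in>U. ?Hc z = vec.span ((\<lambda>i. X i z) ` {..<n}) \<and> vec.dim (?Hc z) = n"
          by (elim exE conjE)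
        have "H' z = ?Hc z" if "z \<in> U" for z using eq U(3) that by blast
        then have "\<forall>z\<in>U. H' z = vec.span ((\<lambda>i. X i z) ` {..<n}) \<and> vec.dim (H' z) = n"
          using U(5) by metis
        with U(1-4) show ?thesis by (intro exI conjI)
      qed
      then show ?thesis unfolding hol_distribution_def by (rule ballI)
    qed
    show "hol_involutive V H'"
      unfolding hol_involutive_def
    proof (intro ballI)
      fix z X Y assume z: "z \<in> V" and X: "X \<in> hol_sections_at V H' z" and Y: "Y \<in> hol_sections_at V H' z"
      obtain U where U: "open U" "z \<in> U" "U \<subseteq> V" "holomorphic_vf U X" "\<forall>y\<in>U. X y \<in> H' y"
        using X unfolding hol_sections_at_def by blast
      obtain U' where U': "open U'" "z \<in> U'" "U' \<subseteq> V" "holomorphic_vf U' Y" "\<forall>y\<in>U'. Y y \<in> H' y"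
        using Y unfolding hol_sections_at_def by blast
      have "hol_bracket X Y z \<in> ?Hc z"
      proof (rule H_involutive[where V="U \<inter> U'"])
        show "holomorphic_vf (U \<inter> U') X" by (rule holomorphic_vf_subset[OF U(4)]) auto
        show "holomorphic_vf (U \<inter> U') Y" by (rule holomorphic_vf_subset[OF U'(4)]) auto
        show "X y \<in> ?Hc y" if "y \<in> U \<inter> U'" for y using that U(3,5) eq by blast
        show "Y y \<in> ?Hc y" if "y \<in> U \<inter> U'" for y using that U'(3,5) eq by blast
      qed (use U U' VB in auto)
      then show "hol_bracket X Y z \<in> H' z" using eq z by simp
    qed
    show "\<forall>z\<in>V. H' z \<subseteq> ?Hc z + tau_dist ?Kc z \<and> ?Kc z \<subseteq> H' z \<and> H' z \<inter> tau_dist ?Kc z = {0}"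
    proof (intro ballI conjI)
      fix z assume z: "z \<in> V"
      then have zB: "z \<in> B" using VB by blast
      have H'z: "H' z = ?Hc z" using eq z by blast
      show "H' z \<subseteq> ?Hc z + tau_dist ?Kc z"
      proof
        fix v assume "v \<in> H' z"
        then have "v + 0 *s kb z \<in> ?Hc z + tau_dist ?Kc z" unfolding tauK H'z by (rule set_plus_intro[OF _ rangeI])
        then show "v \<in> ?Hc z + tau_dist ?Kc z" by simp
      qed
      show "?Kc z \<subseteq> H' z" unfolding H'z using Esp_simps(4)[OF k_Esp[OF zB]] by auto
      show "H' z \<inter> tau_dist ?Kc z = {0}"
      proof -
        have "v = 0" if v: "v \<in> Esp {..<n} z" "v \<in> range (\<lambda>c. c *s kb z)" for v
        proof -
          have "v \<in> Esp {n..<2*n} z" using v(2) Esp_simps(4)[OF kb_Esp[OF zB]] by auto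
          then have "proj {..<n} z v = 0" by (intro proj_eq_0) auto
          moreover have "proj {..<n} z v = v" by (rule proj_ident[OF zB _ v(1)]) auto
          ultimately show "v = 0" by simp
        qed
        moreover have "0 \<in> range (\<lambda>c. c *s kb z)" by (rule range_eqI[of _ _ 0]) simp
        ultimately show ?thesis unfolding H'z tauK using Esp_simps(1)[of "{..<n}" z] by blast
      qed
    qed
  qed
qed

end

theorem corollary3p7:
  fixes n :: nat and M :: "(real^'m) set" and H :: "real^'m \<Rightarrow> (complex^'m) set"
    and p :: "real^'m"
  assumes "cr_structure n M H"
    and "two_nondegenerate M H"
    and "\<forall>q\<in>M. vec.dim (levi_kernel M H q) = 1"
    and "p \<in> M"
    and "\<not> regular_symbol M H p"
  shows "recoverable_near n M H p"
proof -
  obtain r E \<kappa> where chart: "cr_chart n M H p r E \<kappa>"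
    by (rule cr_chart_exists[OF assms(1,4)])
  obtain r' k where k: "0 < r'" "r' \<le> r" "holomorphic_vf (ball (cvec p) r') k"
    "\<And>z. z \<in> ball (cvec p) r' \<Longrightarrow> k z \<noteq> 0"
    "\<And>x. x \<in> ball p r' \<Longrightarrow> levi_kernel M H x = range (\<lambda>c. c *s k (cvec x))"
    by (rule cr_chart.levi_kernel_frame[OF chart assms(3)], rule that, assumption+)
  interpret cr_chart n M H p r' E \<kappa> by (rule cr_chart_shrink[OF chart k(1,2)])
  interpret levi_chart n M H p r' E \<kappa> k
    by unfold_locales (use k in auto)
  show ?thesis by (rule recoverable_if_nonregular[OF assms(5)])
qed

end
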